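(* Let $T>0$ and let $(u_{\mathrm{ini}},\xi_{\mathrm{ini}})$ be admissible initial data. For $0<\varepsilon^2\le T$ let $\xi_\varepsilon,q_\varepsilon,f_\varepsilon,p_\varepsilon$ be the piecewise-constant-in-time functions produced by the scheme. There exist subsequences for $\varepsilon\to0$ with the following properties. 1. $\xi_\varepsilon\to\xi_0$ in $L^\infty([0,T])$ for a limit function $\xi_0\in W^{1,\infty}([0,T])$. 2. $q_\varepsilon$ converges to $q_0\in C([0,T]\times\mathbb{R})$ in $L^\infty([0,T]\times\mathbb{R})$ and therefore pointwise almost everywhere, where $q_0$ is the solution of the heat equation $\partial_tq_0=\partial_x^2q_0$ with initial data $q_0(0,\cdot)=p_{\mathrm{ini}}$. 3. There exists a limit function $f_0\in C([0,T]\times\mathbb{R})$ such that $f_\varepsilon$ converges to $f_0$ pointwise almost everywhere as well as in $L^\infty(K)$ for every compact subset $K\subset[0,T]\times\mathbb{R}$. In particular, $$p_\varepsilon=q_\varepsilon-f_\varepsilon\ \xrightarrow{\ \varepsilon\to0\ }\ q_0-f_0=:p_0$$ in $L^\infty(K)$ for every compact $K\subset[0,T]\times\mathbb{R}$ and pointwise almost everywhere.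
   Context: Kernels: $g_\varepsilon(x)=\frac{1}{2\varepsilon}\exp(-|x|/\varepsilon)$; $s_\varepsilon(x)=-\exp(x/\varepsilon)$ for $x\le0$, $s_\varepsilon(x)=+\exp(-x/\varepsilon)$ for $x>0$. Write $g_\varepsilon^{\ast k}$ for the $k$-fold convolution power ($g_\varepsilon^{\ast0}\ast$ is the identity). Scheme: starting from $(u^0,\xi^0)=(u_{\mathrm{ini}},\xi_{\mathrm{ini}})$, define $(u^{n+1},\xi^{n+1})$ from $(u^n,\xi^n)$ as follows. 1. Set $\tilde u^n:=g_\varepsilon\ast u^n$. 2. If $\tilde u^n(\xi^n)>1$, choose the maximal $\xi^{n+1}<\xi^n$ with $\tilde u^n(\xi^{n+1})=+1$; if $\tilde u^n(\xi^n)<-1$, choose the minimal $\xi^{n+1}>\xi^n$ with $\tilde u^n(\xi^{n+1})=-1$; if $\tilde u^n(\xi^n)\in[-1,1]$, set $\xi^{n+1}=\xi^n$. 3. Set $u^{n+1}=\tilde u^n+s_\varepsilon(\cdot-\xi^{n+1})$. Admissible single-interface state $(u,\xi)$: (i) $u:\mathbb{R}\to\mathbb{R}$ is continuous for $x<\xi$ and for $x>\xi$; (ii) $\lim_{x\searrow\xi}u(x)-\lim_{x\nearrow\xi}u(x)=2$; (iii) $-2\le u(x)\le0$ for $x\le\xi$ and $u(x)\ge0$ for $x>\xi$; (iv) there is $\alpha>0$ with $u(x)\le\alpha(x-\xi)+2$ for all $x>\xi$. Admissibility with the same $\alpha$ is preserved by the iteration step. Admissible initial data (independent of $\varepsilon$):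 $(u_{\mathrm{ini}},\xi_{\mathrm{ini}})$ is an admissible single-interface state, $\xi_{\mathrm{ini}}=0$, and $p_{\mathrm{ini}}=u_{\mathrm{ini}}-\mathrm{sgn}(\cdot-\xi_{\mathrm{ini}})$ (extended continuously to $x=\xi_{\mathrm{ini}}$) has a distributional second derivative that is a signed measure with finite mass. Derived quantities: $p^n:=u^n-\mathrm{sgn}(\cdot-\xi^n)$ (extended continuously to $x=\xi^n$); regular part $q^0:=p^0=p_{\mathrm{ini}}$, $q^{n+1}:=g_\varepsilon\ast q^n$; local fluctuations $r^n:=g_\varepsilon\ast\mathrm{sgn}(\cdot-\xi^{n+1})-g_\varepsilon\ast\mathrm{sgn}(\cdot-\xi^n)$; global fluctuations $f^0:=0$, $f^n:=\sum_{i=1}^ng_\varepsilon^{\ast(n-i)}\ast r^{i-1}$. One has $p^n=q^n-f^n$. Interpolation: for $t\in[n\varepsilon^2,(n+1)\varepsilon^2)$, $t\in[0,T]$, set $\xi_\varepsilon(t):=\xi^n$, $p_\varepsilon(t,x):=p^n(x)$, $q_\varepsilon(t,x):=q^n(x)$, $f_\varepsilon(t,x):=f^n(x)$. The solution $q_0$ of the heat equation is the one given by convolution of $p_{\mathrm{ini}}$ with the heat kernel $\frac{1}{\sqrt{4\pi t}}\exp(-x^2/(4t))$. *)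

theory Defs
  imports "HOL-Probability.Essential_Supremum"
begin

section \<open>Function spaces and distributions\<close>

definition in_Linf :: "'a measure \<Rightarrow> ('a \<Rightarrow> real) \<Rightarrow> bool" where
  "in_Linf M f \<longleftrightarrow> f \<in> borel_measurable M \<and> esssup M (\<lambda>x. ennreal \<bar>f x\<bar>) < \<infinity>"

text \<open>The essential supremum is taken in \<^typ>\<open>ennreal\<close>, so that it is 0 (and not minus infinity)
  on a null set. The members of the sequence and the limit may be unbounded; only the differences
  have to be in the space.\<close>

definition tendsto_Linf :: "'a measure \<Rightarrow> (nat \<Rightarrow> 'a \<Rightarrow> real) \<Rightarrow> ('a \<Rightarrow> real) \<Rightarrow> bool" where
  "tendsto_Linf M F f \<longleftrightarrow>
     (\<forall>k. in_Linf M (\<lambda>x. F k x - f x)) \<and>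
     (\<lambda>k. esssup M (\<lambda>x. ennreal \<bar>F k x - f x\<bar>)) \<longlonglongrightarrow> 0"

definition test_function :: "real set \<Rightarrow> (real \<Rightarrow> real) \<Rightarrow> bool" where
  "test_function U \<phi> \<longleftrightarrow>
     (\<forall>k. (deriv ^^ k) \<phi> differentiable_on UNIV) \<and>
     compact (closure {x. \<phi> x \<noteq> 0}) \<and> closure {x. \<phi> x \<noteq> 0} \<subseteq> U"

definition W1_inf :: "real \<Rightarrow> real \<Rightarrow> (real \<Rightarrow> real) \<Rightarrow> bool" where
  "W1_inf a b f \<longleftrightarrow>
     in_Linf (lebesgue_on {a..b}) f \<and>
     (\<exists>v. in_Linf (lebesgue_on {a..b}) v \<and>
       (\<forall>\<phi>. test_function {a<..<b} \<phi> \<longrightarrow>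
         (LINT t|lebesgue_on {a..b}. f t * deriv \<phi> t) = - (LINT t|lebesgue_on {a..b}. v t * \<phi> t)))"

text \<open>A signed measure of finite mass is represented as a difference of two finite measures.\<close>

definition second_derivative_finite_measure :: "(real \<Rightarrow> real) \<Rightarrow> bool" where
  "second_derivative_finite_measure p \<longleftrightarrow>
     (\<exists>\<mu> \<nu> :: real measure.
        finite_measure \<mu> \<and> sets \<mu> = sets borel \<and> finite_measure \<nu> \<and> sets \<nu> = sets borel \<and>
        (\<forall>\<phi>. test_function UNIV \<phi> \<longrightarrow>
          (LINT x|lborel. p x * deriv (deriv \<phi>) x) = (LINT x|\<mu>. \<phi> x) - (LINT x|\<nu>. \<phi> x)))"

section \<open>Kernels and convolution\<close>

definition conv :: "(real \<Rightarrow> real) \<Rightarrow> (real \<Rightarrow> real) \<Rightarrow> real \<Rightarrow> real" where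
  "conv g h x = (LINT y|lborel. g (x - y) * h y)"

text \<open>\<open>kernel_pow g k\<close> is the \<open>(k + 1)\<close>-fold convolution power of \<open>g\<close>.\<close>

primrec kernel_pow :: "(real \<Rightarrow> real) \<Rightarrow> nat \<Rightarrow> real \<Rightarrow> real" where
  "kernel_pow g 0 = g"
| "kernel_pow g (Suc k) = conv g (kernel_pow g k)"

text \<open>Convolution with the \<open>k\<close>-fold convolution power; the identity for \<open>k = 0\<close>.\<close>

definition conv_pow :: "(real \<Rightarrow> real) \<Rightarrow> nat \<Rightarrow> (real \<Rightarrow> real) \<Rightarrow> real \<Rightarrow> real" where
  "conv_pow g k h = (case k of 0 \<Rightarrow> h | Suc j \<Rightarrow> conv (kernel_pow g j) h)"

definition g_ker :: "real \<Rightarrow> real \<Rightarrow> real" where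
  "g_ker \<epsilon> x = 1 / (2 * \<epsilon>) * exp (- \<bar>x\<bar> / \<epsilon>)"

definition s_ker :: "real \<Rightarrow> real \<Rightarrow> real" where
  "s_ker \<epsilon> x = (if x \<le> 0 then - exp (x / \<epsilon>) else exp (- x / \<epsilon>))"

definition heat_kernel :: "real \<Rightarrow> real \<Rightarrow> real" where
  "heat_kernel t x = 1 / sqrt (4 * pi * t) * exp (- x\<^sup>2 / (4 * t))"

definition heat_flow :: "(real \<Rightarrow> real) \<Rightarrow> real \<Rightarrow> real \<Rightarrow> real" where
  "heat_flow p t = (if t = 0 then p else conv (heat_kernel t) p)"

definition solves_heat_eq :: "real \<Rightarrow> (real \<Rightarrow> real) \<Rightarrow> (real \<Rightarrow> real \<Rightarrow> real) \<Rightarrow> bool" where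
  "solves_heat_eq T p q \<longleftrightarrow>
     q 0 = p \<and>
     (\<forall>t\<in>{0<..T}. \<exists>qx qxx.
        (\<forall>x. (q t has_real_derivative qx x) (at x)) \<and>
        (\<forall>x. (qx has_real_derivative qxx x) (at x)) \<and>
        (\<forall>x. ((\<lambda>s. q s x) has_real_derivative qxx x) (at t within {0..T})))"

section \<open>Single-interface states\<close>

definition p_of :: "(real \<Rightarrow> real) \<Rightarrow> real \<Rightarrow> real \<Rightarrow> real" where
  "p_of u \<xi> x = (if x = \<xi> then Lim (at \<xi>) (\<lambda>y. u y - sgn (y - \<xi>)) else u x - sgn (x - \<xi>))"

definition admissible_state :: "(real \<Rightarrow> real) \<Rightarrow> real \<Rightarrow> bool" where
  "admissible_state u \<xi> \<longleftrightarrow>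
     continuous_on {..<\<xi>} u \<and> continuous_on {\<xi><..} u \<and>
     (\<exists>l r. (u \<longlongrightarrow> l) (at_left \<xi>) \<and> (u \<longlongrightarrow> r) (at_right \<xi>) \<and> r - l = 2) \<and>
     (\<forall>x\<le>\<xi>. -2 \<le> u x \<and> u x \<le> 0) \<and> (\<forall>x>\<xi>. u x \<ge> 0) \<and>
     (\<exists>\<alpha>>0. \<forall>x>\<xi>. u x \<le> \<alpha> * (x - \<xi>) + 2)"

definition admissible_initial :: "(real \<Rightarrow> real) \<Rightarrow> real \<Rightarrow> bool" where
  "admissible_initial u \<xi> \<longleftrightarrow>
     admissible_state u \<xi> \<and> \<xi> = 0 \<and> second_derivative_finite_measure (p_of u \<xi>)"

section \<open>The scheme\<close>

definition next_interface :: "(real \<Rightarrow> real) \<Rightarrow> real \<Rightarrow> real" where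
  "next_interface v \<xi> =
     (if v \<xi> > 1 then (GREATEST z. z < \<xi> \<and> v z = 1)
      else if v \<xi> < -1 then (LEAST z. z > \<xi> \<and> v z = -1)
      else \<xi>)"

primrec scheme :: "real \<Rightarrow> (real \<Rightarrow> real) \<Rightarrow> real \<Rightarrow> nat \<Rightarrow> (real \<Rightarrow> real) \<times> real" where
  "scheme \<epsilon> u \<xi> 0 = (u, \<xi>)"
| "scheme \<epsilon> u \<xi> (Suc n) =
     (let v = conv (g_ker \<epsilon>) (fst (scheme \<epsilon> u \<xi> n));
          \<xi>' = next_interface v (snd (scheme \<epsilon> u \<xi> n))
      in (\<lambda>x. v x + s_ker \<epsilon> (x - \<xi>'), \<xi>'))"

definition u_seq :: "real \<Rightarrow> (real \<Rightarrow> real) \<Rightarrow> real \<Rightarrow> nat \<Rightarrow> real \<Rightarrow> real" where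
  "u_seq \<epsilon> u \<xi> n = fst (scheme \<epsilon> u \<xi> n)"

definition xi_seq :: "real \<Rightarrow> (real \<Rightarrow> real) \<Rightarrow> real \<Rightarrow> nat \<Rightarrow> real" where
  "xi_seq \<epsilon> u \<xi> n = snd (scheme \<epsilon> u \<xi> n)"

definition p_seq :: "real \<Rightarrow> (real \<Rightarrow> real) \<Rightarrow> real \<Rightarrow> nat \<Rightarrow> real \<Rightarrow> real" where
  "p_seq \<epsilon> u \<xi> n = p_of (u_seq \<epsilon> u \<xi> n) (xi_seq \<epsilon> u \<xi> n)"

primrec q_seq :: "real \<Rightarrow> (real \<Rightarrow> real) \<Rightarrow> real \<Rightarrow> nat \<Rightarrow> real \<Rightarrow> real" where
  "q_seq \<epsilon> u \<xi> 0 = p_of u \<xi>"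
| "q_seq \<epsilon> u \<xi> (Suc n) = conv (g_ker \<epsilon>) (q_seq \<epsilon> u \<xi> n)"

definition r_seq :: "real \<Rightarrow> (real \<Rightarrow> real) \<Rightarrow> real \<Rightarrow> nat \<Rightarrow> real \<Rightarrow> real" where
  "r_seq \<epsilon> u \<xi> n x =
     conv (g_ker \<epsilon>) (\<lambda>y. sgn (y - xi_seq \<epsilon> u \<xi> (Suc n))) x
     - conv (g_ker \<epsilon>) (\<lambda>y. sgn (y - xi_seq \<epsilon> u \<xi> n)) x"

definition f_seq :: "real \<Rightarrow> (real \<Rightarrow> real) \<Rightarrow> real \<Rightarrow> nat \<Rightarrow> real \<Rightarrow> real" where
  "f_seq \<epsilon> u \<xi> n x = (\<Sum>i=1..n. conv_pow (g_ker \<epsilon>) (n - i) (r_seq \<epsilon> u \<xi> (i - 1)) x)"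

text \<open>For \<open>t \<ge> 0\<close> the index is the \<open>n\<close> with \<open>n * \<epsilon>\<^sup>2 \<le> t < (n + 1) * \<epsilon>\<^sup>2\<close>.\<close>

definition interp :: "real \<Rightarrow> (nat \<Rightarrow> 'a) \<Rightarrow> real \<Rightarrow> 'a" where
  "interp \<epsilon> a t = a (nat \<lfloor>t / \<epsilon>\<^sup>2\<rfloor>)"

definition xi_eps :: "real \<Rightarrow> (real \<Rightarrow> real) \<Rightarrow> real \<Rightarrow> real \<Rightarrow> real" where
  "xi_eps \<epsilon> u \<xi> = interp \<epsilon> (xi_seq \<epsilon> u \<xi>)"

definition p_eps :: "real \<Rightarrow> (real \<Rightarrow> real) \<Rightarrow> real \<Rightarrow> real \<Rightarrow> real \<Rightarrow> real" where
  "p_eps \<epsilon> u \<xi> = interp \<epsilon> (p_seq \<epsilon> u \<xi>)"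

definition q_eps :: "real \<Rightarrow> (real \<Rightarrow> real) \<Rightarrow> real \<Rightarrow> real \<Rightarrow> real \<Rightarrow> real" where
  "q_eps \<epsilon> u \<xi> = interp \<epsilon> (q_seq \<epsilon> u \<xi>)"

definition f_eps :: "real \<Rightarrow> (real \<Rightarrow> real) \<Rightarrow> real \<Rightarrow> real \<Rightarrow> real \<Rightarrow> real" where
  "f_eps \<epsilon> u \<xi> = interp \<epsilon> (f_seq \<epsilon> u \<xi>)"

end

theory Submission
  imports Defs "HOL-Probability.Probability" "HOL-Complex_Analysis.Great_Picard" "HOL-Real_Asymp.Real_Asymp"
begin

text \<open>Convolution with the kernel is the resolvent \<open>(1 - \<epsilon>\<^sup>2 \<partial>\<^sub>x\<^sup>2)\<^sup>-\<^sup>1\<close>, so the regular part \<open>q\<close> is the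
  implicit Euler scheme for the heat equation. A second derivative of finite mass makes the initial
  \<open>p\<close> Lipschitz (it is bounded on the left), and then the consistency error is uniform away from
  \<open>t = 0\<close> while the initial layer contributes only \<open>O(sqrt \<delta>)\<close>.

  Comparison arguments with the exponential kernel show that the interface moves to the left by at most
  \<open>\<alpha> \<epsilon>\<^sup>2 / 2\<close> per step. Hence the limit interface is monotone and Lipschitz, and each source term \<open>r\<close> is
  dominated by \<open>C (g * \<bar>\<cdot> - \<xi>\<bar> - \<bar>\<cdot> - \<xi>\<bar>)\<close>. These bounds telescope along the iteration, so over a time
  span \<open>\<theta>\<close> the sources change \<open>f\<close> by \<open>O(sqrt \<theta>)\<close> only, while the iterated convolution over the same span
  is Lipschitz with constant \<open>O(1 / sqrt \<theta>)\<close>. This gives equicontinuity of \<open>f\<close> in time and space, up to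
  errors that vanish with \<open>\<epsilon>\<close>, and the Arzela-Ascoli argument yields the subsequence.\<close>

section \<open>The exponential kernel\<close>

text \<open>The obstacle is the number of steps: one source \<open>r_seq\<close> has sup norm of
  order e, and there are about T/e^2 of them, so adding sup norms gives T/e. The saving comes from
  their shape. The comparison profile g convolved with \<bar>y - a\<bar>, minus \<bar>x - a\<bar>,
  equals 2 e^2 g (x - a), so each source acts like a point source at the interface of strength of
  order e^2. Up to the drift of the interface, the telescoped sum is the expected growth of the
  distance of a random walk from it, a discrete Tanaka formula for local time, and in time \<theta>
  a walk moves by about sqrt \<theta>. The speed bound is a similar balance: the slope \<alpha>
  lifts the smoothed state at the interface above 1 by at most \<alpha> e / 2, and the upper barrier
  decays to the left at rate 1/e. For the regular part the initial curvature is only a measure. The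
  bound on the second space derivative of the heat flow blows up like 1/sqrt t, and its modulus in
  time degenerates at t = 0, which is why the comparison is made with the flow started a time
  \<delta> ahead.\<close>

definition tame :: "(real \<Rightarrow> real) \<Rightarrow> bool" where
  "tame h \<longleftrightarrow> h \<in> borel_measurable borel \<and> (\<exists>C. \<forall>x. \<bar>h x\<bar> \<le> C * (1 + x\<^sup>2))"

lemma tameI:
  assumes "h \<in> borel_measurable borel" "\<And>x. \<bar>h x\<bar> \<le> C * (1 + x\<^sup>2)"
  shows "tame h"
  using assms unfolding tame_def by blast

lemma tame_measurable [measurable_dest]: "tame h \<Longrightarrow> h \<in> borel_measurable borel"
  unfolding tame_def by blast

lemma tameE:
  assumes "tame h"
  obtains C where "C \<ge> 0" "\<And>x. \<bar>h x\<bar> \<le> C * (1 + x\<^sup>2)"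
proof -
  obtain C where C: "\<And>x. \<bar>h x\<bar> \<le> C * (1 + x\<^sup>2)" using assms unfolding tame_def by blast
  have "C \<ge> 0" using C[of 0] by simp
  then show ?thesis using C that by blast
qed

lemma tame_bounded:
  assumes "h \<in> borel_measurable borel" "\<And>x. \<bar>h x\<bar> \<le> B"
  shows "tame h"
proof (rule tameI[where C=B])
  fix x
  have "B \<ge> 0" using assms(2)[of 0] by linarith
  then have "B * 1 \<le> B * (1 + x\<^sup>2)" by (intro mult_left_mono) auto
  then show "\<bar>h x\<bar> \<le> B * (1 + x\<^sup>2)" using assms(2)[of x] by linarith
qed (use assms in auto)

lemma abs_le_one_plus_square: "\<bar>x\<bar> \<le> 1 + (x::real)\<^sup>2"
proof -
  have "0 \<le> (\<bar>x\<bar> - 1)\<^sup>2" by simp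
  also have "(\<bar>x\<bar> - 1)\<^sup>2 = x\<^sup>2 - 2 * \<bar>x\<bar> + 1" by (simp add: power2_eq_square algebra_simps)
  finally show ?thesis by (smt (verit) zero_le_power2)
qed

lemma tame_const [simp]: "tame (\<lambda>x. c)"
  by (rule tame_bounded) auto

lemma tame_linear_growth:
  assumes "h \<in> borel_measurable borel" "\<And>x. \<bar>h x\<bar> \<le> A + B * \<bar>x\<bar>" "A \<ge> 0" "B \<ge> 0"
  shows "tame h"
proof (rule tameI[where C="A+B"])
  fix x
  have "B * \<bar>x\<bar> \<le> B * (1 + x\<^sup>2)" using abs_le_one_plus_square assms by (intro mult_left_mono) auto
  moreover have "A * 1 \<le> A * (1 + x\<^sup>2)" using assms by (intro mult_left_mono) auto
  ultimately show "\<bar>h x\<bar> \<le> (A + B) * (1 + x\<^sup>2)" using assms(2)[of x] by (simp add: distrib_right)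
qed (use assms in auto)

lemma tame_id [simp]: "tame (\<lambda>x. x)"
  by (rule tame_linear_growth[where A=0 and B=1]) auto

lemma tame_abs: assumes "tame h" shows "tame (\<lambda>x. \<bar>h x\<bar>)"
proof -
  obtain C where C: "\<And>x. \<bar>h x\<bar> \<le> C * (1 + x\<^sup>2)" using assms unfolding tame_def by blast
  show ?thesis by (rule tameI[where C=C]) (use assms C in \<open>auto dest: tame_measurable\<close>)
qed

lemma tame_add: assumes "tame h" "tame k" shows "tame (\<lambda>x. h x + k x)"
proof -
  obtain C where C: "\<And>x. \<bar>h x\<bar> \<le> C * (1 + x\<^sup>2)" using assms unfolding tame_def by blast
  obtain D where D: "\<And>x. \<bar>k x\<bar> \<le> D * (1 + x\<^sup>2)" using assms unfolding tame_def by blast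
  show ?thesis
  proof (rule tameI[where C="C+D"])
    show "(\<lambda>x. h x + k x) \<in> borel_measurable borel" using assms by (auto dest: tame_measurable)
    show "\<bar>h x + k x\<bar> \<le> (C + D) * (1 + x\<^sup>2)" for x
      using C[of x] D[of x] by (simp only: distrib_right)
  qed
qed

lemma tame_cmult: assumes "tame h" shows "tame (\<lambda>x. c * h x)"
proof -
  obtain C where C: "\<And>x. \<bar>h x\<bar> \<le> C * (1 + x\<^sup>2)" using assms unfolding tame_def by blast
  show ?thesis
  proof (rule tameI[where C="\<bar>c\<bar>*C"])
    show "(\<lambda>x. c * h x) \<in> borel_measurable borel" using assms by (auto dest: tame_measurable)
    show "\<bar>c * h x\<bar> \<le> (\<bar>c\<bar> * C) * (1 + x\<^sup>2)" for x
      using mult_left_mono[OF C[of x], of "\<bar>c\<bar>"] by (simp add: abs_mult mult.assoc)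
  qed
qed

lemma tame_minus: "tame h \<Longrightarrow> tame (\<lambda>x. - h x)"
  using tame_cmult[of h "-1"] by simp

lemma tame_diff: assumes "tame h" "tame k" shows "tame (\<lambda>x. h x - k x)"
  using tame_add[OF assms(1) tame_minus[OF assms(2)]] by simp

lemma tame_le:
  assumes "h \<in> borel_measurable borel" "tame k" "\<And>x. \<bar>h x\<bar> \<le> \<bar>k x\<bar>"
  shows "tame h"
proof -
  obtain C where C: "\<And>x. \<bar>k x\<bar> \<le> C * (1 + x\<^sup>2)" using assms unfolding tame_def by blast
  show ?thesis by (rule tameI[where C=C]) (use assms C order_trans in blast)+
qed

lemma tame_shift: assumes "tame h" shows "tame (\<lambda>x. h (x + a))"
proof -
  obtain C where C0: "C \<ge> 0" and C: "\<And>x. \<bar>h x\<bar> \<le> C * (1 + x\<^sup>2)" using assms by (rule tameE) blast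
  have [measurable]: "h \<in> borel_measurable borel" using assms by (rule tame_measurable)
  show ?thesis
  proof (rule tameI[where C="C * (2 + 2 * a\<^sup>2)"])
    fix x
    have "(x + a)\<^sup>2 \<le> 2 * x\<^sup>2 + 2 * a\<^sup>2" by (smt (verit) power2_diff power2_sum zero_le_power2)
    then have "1 + (x + a)\<^sup>2 \<le> (2 + 2 * a\<^sup>2) * (1 + x\<^sup>2)"
      by (simp add: distrib_left distrib_right) (smt (verit) zero_le_power2 mult_nonneg_nonneg)
    then have "C * (1 + (x + a)\<^sup>2) \<le> C * ((2 + 2 * a\<^sup>2) * (1 + x\<^sup>2))"
      using C0 by (rule mult_left_mono)
    then show "\<bar>h (x + a)\<bar> \<le> C * (2 + 2 * a\<^sup>2) * (1 + x\<^sup>2)" using C[of "x+a"] by (simp add: mult.assoc)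
  qed measurable
qed

lemma tame_square: "tame (\<lambda>x. (x - a)\<^sup>2)"
proof -
  have "tame (\<lambda>x. x\<^sup>2)" by (rule tameI[where C=1]) auto
  from tame_shift[OF this, of "-a"] show ?thesis by simp
qed

lemma tame_reflect: assumes "tame h" shows "tame (\<lambda>x. h (- x))"
proof -
  obtain C where C: "\<And>x. \<bar>h x\<bar> \<le> C * (1 + x\<^sup>2)" using assms unfolding tame_def by blast
  have [measurable]: "h \<in> borel_measurable borel" using assms by (rule tame_measurable)
  show ?thesis
  proof (rule tameI[where C=C])
    show "\<bar>h (-x)\<bar> \<le> C * (1 + x\<^sup>2)" for x using C[of "-x"] by simp
  qed measurable
qed

lemma tame_sgn: "tame (\<lambda>x. sgn (x - a))"
  by (rule tame_bounded[where B=1]) (auto simp: sgn_real_def)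

section \<open>Half-line integrals against the kernel and the resolvent identity\<close>

lemma g_ker_nonneg: "e > 0 \<Longrightarrow> 0 \<le> g_ker e x"
  unfolding g_ker_def by simp

lemma g_ker_measurable [measurable]: "g_ker e \<in> borel_measurable borel"
  unfolding g_ker_def by measurable

lemma exp_decay:
  fixes \<psi> :: "real \<Rightarrow> real"
  assumes "e > 0" "\<And>y. y \<ge> a \<Longrightarrow> \<bar>\<psi> y\<bar> \<le> C * (1 + y\<^sup>2)"
  shows "((\<lambda>y. exp ((x - y) / e) * \<psi> y) \<longlongrightarrow> 0) at_top"
proof (rule Lim_null_comparison[where g="\<lambda>y. exp ((x - y) / e) * (C * (1 + y\<^sup>2))"])
  show "\<forall>\<^sub>F y in at_top. norm (exp ((x - y) / e) * \<psi> y) \<le> exp ((x - y) / e) * (C * (1 + y\<^sup>2))"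
    using eventually_ge_at_top[of a] by eventually_elim (use assms in \<open>simp add: abs_mult\<close>)
  show "((\<lambda>y. exp ((x - y) / e) * (C * (1 + y\<^sup>2))) \<longlongrightarrow> 0) at_top"
    using assms(1) by real_asymp
qed

text \<open>To the right of x the kernel is a multiple of exp((x - y)/e), and for w =
  \<open>\<psi> - e\<^sup>2 * \<psi>''\<close> the integrand has the explicit antiderivative
  \<open>F\<close>, which vanishes at infinity by the growth bounds. Positivity of w permits the
  nonnegative integral; as \<open>F\<close> increases to 0, it also yields the sign needed to add
  the two half-line values in \<open>ennreal\<close>.\<close>

lemma g_ker_half_line:
  assumes e: "e > 0" and xa: "x \<le> a" and [measurable]: "w \<in> borel_measurable borel"
    and w0: "\<And>y. y \<ge> a \<Longrightarrow> 0 \<le> w y"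
    and d1: "\<And>y. y \<ge> a \<Longrightarrow> (\<psi> has_real_derivative \<psi>' y) (at y)"
    and d2: "\<And>y. y \<ge> a \<Longrightarrow> (\<psi>' has_real_derivative \<psi>'' y) (at y)"
    and w: "\<And>y. y \<ge> a \<Longrightarrow> w y = \<psi> y - e\<^sup>2 * \<psi>'' y"
    and b: "\<And>y. y \<ge> a \<Longrightarrow> \<bar>\<psi> y\<bar> \<le> C * (1 + y\<^sup>2)" "\<And>y. y \<ge> a \<Longrightarrow> \<bar>\<psi>' y\<bar> \<le> C * (1 + y\<^sup>2)"
  shows "(\<integral>\<^sup>+y. ennreal (g_ker e (x - y) * w y) * indicator {a..} y \<partial>lborel)
      = ennreal (exp ((x - a) / e) * (\<psi> a + e * \<psi>' a) / 2)"
    and "0 \<le> \<psi> a + e * \<psi>' a"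
proof -
  define F where "F y = - (exp ((x - y) / e) * \<psi> y / 2 + e / 2 * (exp ((x - y) / e) * \<psi>' y))" for y
  define f where "f y = 1 / (2 * e) * exp ((x - y) / e) * w y" for y
  have [measurable]: "f \<in> borel_measurable borel" unfolding f_def by measurable
  have f0: "0 \<le> f y" if "a \<le> y" for y unfolding f_def using w0[OF that] e by simp
  have dE: "DERIV (\<lambda>y. exp ((x - y) / e)) y :> - exp ((x - y) / e) / e" for y
    using e by (auto intro!: derivative_eq_intros)
  have dF: "DERIV F y :> f y" if "a \<le> y" for y
  proof -
    let ?E = "exp ((x - y) / e)"
    have "DERIV F y :> - ((?E * \<psi>' y + - ?E / e * \<psi> y) / 2 + e / 2 * (?E * \<psi>'' y + - ?E / e * \<psi>' y))"
      unfolding F_def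
      by (intro DERIV_minus DERIV_add DERIV_cdivide DERIV_cmult DERIV_mult' dE d1[OF that] d2[OF that])
    moreover have "- ((?E * \<psi>' y + - ?E / e * \<psi> y) / 2 + e / 2 * (?E * \<psi>'' y + - ?E / e * \<psi>' y)) = f y"
      unfolding f_def w[OF that] using e by (simp add: field_simps power2_eq_square)
    ultimately show ?thesis by simp
  qed
  have "(F \<longlongrightarrow> - (0 / 2 + e / 2 * 0)) at_top"
    unfolding F_def by (intro tendsto_intros exp_decay[OF e b(1)] exp_decay[OF e b(2)])
      auto
  then have lim: "(F \<longlongrightarrow> 0) at_top" by simp
  have Fa: "F a = - (exp ((x - a) / e) * (\<psi> a + e * \<psi>' a) / 2)"
    unfolding F_def by (simp add: field_simps)
  have "F a \<le> 0"
  proof (rule tendsto_lowerbound[OF lim])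
    show "\<forall>\<^sub>F y in at_top. F a \<le> F y"
      using eventually_ge_at_top[of a]
    proof eventually_elim
      case (elim y)
      show ?case using elim dF f0 by (intro DERIV_nonneg_imp_nondecreasing[of a y F]) (auto intro: order_trans)
    qed
  qed simp
  then have "0 \<le> exp ((x - a) / e) * (\<psi> a + e * \<psi>' a)" unfolding Fa by simp
  then show "0 \<le> \<psi> a + e * \<psi>' a" by (simp add: zero_le_mult_iff)
  have "(\<integral>\<^sup>+y. ennreal (g_ker e (x - y) * w y) * indicator {a..} y \<partial>lborel)
      = (\<integral>\<^sup>+y. ennreal (f y) * indicator {a..} y \<partial>lborel)"
    by (intro nn_integral_cong) (use xa in \<open>auto simp: f_def g_ker_def indicator_def diff_divide_distrib\<close>)
  also have "\<dots> = ennreal (0 - F a)"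
    by (rule nn_integral_FTC_atLeast) (use dF f0 lim in auto)
  finally show "(\<integral>\<^sup>+y. ennreal (g_ker e (x - y) * w y) * indicator {a..} y \<partial>lborel)
      = ennreal (exp ((x - a) / e) * (\<psi> a + e * \<psi>' a) / 2)" unfolding Fa by simp
qed

text \<open>The convolution with \<^const>\<open>g_ker\<close> is the resolvent \<open>(1 - e\<^sup>2 \<partial>\<^sub>x\<^sup>2)\<^sup>-\<^sup>1\<close>.\<close>

lemma g_ker_resolvent_nonneg:
  assumes e: "e > 0" and [measurable]: "w \<in> borel_measurable borel"
    and w0: "\<And>y. 0 \<le> w y"
    and d1: "\<And>y. (\<psi> has_real_derivative \<psi>' y) (at y)"
    and d2: "\<And>y. (\<psi>' has_real_derivative \<psi>'' y) (at y)"
    and w: "\<And>y. w y = \<psi> y - e\<^sup>2 * \<psi>'' y"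
    and b: "\<And>y. \<bar>\<psi> y\<bar> \<le> C * (1 + y\<^sup>2)" "\<And>y. \<bar>\<psi>' y\<bar> \<le> C * (1 + y\<^sup>2)"
  shows "has_bochner_integral lborel (\<lambda>y. g_ker e (x - y) * w y) (\<psi> x)"
proof -
  let ?h = "\<lambda>y. g_ker e (x - y) * w y"
  have R: "(\<integral>\<^sup>+y. ennreal (?h y) * indicator {x..} y \<partial>lborel) = ennreal ((\<psi> x + e * \<psi>' x) / 2)"
      and R0: "0 \<le> \<psi> x + e * \<psi>' x"
    using g_ker_half_line[of e x x w \<psi> \<psi>' \<psi>'' C] assms by auto
  \<comment> \<open>Reflection turns the left half-line into a right one and changes the sign of
    \<open>\<psi>'\<close>. The halves contribute (\<psi> + e \<psi>')/2 and (\<psi> - e \<psi>')/2,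
    so the derivative cancels in the sum.\<close>
  have m: "((\<lambda>y::real. - y) has_real_derivative - 1) (at y)" for y by (auto intro!: derivative_eq_intros)
  have d1': "((\<lambda>y. \<psi> (- y)) has_real_derivative - \<psi>' (- y)) (at y)" for y
    using DERIV_chain2[OF d1 m, of y] by simp
  have d2': "((\<lambda>y. - \<psi>' (- y)) has_real_derivative \<psi>'' (- y)) (at y)" for y
    using DERIV_minus[OF DERIV_chain2[OF d2 m, of y]] by simp
  have bm: "(\<lambda>y. w (- y)) \<in> borel_measurable borel" by measurable
  have L: "(\<integral>\<^sup>+y. ennreal (g_ker e (- x - y) * w (- y)) * indicator {- x..} y \<partial>lborel)
        = ennreal (exp ((-x - - x) / e) * (\<psi> (- (- x)) + e * - \<psi>' (- (- x))) / 2)"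
      and L0: "0 \<le> \<psi> (- (- x)) + e * - \<psi>' (- (- x))"
  proof -
    have b': "\<bar>\<psi> (- y)\<bar> \<le> C * (1 + y\<^sup>2)" "\<bar>- \<psi>' (- y)\<bar> \<le> C * (1 + y\<^sup>2)" for y
      using b(1)[of "- y"] b(2)[of "- y"] by auto
    note HL = g_ker_half_line[of e "-x" "-x" "\<lambda>y. w (- y)" "\<lambda>y. \<psi> (- y)" "\<lambda>y. - \<psi>' (- y)"
        "\<lambda>y. \<psi>'' (- y)" C, OF e order_refl bm w0 d1' d2' w b']
    show "(\<integral>\<^sup>+y. ennreal (g_ker e (- x - y) * w (- y)) * indicator {- x..} y \<partial>lborel)
        = ennreal (exp ((-x - - x) / e) * (\<psi> (- (- x)) + e * - \<psi>' (- (- x))) / 2)" by (rule HL(1))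
    show "0 \<le> \<psi> (- (- x)) + e * - \<psi>' (- (- x))" by (rule HL(2))
  qed
  have "(\<integral>\<^sup>+y. ennreal (?h y) * indicator {..x} y \<partial>lborel)
      = (\<integral>\<^sup>+y. ennreal (g_ker e (- x - y) * w (- y)) * indicator {- x..} y \<partial>lborel)"
    by (subst nn_integral_real_affine[of _ "-1" 0])
       (auto intro!: nn_integral_cong simp: g_ker_def indicator_def abs_minus_commute)
  then have L': "(\<integral>\<^sup>+y. ennreal (?h y) * indicator {..x} y \<partial>lborel) = ennreal ((\<psi> x - e * \<psi>' x) / 2)"
    unfolding L by simp
  have "(\<integral>\<^sup>+y. ennreal (?h y) \<partial>lborel)
     = (\<integral>\<^sup>+y. ennreal (?h y) * indicator {x..} y + ennreal (?h y) * indicator {..x} y \<partial>lborel)"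
    by (intro nn_integral_cong_AE) (use AE_lborel_singleton[of x] in \<open>eventually_elim, auto simp: indicator_def\<close>)
  also have "\<dots> = ennreal ((\<psi> x + e * \<psi>' x) / 2) + ennreal ((\<psi> x - e * \<psi>' x) / 2)"
    by (subst nn_integral_add) (auto simp: R L')
  also have "\<dots> = ennreal (\<psi> x)"
    using R0 L0 by (subst ennreal_plus[symmetric]) (auto simp: field_simps)
  finally have N: "(\<integral>\<^sup>+y. ennreal (?h y) \<partial>lborel) = ennreal (\<psi> x)" .
  have "0 \<le> \<psi> x" using R0 L0 by simp
  then show ?thesis
    using N g_ker_nonneg[OF e] w0 by (intro has_bochner_integral_nn_integral) auto
qed

lemma tame_integrable:
  assumes e: "e > 0" and h: "tame h"
  shows "integrable lborel (\<lambda>y. g_ker e (x - y) * h y)"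
proof -
  have [measurable]: "h \<in> borel_measurable borel" using h by (rule tame_measurable)
  obtain C where C0: "C \<ge> 0" and C: "\<And>x. \<bar>h x\<bar> \<le> C * (1 + x\<^sup>2)" using h by (rule tameE) blast
  \<comment> \<open>The majorant 1 + y^2 is \<open>\<psi> - e\<^sup>2 * \<psi>''\<close> for \<psi>
    = 1 + y^2 + 2 e^2, so its integral against the kernel is known exactly.\<close>
  have "has_bochner_integral lborel (\<lambda>y. g_ker e (x - y) * (1 + y\<^sup>2)) (1 + x\<^sup>2 + 2 * e\<^sup>2)"
  proof (rule g_ker_resolvent_nonneg[where \<psi>="\<lambda>y. 1 + y\<^sup>2 + 2 * e\<^sup>2" and \<psi>'="\<lambda>y. 2 * y" and \<psi>''="\<lambda>y. 2"
        and C="2 + 2 * e\<^sup>2", OF e])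
    show "\<bar>1 + y\<^sup>2 + 2 * e\<^sup>2\<bar> \<le> (2 + 2 * e\<^sup>2) * (1 + y\<^sup>2)" for y
      by (simp add: distrib_left distrib_right)
    show "\<bar>2 * y\<bar> \<le> (2 + 2 * e\<^sup>2) * (1 + y\<^sup>2)" for y
    proof -
      have "0 \<le> 2 * e\<^sup>2 * (1 + y\<^sup>2)" by simp
      moreover have "\<bar>2 * y\<bar> \<le> 2 * (1 + y\<^sup>2)" using abs_le_one_plus_square[of y] by simp
      ultimately show ?thesis unfolding distrib_right[of 2] by linarith
    qed
  qed (auto intro!: derivative_eq_intros)
  then have "integrable lborel (\<lambda>y. C * (g_ker e (x - y) * (1 + y\<^sup>2)))"
    by (auto simp: has_bochner_integral_iff)
  then show ?thesis
  proof (rule Bochner_Integration.integrable_bound)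
    show "AE y in lborel. norm (g_ker e (x - y) * h y) \<le> norm (C * (g_ker e (x - y) * (1 + y\<^sup>2)))"
    proof (rule AE_I2)
      fix y
      have "g_ker e (x - y) * \<bar>h y\<bar> \<le> g_ker e (x - y) * (C * (1 + y\<^sup>2))"
        using C g_ker_nonneg[OF e] by (intro mult_left_mono)
      then show "norm (g_ker e (x - y) * h y) \<le> norm (C * (g_ker e (x - y) * (1 + y\<^sup>2)))"
        using C0 g_ker_nonneg[OF e] by (simp add: abs_mult mult.left_commute)
    qed
  qed measurable
qed

section \<open>The convolution operator on tame functions\<close>

lemma conv_g_add:
  assumes "e > 0" "tame h" "tame k"
  shows "conv (g_ker e) (\<lambda>x. h x + k x) x = conv (g_ker e) h x + conv (g_ker e) k x"
  unfolding conv_def distrib_left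
  by (rule Bochner_Integration.integral_add) (use assms tame_integrable in auto)

lemma conv_g_diff:
  assumes "e > 0" "tame h" "tame k"
  shows "conv (g_ker e) (\<lambda>x. h x - k x) x = conv (g_ker e) h x - conv (g_ker e) k x"
  unfolding conv_def right_diff_distrib
  by (rule Bochner_Integration.integral_diff) (use assms tame_integrable in auto)

lemma conv_cmult: "conv g (\<lambda>x. c * h x) x = c * conv g h x"
  unfolding conv_def by (simp add: mult.left_commute)

lemma conv_g_mono:
  assumes "e > 0" "tame h" "tame k" "\<And>y. h y \<le> k y"
  shows "conv (g_ker e) h x \<le> conv (g_ker e) k x"
  unfolding conv_def
  by (rule integral_mono) (use assms tame_integrable g_ker_nonneg in \<open>auto intro!: mult_left_mono\<close>)

text \<open>The sign condition of \<open>g_ker_resolvent_nonneg\<close> is removed by adding the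
  majorant D (1 + y^2), itself in the range of the differential operator, and subtracting its known
  contribution.\<close>

lemma conv_g_resolvent:
  assumes e: "e > 0" and w: "tame (\<lambda>y. \<psi> y - e\<^sup>2 * \<psi>'' y)"
    and d1: "\<And>y. (\<psi> has_real_derivative \<psi>' y) (at y)"
    and d2: "\<And>y. (\<psi>' has_real_derivative \<psi>'' y) (at y)"
    and b: "\<And>y. \<bar>\<psi> y\<bar> \<le> C * (1 + y\<^sup>2)" "\<And>y. \<bar>\<psi>' y\<bar> \<le> C * (1 + y\<^sup>2)"
  shows "conv (g_ker e) (\<lambda>y. \<psi> y - e\<^sup>2 * \<psi>'' y) x = \<psi> x"
proof -
  have [measurable]: "(\<lambda>y. \<psi> y - e\<^sup>2 * \<psi>'' y) \<in> borel_measurable borel" using w by (rule tame_measurable)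
  obtain D where D0: "D \<ge> 0" and D: "\<And>x. \<bar>\<psi> x - e\<^sup>2 * \<psi>'' x\<bar> \<le> D * (1 + x\<^sup>2)" using w by (rule tameE) blast
  have C0: "C \<ge> 0" using b(1)[of 0] by simp
  have aux: "\<bar>1 + y\<^sup>2 + 2 * e\<^sup>2\<bar> \<le> (2 + 2 * e\<^sup>2) * (1 + y\<^sup>2)" for y
      by (simp add: distrib_left distrib_right)
  have aux2: "\<bar>2 * y\<bar> \<le> (2 + 2 * e\<^sup>2) * (1 + y\<^sup>2)" for y
    proof -
      have "0 \<le> 2 * e\<^sup>2 * (1 + y\<^sup>2)" by simp
      moreover have "\<bar>2 * y\<bar> \<le> 2 * (1 + y\<^sup>2)" using abs_le_one_plus_square[of y] by simp
      ultimately show ?thesis unfolding distrib_right[of 2] by linarith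
    qed
  \<comment> \<open>k = 1 is the lifted integrand, k = 0 the majorant alone. Both are nonnegative,
    and their difference is the claim.\<close>
  have A: "has_bochner_integral lborel (\<lambda>y. g_ker e (x - y) * (E * (1 + y\<^sup>2) + k * (\<psi> y - e\<^sup>2 * \<psi>'' y)))
      (E * (1 + x\<^sup>2 + 2 * e\<^sup>2) + k * \<psi> x)" if E: "(E = D \<and> k = 1) \<or> (E = D \<and> k = 0)" for E k
  proof (rule g_ker_resolvent_nonneg[where \<psi>="\<lambda>y. E * (1 + y\<^sup>2 + 2 * e\<^sup>2) + k * \<psi> y"
        and \<psi>'="\<lambda>y. E * (2 * y) + k * \<psi>' y" and \<psi>''="\<lambda>y. E * 2 + k * \<psi>'' y"
        and C="D * (2 + 2 * e\<^sup>2) + C", OF e])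
    show "0 \<le> E * (1 + y\<^sup>2) + k * (\<psi> y - e\<^sup>2 * \<psi>'' y)" for y
      using E D[of y] D0 by auto
    have kk: "\<bar>k * z\<bar> \<le> \<bar>z\<bar>" for z using E by auto
    show "\<bar>E * (1 + y\<^sup>2 + 2 * e\<^sup>2) + k * \<psi> y\<bar> \<le> (D * (2 + 2 * e\<^sup>2) + C) * (1 + y\<^sup>2)" for y
    proof -
      have "\<bar>E * (1 + y\<^sup>2 + 2 * e\<^sup>2)\<bar> \<le> D * ((2 + 2 * e\<^sup>2) * (1 + y\<^sup>2))"
        unfolding abs_mult using aux[of y] E D0 by (intro mult_mono) auto
      with b(1)[of y] kk[of "\<psi> y"] show ?thesis by (simp only: distrib_right mult.assoc)
    qed
    show "\<bar>E * (2 * y) + k * \<psi>' y\<bar> \<le> (D * (2 + 2 * e\<^sup>2) + C) * (1 + y\<^sup>2)" for y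
    proof -
      have "\<bar>E * (2 * y)\<bar> \<le> D * ((2 + 2 * e\<^sup>2) * (1 + y\<^sup>2))"
        unfolding abs_mult[of E] using aux2[of y] E D0 by (intro mult_mono) auto
      with b(2)[of y] kk[of "\<psi>' y"] show ?thesis by (simp only: distrib_right mult.assoc)
    qed
    show "E * (1 + y\<^sup>2) + k * (\<psi> y - e\<^sup>2 * \<psi>'' y) = E * (1 + y\<^sup>2 + 2 * e\<^sup>2) + k * \<psi> y - e\<^sup>2 * (E * 2 + k * \<psi>'' y)" for y
      by (simp add: algebra_simps)
    show "((\<lambda>y. E * (1 + y\<^sup>2 + 2 * e\<^sup>2) + k * \<psi> y) has_real_derivative E * (2 * y) + k * \<psi>' y) (at y)" for y
      by (auto intro!: derivative_eq_intros d1)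
    show "((\<lambda>y. E * (2 * y) + k * \<psi>' y) has_real_derivative E * 2 + k * \<psi>'' y) (at y)" for y
      by (auto intro!: derivative_eq_intros d2)
  qed measurable
  have "has_bochner_integral lborel (\<lambda>y. g_ker e (x - y) * (D * (1 + y\<^sup>2) + 1 * (\<psi> y - e\<^sup>2 * \<psi>'' y))
        - g_ker e (x - y) * (D * (1 + y\<^sup>2) + 0 * (\<psi> y - e\<^sup>2 * \<psi>'' y)))
      ((D * (1 + x\<^sup>2 + 2 * e\<^sup>2) + 1 * \<psi> x) - (D * (1 + x\<^sup>2 + 2 * e\<^sup>2) + 0 * \<psi> x))"
    by (intro has_bochner_integral_diff A) auto
  then show ?thesis
    unfolding conv_def by (simp add: has_bochner_integral_iff algebra_simps)
qed

lemma conv_g_const: "e > 0 \<Longrightarrow> conv (g_ker e) (\<lambda>y. c) x = c"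
  using conv_g_resolvent[of e "\<lambda>y. c" "\<lambda>y. 0" "\<lambda>y. 0" "\<bar>c\<bar>" x]
  by (simp add: distrib_left)

lemma conv_g_id: "e > 0 \<Longrightarrow> conv (g_ker e) (\<lambda>y. y) x = x"
  using conv_g_resolvent[of e "\<lambda>y. y" "\<lambda>y. 0" "\<lambda>y. 1" 1 x] abs_le_one_plus_square
  by simp

text \<open>The kernel is a probability density of variance 2 e^2, the spread of the heat flow after
  time e^2; this is why one step of the scheme advances time by e^2.\<close>

lemma conv_g_square:
  assumes e: "e > 0" shows "conv (g_ker e) (\<lambda>y. (y - a)\<^sup>2) x = (x - a)\<^sup>2 + 2 * e\<^sup>2"
proof -
  have q: "conv (g_ker e) (\<lambda>y. y\<^sup>2 - e\<^sup>2 * 2) x = x\<^sup>2"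
  proof (rule conv_g_resolvent[OF e, where \<psi>'="\<lambda>y. 2 * y" and C=2])
    show "tame (\<lambda>y. y\<^sup>2 - e\<^sup>2 * 2)" using tame_diff[OF tame_square[of 0] tame_const] by simp
    show "\<bar>2 * y\<bar> \<le> 2 * (1 + y\<^sup>2)" for y :: real using abs_le_one_plus_square[of y] by simp
  qed (auto intro!: derivative_eq_intros)
  have "(\<lambda>y. (y - a)\<^sup>2) = (\<lambda>y. (y\<^sup>2 - e\<^sup>2 * 2) + ((- 2 * a) * y + (a\<^sup>2 + e\<^sup>2 * 2)))"
    by (auto simp: power2_eq_square algebra_simps)
  moreover have "tame (\<lambda>y. y\<^sup>2 - e\<^sup>2 * 2)" using tame_diff[OF tame_square[of 0] tame_const] by simp
  ultimately have "conv (g_ker e) (\<lambda>y. (y - a)\<^sup>2) x = x\<^sup>2 + ((- 2 * a) * x + (a\<^sup>2 + e\<^sup>2 * 2))"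
    by (simp only: conv_g_add[OF e] tame_add tame_cmult tame_id tame_const conv_cmult conv_g_id[OF e] conv_g_const[OF e] q)
  then show ?thesis by (simp add: power2_eq_square algebra_simps)
qed

lemma conv_g_bound:
  assumes "e > 0" "h \<in> borel_measurable borel" "\<And>y. \<bar>h y\<bar> \<le> B"
  shows "\<bar>conv (g_ker e) h x\<bar> \<le> B"
proof -
  have "tame h" by (rule tame_bounded) (use assms in auto)
  moreover have "- B \<le> h y" "h y \<le> B" for y using assms(3)[of y] by auto
  ultimately show ?thesis
    using conv_g_mono[of e "\<lambda>_. -B" h x] conv_g_mono[of e h "\<lambda>_. B" x] assms(1) by (auto simp: conv_g_const)
qed

lemma conv_g_abs:
  assumes e: "e > 0" and h: "tame h"
  shows "\<bar>conv (g_ker e) h x\<bar> \<le> conv (g_ker e) (\<lambda>y. \<bar>h y\<bar>) x"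
proof -
  have "conv (g_ker e) (\<lambda>y. - 1 * \<bar>h y\<bar>) x \<le> conv (g_ker e) h x"
    by (rule conv_g_mono[OF e tame_cmult[OF tame_abs[OF h]] h]) auto
  moreover have "conv (g_ker e) h x \<le> conv (g_ker e) (\<lambda>y. \<bar>h y\<bar>) x"
    by (rule conv_g_mono[OF e h tame_abs[OF h]]) auto
  ultimately show ?thesis unfolding conv_cmult by linarith
qed

lemma tame_conv_g:
  assumes e: "e > 0" and h: "tame h"
  shows "tame (conv (g_ker e) h)"
proof -
  obtain C where C0: "C \<ge> 0" and C: "\<And>x. \<bar>h x\<bar> \<le> C * (1 + x\<^sup>2)" using h by (rule tameE) blast
  have [measurable]: "h \<in> borel_measurable borel" using h by (rule tame_measurable)
  have t1: "tame (\<lambda>y. 1 + (y - 0)\<^sup>2)" by (intro tame_add tame_square tame_const)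
  show ?thesis
  proof (rule tameI[where C="C * (1 + 2 * e\<^sup>2)"])
    show "conv (g_ker e) h \<in> borel_measurable borel" unfolding conv_def by measurable
    fix x
    have "conv (g_ker e) (\<lambda>y. \<bar>h y\<bar>) x \<le> conv (g_ker e) (\<lambda>y. C * (1 + (y - 0)\<^sup>2)) x"
      by (rule conv_g_mono[OF e tame_abs[OF h] tame_cmult[OF t1]]) (use C in simp)
    also have "\<dots> = C * (1 + ((x - 0)\<^sup>2 + 2 * e\<^sup>2))"
      unfolding conv_cmult by (simp only: conv_g_add[OF e tame_const tame_square] conv_g_const[OF e] conv_g_square[OF e])
    also have "\<dots> \<le> C * ((1 + 2 * e\<^sup>2) * (1 + x\<^sup>2))"
      using C0 by (intro mult_left_mono) (auto simp: algebra_simps)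
    finally show "\<bar>conv (g_ker e) h x\<bar> \<le> C * (1 + 2 * e\<^sup>2) * (1 + x\<^sup>2)"
      using conv_g_abs[OF e h, of x] by (simp add: mult.assoc)
  qed
qed

text \<open>Values at the interface are conventions of \<open>sgn\<close>, \<open>p_of\<close> and
  indicators; a single point does not affect the convolution.\<close>

lemma conv_cong_except:
  assumes [measurable]: "g \<in> borel_measurable borel" "h \<in> borel_measurable borel" "k \<in> borel_measurable borel"
    and "\<And>y. y \<noteq> a \<Longrightarrow> h y = k y"
  shows "conv g h x = conv g k x"
  unfolding conv_def
  by (intro integral_cong_AE) (use AE_lborel_singleton[of a] assms(4) in \<open>auto\<close>)

lemma conv_shift: "conv g (\<lambda>y. h (y + a)) x = conv g h (x + a)"
  unfolding conv_def
  by (subst lborel_integral_real_affine[of 1 "\<lambda>y. g (x + a - y) * h y" a]) (auto simp: algebra_simps)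

lemma conv_reflect: 
  shows "conv (g_ker e) (\<lambda>y. h (- y)) x = conv (g_ker e) h (- x)"
  unfolding conv_def
  by (subst lborel_integral_real_affine[of "-1" "\<lambda>y. g_ker e (- x - y) * h y" 0])
     (auto simp: g_ker_def abs_minus_commute)

text \<open>Memorylessness of the exponential kernel.\<close>

lemma conv_g_exp_compare:
  assumes e: "e > 0" and h: "tame h" and ax: "a \<le> x" and h0: "\<And>y. y > a \<Longrightarrow> 0 \<le> h y"
  shows "exp (- (x - a) / e) * conv (g_ker e) h a \<le> conv (g_ker e) h x"
  unfolding conv_cmult[symmetric, of "exp (- (x - a) / e)"]
  unfolding conv_def
proof (rule integral_mono)
  show "integrable lborel (\<lambda>y. g_ker e (a - y) * (exp (- (x - a) / e) * h y))"
    by (rule tame_integrable[OF e tame_cmult[OF h]])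
  show "integrable lborel (\<lambda>y. g_ker e (x - y) * h y)" by (rule tame_integrable[OF e h])
  fix y
  show "g_ker e (a - y) * (exp (- (x - a) / e) * h y) \<le> g_ker e (x - y) * h y"
  proof (cases "y > a")
    case True
    have "g_ker e (a - y) * exp (- (x - a) / e) = 1 / (2 * e) * exp (- (\<bar>a - y\<bar> + (x - a)) / e)"
      by (simp add: g_ker_def exp_add[symmetric] add_divide_distrib diff_divide_distrib)
    also have "\<dots> \<le> g_ker e (x - y)"
    proof -
      have "- (\<bar>a - y\<bar> + (x - a)) / e \<le> - \<bar>x - y\<bar> / e"
        using e ax by (intro divide_right_mono) auto
      then show ?thesis unfolding g_ker_def using e by (intro mult_left_mono) auto
    qed
    finally show ?thesis using h0[OF True] by (simp add: mult_right_mono flip: mult.assoc)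
  next
    \<comment> \<open>Left of a, \<bar>x - y\<bar> = \<bar>a - y\<bar> + (x - a), so the two
      integrands agree exactly, whatever the sign of h.\<close>
    case False
    have "g_ker e (a - y) * exp (- (x - a) / e) = g_ker e (x - y)"
      using False ax by (simp add: g_ker_def exp_add[symmetric] add_divide_distrib diff_divide_distrib)
    then show ?thesis by (simp flip: mult.assoc)
  qed
qed

lemma conv_g_exp_compare_left:
  assumes e: "e > 0" and h: "tame h" and ax: "x \<le> a" and h0: "\<And>y. y < a \<Longrightarrow> 0 \<le> h y"
  shows "exp ((x - a) / e) * conv (g_ker e) h a \<le> conv (g_ker e) h x"
  using conv_g_exp_compare[OF e tame_reflect[OF h], of "-a" "-x"] ax h0
  unfolding conv_reflect by simp

section \<open>Explicit convolutions and continuity estimates\<close>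

text \<open>Step and ramp are the two pieces of the upper barrier 2 + \<alpha> (y - \<xi>) on the
  right of the interface. From x \<le> a only one exponential branch of the kernel is seen, so both
  results are pure exponentials.\<close>

lemma conv_g_half_line:
  assumes e: "e > 0" and xa: "x \<le> a"
  shows "conv (g_ker e) (\<lambda>y. indicator {a<..} y) x = exp ((x - a) / e) / 2"
    and "conv (g_ker e) (\<lambda>y. max (y - a) 0) x = e * exp ((x - a) / e) / 2"
proof -
  have nn: "conv (g_ker e) h x = v" if "tame h" "\<And>y. h y \<ge> 0" "v \<ge> 0"
     "(\<integral>\<^sup>+y. ennreal (g_ker e (x - y) * h y) \<partial>lborel) = ennreal v" for h v
    unfolding conv_def using that g_ker_nonneg[OF e]
    by (intro has_bochner_integral_integral_eq has_bochner_integral_nn_integral) (auto dest: tame_measurable)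
  show "conv (g_ker e) (\<lambda>y. indicator {a<..} y) x = exp ((x - a) / e) / 2"
  proof (rule nn)
    show "tame (\<lambda>y. indicator {a<..} y)" by (rule tame_bounded[where B=1]) (auto simp: indicator_def)
    have "(\<integral>\<^sup>+y. ennreal (g_ker e (x - y) * indicator {a<..} y) \<partial>lborel)
      = (\<integral>\<^sup>+y. ennreal (g_ker e (x - y) * 1) * indicator {a..} y \<partial>lborel)"
      by (intro nn_integral_cong_AE) (use AE_lborel_singleton[of a] in \<open>eventually_elim, auto simp: indicator_def\<close>)
    also have "\<dots> = ennreal (exp ((x - a) / e) * (1 + e * 0) / 2)"
      by (rule g_ker_half_line(1)[OF e xa, where \<psi>="\<lambda>y. 1" and \<psi>'="\<lambda>y. 0" and \<psi>''="\<lambda>y. 0" and C=1]) auto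
    finally show "(\<integral>\<^sup>+y. ennreal (g_ker e (x - y) * indicator {a<..} y) \<partial>lborel) = ennreal (exp ((x - a) / e) / 2)" by simp
  qed auto
  show "conv (g_ker e) (\<lambda>y. max (y - a) 0) x = e * exp ((x - a) / e) / 2"
  proof (rule nn)
    show "tame (\<lambda>y. max (y - a) 0)" by (rule tame_linear_growth[where A="\<bar>a\<bar>" and B=1]) auto
    have "(\<integral>\<^sup>+y. ennreal (g_ker e (x - y) * max (y - a) 0) \<partial>lborel)
      = (\<integral>\<^sup>+y. ennreal (g_ker e (x - y) * (y - a)) * indicator {a..} y \<partial>lborel)"
      by (intro nn_integral_cong) (auto simp: indicator_def)
    also have "\<dots> = ennreal (exp ((x - a) / e) * ((a - a) + e * 1) / 2)"
    proof (rule g_ker_half_line(1)[OF e xa, where \<psi>="\<lambda>y. y - a" and \<psi>'="\<lambda>y. 1" and \<psi>''="\<lambda>y. 0" and C="1 + \<bar>a\<bar>"])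
      fix y
      show "\<bar>y - a\<bar> \<le> (1 + \<bar>a\<bar>) * (1 + y\<^sup>2)"
        using abs_le_one_plus_square[of y] mult_nonneg_nonneg[OF abs_ge_zero[of a] zero_le_power2[of y]] abs_triangle_ineq4[of y a]
        by (simp only: distrib_left distrib_right mult_1 mult_1_right)
      show "\<bar>1\<bar> \<le> (1 + \<bar>a\<bar>) * (1 + y\<^sup>2)"
        using mult_nonneg_nonneg[of "\<bar>a\<bar>" "y\<^sup>2"] by (simp add: distrib_left distrib_right)
    qed (auto intro!: derivative_eq_intros)
    finally show "(\<integral>\<^sup>+y. ennreal (g_ker e (x - y) * max (y - a) 0) \<partial>lborel) = ennreal (e * exp ((x - a) / e) / 2)"
      by (simp add: mult.commute)
  qed (use e in auto)
qed

lemma conv_g_sgn: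
  assumes e: "e > 0"
  shows "conv (g_ker e) (\<lambda>y. sgn (y - a)) x = sgn (x - a) * (1 - exp (- \<bar>x - a\<bar> / e))"
proof -
  have i: "tame (indicator {0<..} :: real \<Rightarrow> real)" by (rule tame_bounded[where B=1]) (auto simp: indicator_def)
  have L: "conv (g_ker e) sgn x = - 1 + exp (x / e)" if "x \<le> 0" for x
  proof -
    have "conv (g_ker e) sgn x = conv (g_ker e) (\<lambda>y. - 1 + 2 * indicator {0<..} y) x"
      by (rule conv_cong_except[where a=0]) (auto simp: indicator_def sgn_real_def)
    also have "\<dots> = - 1 + 2 * (exp ((x - 0) / e) / 2)"
      by (simp only: conv_g_add[OF e tame_const tame_cmult[OF i]] conv_g_const[OF e] conv_cmult conv_g_half_line(1)[OF e that])
    finally show ?thesis by simp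
  qed
  have R: "conv (g_ker e) sgn x = 1 - exp (- x / e)" if "x \<ge> 0" for x
  proof -
    have "conv (g_ker e) sgn x = conv (g_ker e) (\<lambda>y. sgn (- y)) (- x)"
      using conv_reflect[of e sgn "- x"] by (simp only: minus_minus)
    also have "\<dots> = conv (g_ker e) (\<lambda>y. - 1 * sgn y) (- x)" by (simp add: sgn_minus)
    also have "\<dots> = 1 - exp (- x / e)" unfolding conv_cmult using L[of "-x"] that by simp
    finally show ?thesis .
  qed
  have "conv (g_ker e) (\<lambda>y. sgn (y - a)) x = conv (g_ker e) sgn (x - a)"
    using conv_shift[of "g_ker e" sgn "-a" x] by simp
  then show ?thesis using L[of "x-a"] R[of "x-a"] by (cases "x \<le> a") (auto simp: sgn_real_def diff_divide_distrib)
qed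

text \<open>The excess over \<bar>x - a\<bar> is 2 e^2 times the kernel centred at a, since the
  second derivative of the distance is twice a point mass. The source terms are compared with
  exactly this profile.\<close>

lemma conv_g_dist:
  assumes e: "e > 0"
  shows "conv (g_ker e) (\<lambda>y. \<bar>y - a\<bar>) x = \<bar>x - a\<bar> + e * exp (- \<bar>x - a\<bar> / e)"
proof -
  have i: "tame (\<lambda>y. max (y - 0) 0)" by (rule tame_linear_growth[where A=0 and B=1]) auto
  have L: "conv (g_ker e) abs x = - x + e * exp (x / e)" if "x \<le> 0" for x
  proof -
    have "(abs :: real \<Rightarrow> real) = (\<lambda>y. (- 1) * y + 2 * max (y - 0) 0)" by auto
    then have "conv (g_ker e) abs x = conv (g_ker e) (\<lambda>y. (- 1) * y + 2 * max (y - 0) 0) x" by simp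
    also have "\<dots> = (- 1) * x + 2 * (e * exp ((x - 0) / e) / 2)"
      by (simp only: conv_g_add[OF e tame_cmult[OF tame_id] tame_cmult[OF i]] conv_g_id[OF e] conv_cmult conv_g_half_line(2)[OF e that])
    finally show ?thesis by simp
  qed
  have R: "conv (g_ker e) abs x = x + e * exp (- x / e)" if "x \<ge> 0" for x
    using L[of "-x"] that conv_reflect[of e abs x] by simp
  have "conv (g_ker e) (\<lambda>y. \<bar>y - a\<bar>) x = conv (g_ker e) abs (x - a)"
    using conv_shift[of "g_ker e" abs "-a" x] by simp
  then show ?thesis using L[of "x-a"] R[of "x-a"] by (cases "x \<le> a") (auto simp: diff_divide_distrib)
qed

text \<open>A translation changes the exponential kernel by at most the factor exp(\<bar>x -
  y\<bar>/e) either way, so the difference of kernels is bounded by a multiple of the kernel itself,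
  without loss of decay.\<close>

lemma conv_g_increment:
  assumes e: "e > 0" and h: "tame h"
  shows "\<bar>conv (g_ker e) h x - conv (g_ker e) h y\<bar>
    \<le> (exp (\<bar>x - y\<bar> / e) - 1) * conv (g_ker e) (\<lambda>z. \<bar>h z\<bar>) y"
proof -
  have I: "integrable lborel (\<lambda>z. g_ker e (x - z) * h z)" for x by (rule tame_integrable[OF e h])
  have "conv (g_ker e) h x - conv (g_ker e) h y = (LINT z|lborel. (g_ker e (x - z) - g_ker e (y - z)) * h z)"
    unfolding conv_def by (subst Bochner_Integration.integral_diff[OF I I, symmetric]) (simp add: left_diff_distrib)
  also have "\<bar>\<dots>\<bar> \<le> (LINT z|lborel. \<bar>(g_ker e (x - z) - g_ker e (y - z)) * h z\<bar>)"
    by (rule integral_abs_bound)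
  also have "\<dots> \<le> (LINT z|lborel. (exp (\<bar>x - y\<bar> / e) - 1) * (g_ker e (y - z) * \<bar>h z\<bar>))"
  proof (rule integral_mono)
    show "integrable lborel (\<lambda>z. \<bar>(g_ker e (x - z) - g_ker e (y - z)) * h z\<bar>)"
      using Bochner_Integration.integrable_diff[OF I[of x] I[of y]] by (simp add: left_diff_distrib)
    show "integrable lborel (\<lambda>z. (exp (\<bar>x - y\<bar> / e) - 1) * (g_ker e (y - z) * \<bar>h z\<bar>))"
      using tame_integrable[OF e tame_abs[OF h], of y] by simp
    fix z
    define A where "A = \<bar>x - z\<bar>"
    define B where "B = \<bar>y - z\<bar>"
    define d where "d = \<bar>x - y\<bar> / e"
    have "A \<le> B + \<bar>x - y\<bar>" "B \<le> A + \<bar>x - y\<bar>" unfolding A_def B_def by auto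
    then have "A / e \<le> B / e + d" "B / e \<le> A / e + d"
      using e unfolding d_def add_divide_distrib[symmetric] by (auto intro: divide_right_mono)
    then have AB: "- A / e \<le> - B / e + d" "- B / e - d \<le> - A / e" by auto
    have up: "exp (- A / e) \<le> exp (- B / e) * exp d" using AB(1) by (simp flip: exp_add)
    have lo: "exp (- B / e) * exp (- d) \<le> exp (- A / e)" using AB(2) by (simp flip: exp_add)
    have d0: "d \<ge> 0" unfolding d_def using e by simp
    \<comment> \<open>exp d + exp(-d) \<ge> 2 turns the lower factor exp(-d) into 2 - exp d, so that
      both signs of the difference obey the same bound exp d - 1.\<close>
    have "2 - exp d \<le> exp (- d)"
    proof -
      have "exp d + exp (- d) \<ge> 2" using exp_ge_add_one_self[of d] exp_ge_add_one_self[of "-d"] by linarith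
      then show ?thesis by linarith
    qed
    then have "exp (- B / e) * (2 - exp d) \<le> exp (- A / e)"
      using lo mult_left_mono[of "2 - exp d" "exp (-d)" "exp (- B / e)"] by (meson exp_ge_zero order_trans)
    then have *: "\<bar>exp (- A / e) - exp (- B / e)\<bar> \<le> (exp d - 1) * exp (- B / e)"
      using up by (simp add: algebra_simps abs_le_iff)
    then have "\<bar>g_ker e (x - z) - g_ker e (y - z)\<bar> \<le> (exp d - 1) * g_ker e (y - z)"
    proof -
      have "g_ker e (x - z) - g_ker e (y - z) = 1 / (2 * e) * (exp (- A / e) - exp (- B / e))"
        unfolding g_ker_def A_def B_def by (simp add: diff_divide_distrib)
      moreover have "\<bar>1 / (2 * e)\<bar> = 1 / (2 * e)" using e by simp
      moreover have "1 / (2 * e) * \<bar>exp (- A / e) - exp (- B / e)\<bar> \<le> 1 / (2 * e) * ((exp d - 1) * exp (- B / e))"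
        using * e by (intro mult_left_mono) auto
      ultimately show ?thesis unfolding g_ker_def B_def by (simp only: abs_mult mult_ac)
    qed
    then have "\<bar>g_ker e (x - z) - g_ker e (y - z)\<bar> * \<bar>h z\<bar> \<le> (exp d - 1) * g_ker e (y - z) * \<bar>h z\<bar>"
      by (rule mult_right_mono) simp
    then show "\<bar>(g_ker e (x - z) - g_ker e (y - z)) * h z\<bar> \<le> (exp (\<bar>x - y\<bar> / e) - 1) * (g_ker e (y - z) * \<bar>h z\<bar>)"
      by (simp add: abs_mult d_def mult.assoc)
  qed
  finally show ?thesis unfolding conv_def by simp
qed

lemma continuous_conv_g:
  assumes e: "e > 0" and h: "tame h"
  shows "isCont (conv (g_ker e) h) y"
proof -
  have "((\<lambda>x. conv (g_ker e) h x - conv (g_ker e) h y) \<longlongrightarrow> 0) (at y)"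
  proof (rule Lim_null_comparison[where g="\<lambda>x. (exp (\<bar>x - y\<bar> / e) - 1) * conv (g_ker e) (\<lambda>z. \<bar>h z\<bar>) y"])
    have "((\<lambda>x. (exp (\<bar>x - y\<bar> / e) - 1) * conv (g_ker e) (\<lambda>z. \<bar>h z\<bar>) y) \<longlongrightarrow> (exp (\<bar>y - y\<bar> / e) - 1) * conv (g_ker e) (\<lambda>z. \<bar>h z\<bar>) y) (at y)"
      using e by (intro tendsto_intros) auto
    then show "((\<lambda>x. (exp (\<bar>x - y\<bar> / e) - 1) * conv (g_ker e) (\<lambda>z. \<bar>h z\<bar>) y) \<longlongrightarrow> 0) (at y)" by simp
  qed (use conv_g_increment[OF e h] in auto)
  then show ?thesis unfolding isCont_def by (rule LIM_zero_cancel)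
qed

lemma conv_g_jensen:
  assumes e: "e > 0" and [measurable]: "h \<in> borel_measurable borel" and B: "\<And>y. \<bar>h y\<bar> \<le> B"
  shows "conv (g_ker e) (\<lambda>y. (h y - c)\<^sup>2) x = conv (g_ker e) (\<lambda>y. (h y)\<^sup>2) x - 2 * c * conv (g_ker e) h x + c\<^sup>2"
    and "(conv (g_ker e) h x)\<^sup>2 \<le> conv (g_ker e) (\<lambda>y. (h y)\<^sup>2) x"
proof -
  have t: "tame h" by (rule tame_bounded) (use B in auto)
  have t2: "tame (\<lambda>y. (h y)\<^sup>2)"
  proof (rule tame_bounded[where B="B\<^sup>2"])
    show "\<bar>(h y)\<^sup>2\<bar> \<le> B\<^sup>2" for y using power_mono[OF B[of y] abs_ge_zero, of 2] by simp
  qed measurable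
  have *: "conv (g_ker e) (\<lambda>y. (h y - c)\<^sup>2) x = conv (g_ker e) (\<lambda>y. (h y)\<^sup>2) x - 2 * c * conv (g_ker e) h x + c\<^sup>2" for c
  proof -
    have "(\<lambda>y. (h y - c)\<^sup>2) = (\<lambda>y. ((h y)\<^sup>2 - (2 * c) * h y) + c\<^sup>2)" by (auto simp: power2_eq_square algebra_simps)
    then show ?thesis
      by (simp only: conv_g_add[OF e tame_diff[OF t2 tame_cmult[OF t]] tame_const] conv_g_diff[OF e t2 tame_cmult[OF t]] conv_cmult conv_g_const[OF e])
  qed
  then show "conv (g_ker e) (\<lambda>y. (h y - c)\<^sup>2) x = conv (g_ker e) (\<lambda>y. (h y)\<^sup>2) x - 2 * c * conv (g_ker e) h x + c\<^sup>2" .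
  let ?c = "conv (g_ker e) h x"
  have "0 \<le> conv (g_ker e) (\<lambda>y. (h y - ?c)\<^sup>2) x"
    unfolding conv_def[of _ "\<lambda>y. (h y - _)\<^sup>2"] by (rule Bochner_Integration.integral_nonneg) (use g_ker_nonneg[OF e] in auto)
  then show "?c\<^sup>2 \<le> conv (g_ker e) (\<lambda>y. (h y)\<^sup>2) x" unfolding * by (simp add: power2_eq_square)
qed

section \<open>The scheme\<close>

text \<open>Names the slope \<alpha> of the upper barrier, which \<open>admissible_state\<close>
  hides behind an existential. The iteration preserves it, and the constants in the estimates of the
  interface and of f depend on it.\<close>

definition state_bounds :: "real \<Rightarrow> (real \<Rightarrow> real) \<Rightarrow> real \<Rightarrow> bool" where
  "state_bounds \<alpha> u \<xi> \<longleftrightarrow> u \<in> borel_measurable borel \<and>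
     (\<forall>x\<le>\<xi>. -2 \<le> u x \<and> u x \<le> 0) \<and> (\<forall>x>\<xi>. 0 \<le> u x \<and> u x \<le> \<alpha> * (x - \<xi>) + 2)"

lemma admissible_state_bounds:
  assumes "admissible_state u \<xi>"
  obtains \<alpha> where "\<alpha> > 0" "state_bounds \<alpha> u \<xi>"
proof -
  have "continuous_on ({..<\<xi>} \<union> {\<xi><..}) u"
    using assms unfolding admissible_state_def by (intro continuous_on_open_Un) auto
  moreover have "{..<\<xi>} \<union> {\<xi><..} = - {\<xi>}" by auto
  ultimately have "u \<in> borel_measurable borel"
    using borel_measurable_continuous_countable_exceptions[of "{\<xi>}" u] by simp
  then show ?thesis
    using assms that unfolding admissible_state_def state_bounds_def by blast
qed

lemma state_bounds_tame:
  assumes "state_bounds \<alpha> u \<xi>" "\<alpha> > 0"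
  shows "tame u"
proof (rule tame_linear_growth[where A="2 + \<alpha> * \<bar>\<xi>\<bar>" and B=\<alpha>])
  fix x
  have "\<alpha> * (x - \<xi>) \<le> \<alpha> * (\<bar>x\<bar> + \<bar>\<xi>\<bar>)" using assms(2) by (intro mult_left_mono) auto
  moreover have "0 \<le> \<alpha> * \<bar>x\<bar>" "0 \<le> \<alpha> * \<bar>\<xi>\<bar>" using assms(2) by auto
  moreover have "\<bar>u x\<bar> \<le> 2 \<or> (0 \<le> u x \<and> u x \<le> \<alpha> * (x - \<xi>) + 2)"
    using assms(1) unfolding state_bounds_def by (cases "x \<le> \<xi>") (auto simp: abs_le_iff)
  ultimately show "\<bar>u x\<bar> \<le> 2 + \<alpha> * \<bar>\<xi>\<bar> + \<alpha> * \<bar>x\<bar>" by (simp only: distrib_left) linarith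
qed (use assms in \<open>auto simp: state_bounds_def\<close>)

lemma continuous_on_conv_g: "e > 0 \<Longrightarrow> tame h \<Longrightarrow> continuous_on S (conv (g_ker e) h)"
  by (intro continuous_at_imp_continuous_on ballI continuous_conv_g)

text \<open>Two barriers decide everything. From below, u dominates the step from -2 to 0 at \<xi>,
  whose smoothed value there is -1, so the branch moving to the right never occurs. From above, the
  step from 0 to 2 plus a ramp of slope \<alpha> is smoothed to exp((x - \<xi>)/e) (1 + \<alpha> e /
  2) for x \<le> \<xi>, which has dropped to 1 after a distance of at most \<alpha> e^2 / 2.\<close>

lemma next_interface_step:
  assumes e: "e > 0" and \<alpha>: "\<alpha> > 0" and u: "state_bounds \<alpha> u \<xi>"
  defines "v \<equiv> conv (g_ker e) u"
  defines "\<xi>' \<equiv> next_interface v \<xi>"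
  shows "\<xi>' \<le> \<xi>" "\<xi> - \<xi>' \<le> \<alpha> / 2 * e\<^sup>2" "-1 \<le> v \<xi>'" "v \<xi>' \<le> 1"
    "\<xi>' < \<xi> \<Longrightarrow> 1 < v \<xi>" "\<And>x. \<xi>' < x \<Longrightarrow> x \<le> \<xi> \<Longrightarrow> 1 < v x"
proof -
  note t = state_bounds_tame[OF u \<alpha>]
  have cv: "continuous_on S v" for S unfolding v_def by (rule continuous_on_conv_g[OF e t])
  have ti: "tame (indicator {\<xi><..} :: real \<Rightarrow> real)" by (rule tame_bounded[where B=1]) (auto simp: indicator_def)
  have tm: "tame (\<lambda>y. max (y - \<xi>) 0)" by (rule tame_linear_growth[where A="\<bar>\<xi>\<bar>" and B=1]) auto
  have lower: "-1 \<le> v \<xi>"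
  proof -
    have "conv (g_ker e) (\<lambda>y. - 2 + 2 * indicator {\<xi><..} y) \<xi> \<le> v \<xi>"
      unfolding v_def
      by (rule conv_g_mono[OF e tame_add[OF tame_const tame_cmult[OF ti]] t])
         (use u in \<open>auto simp: state_bounds_def indicator_def\<close>)
    then show ?thesis
      unfolding conv_g_add[OF e tame_const tame_cmult[OF ti]] conv_g_const[OF e] conv_cmult conv_g_half_line(1)[OF e order_refl]
      by simp
  qed
  have upper: "v x \<le> exp ((x - \<xi>) / e) * (1 + \<alpha> * e / 2)" if "x \<le> \<xi>" for x
  proof -
    have "v x \<le> conv (g_ker e) (\<lambda>y. 2 * indicator {\<xi><..} y + \<alpha> * max (y - \<xi>) 0) x"
      unfolding v_def
    proof (rule conv_g_mono[OF e t tame_add[OF tame_cmult[OF ti] tame_cmult[OF tm]]])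
      show "u y \<le> 2 * indicator {\<xi><..} y + \<alpha> * max (y - \<xi>) 0" for y
        using u[unfolded state_bounds_def, THEN conjunct2, THEN conjunct1, rule_format, of y]
          u[unfolded state_bounds_def, THEN conjunct2, THEN conjunct2, rule_format, of y] \<alpha>
        by (cases "y \<le> \<xi>") (auto simp: indicator_def max_def)
    qed
    also have "\<dots> = 2 * (exp ((x - \<xi>) / e) / 2) + \<alpha> * (e * exp ((x - \<xi>) / e) / 2)"
      by (simp only: conv_g_add[OF e tame_cmult[OF ti] tame_cmult[OF tm]] conv_cmult conv_g_half_line[OF e that])
    finally show ?thesis by (simp add: algebra_simps)
  qed
  have main: "\<xi>' \<le> \<xi> \<and> -1 \<le> v \<xi>' \<and> v \<xi>' \<le> 1 \<and> (\<xi>' < \<xi> \<longrightarrow> 1 < v \<xi> \<and> v \<xi>' = 1) \<and> (\<forall>x. \<xi>' < x \<and> x \<le> \<xi> \<longrightarrow> 1 < v x)"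
  proof (cases "v \<xi> > 1")
    case False
    then have "\<xi>' = \<xi>" unfolding \<xi>'_def next_interface_def using lower by simp
    then show ?thesis using False lower by auto
  next
    case True
    define S where "S = {z. z \<le> \<xi> \<and> v z = 1}"
    have "S = {..\<xi>} \<inter> v -` {1}" unfolding S_def by auto
    then have "closed S" using continuous_closed_preimage[OF cv[of "{..\<xi>}"] closed_atMost, of "{1}"] by simp
    \<comment> \<open>\<open>b\<close> is the point where the upper barrier equals 1; hence v takes
      the value 1 between b and \<xi>, and the set \<open>S\<close> is nonempty.\<close>
    define b where "b = \<xi> - e * ln (1 + \<alpha> * e / 2)"
    have pos: "1 + \<alpha> * e / 2 > 1" using \<alpha> e by simp
    have b: "b \<le> \<xi>" unfolding b_def using pos e by simp
    have "exp ((b - \<xi>) / e) = 1 / (1 + \<alpha> * e / 2)" unfolding b_def using pos e by (simp add: exp_minus field_simps)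
    then have "v b \<le> 1" using upper[OF b] pos by simp
    then obtain z where "b \<le> z" "z \<le> \<xi>" "v z = 1"
      using IVT'[of v b 1 \<xi>] True b cv by auto
    then have "S \<noteq> {}" unfolding S_def by auto
    have bdd: "bdd_above S" unfolding S_def by (auto intro!: bdd_aboveI)
    define s where "s = Sup S"
    have sS: "s \<in> S" unfolding s_def by (rule closed_contains_Sup) fact+
    have smax: "y \<le> s" if "y \<in> S" for y unfolding s_def by (rule cSup_upper[OF that bdd])
    have s1: "v s = 1" "s < \<xi>" using sS True unfolding S_def by (auto simp: order_less_le)
    have "\<xi>' = (GREATEST z. z < \<xi> \<and> v z = 1)" unfolding \<xi>'_def next_interface_def using True by simp
    also have "\<dots> = s" by (rule Greatest_equality) (use s1 smax in \<open>auto simp: S_def\<close>)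
    finally have eq: "\<xi>' = s" .
    have "1 < v x" if sx: "s < x" "x \<le> \<xi>" for x
    proof (rule ccontr)
      assume "\<not> 1 < v x"
      then obtain z where "x \<le> z" "z \<le> \<xi>" "v z = 1"
        using IVT'[of v x 1 \<xi>] True sx cv by auto
      then show False using smax[of z] sx unfolding S_def by auto
    qed
    then show ?thesis using s1 eq True by auto
  qed
  then show "\<xi>' \<le> \<xi>" "-1 \<le> v \<xi>'" "v \<xi>' \<le> 1" "\<xi>' < \<xi> \<Longrightarrow> 1 < v \<xi>" "\<And>x. \<xi>' < x \<Longrightarrow> x \<le> \<xi> \<Longrightarrow> 1 < v x"
    by auto
  show "\<xi> - \<xi>' \<le> \<alpha> / 2 * e\<^sup>2"
  proof (cases "\<xi>' < \<xi>")
    case False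
    then show ?thesis using main \<alpha> by simp
  next
    case True
    \<comment> \<open>At a moved interface v equals 1, so the upper barrier is at least 1 there; 1 +
      z \<le> exp z then removes the logarithm from the bound on the displacement.\<close>
    then have "1 \<le> exp ((\<xi>' - \<xi>) / e) * (1 + \<alpha> * e / 2)" using main upper[of \<xi>'] by auto
    then have "exp ((\<xi> - \<xi>') / e) * 1 \<le> exp ((\<xi> - \<xi>') / e) * (exp ((\<xi>' - \<xi>) / e) * (1 + \<alpha> * e / 2))"
      by (intro mult_left_mono) auto
    also have "\<dots> = 1 + \<alpha> * e / 2"
      by (simp flip: mult.assoc exp_add add_divide_distrib)
    finally have "1 + (\<xi> - \<xi>') / e \<le> 1 + \<alpha> * e / 2" using exp_ge_add_one_self[of "(\<xi> - \<xi>') / e"] by linarith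
    then have "(\<xi> - \<xi>') / e * e \<le> \<alpha> * e / 2 * e" using e by (intro mult_right_mono) auto
    then show ?thesis using e by (simp add: power2_eq_square)
  qed
qed

text \<open>\<open>s_ker\<close> has exactly the exponential profile of the memoryless comparison.
  That comparison is applied to functions of one sign on the side of the base point where x lies: -u
  and u + 2 on the left, u and the barrier minus u on the right. At \<xi>' the smoothed state lies
  in [-1, 1], and this is what the unit amplitude of \<open>s_ker\<close> compensates.\<close>

lemma state_bounds_step:
  assumes e: "e > 0" and \<alpha>: "\<alpha> > 0" and u: "state_bounds \<alpha> u \<xi>"
  defines "v \<equiv> conv (g_ker e) u"
  defines "\<xi>' \<equiv> next_interface v \<xi>"
  shows "state_bounds \<alpha> (\<lambda>x. v x + s_ker e (x - \<xi>')) \<xi>'"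
proof -
  note t = state_bounds_tame[OF u \<alpha>]
  note step = next_interface_step[OF e \<alpha> u, folded v_def, folded \<xi>'_def]
  have [measurable]: "v \<in> borel_measurable borel" unfolding v_def by (rule tame_measurable[OF tame_conv_g[OF e t]])
  have "(\<lambda>x. v x + s_ker e (x - \<xi>')) \<in> borel_measurable borel" unfolding s_ker_def by measurable
  moreover have "-2 \<le> v x + s_ker e (x - \<xi>') \<and> v x + s_ker e (x - \<xi>') \<le> 0" if x: "x \<le> \<xi>'" for x
  proof -
    let ?E = "exp ((x - \<xi>') / e)"
    \<comment> \<open>Since \<xi>' \<le> \<xi>, the old state is nonpositive on the whole half-line
      left of \<xi>'.\<close>
    have "?E * conv (g_ker e) (\<lambda>y. (- 1) * u y) \<xi>' \<le> conv (g_ker e) (\<lambda>y. (- 1) * u y) x"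
      by (rule conv_g_exp_compare_left[OF e tame_cmult[OF t] x]) (use u step(1) in \<open>auto simp: state_bounds_def\<close>)
    then have "v x \<le> ?E * v \<xi>'" unfolding conv_cmult v_def by simp
    also have "\<dots> \<le> ?E * 1" using step by (intro mult_left_mono) auto
    finally have 1: "v x \<le> ?E" by simp
    have "?E * conv (g_ker e) (\<lambda>y. u y + 2) \<xi>' \<le> conv (g_ker e) (\<lambda>y. u y + 2) x"
    proof (rule conv_g_exp_compare_left[OF e tame_add[OF t tame_const] x])
      show "0 \<le> u y + 2" for y using u unfolding state_bounds_def by (cases "y \<le> \<xi>") force+
    qed
    then have "?E * (v \<xi>' + 2) \<le> v x + 2" by (simp add: conv_g_add[OF e t tame_const] conv_g_const[OF e] v_def)
    moreover have "?E * 1 \<le> ?E * (v \<xi>' + 2)" using step by (intro mult_left_mono) auto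
    ultimately have "?E \<le> v x + 2" by linarith
    then show ?thesis using 1 x unfolding s_ker_def by simp
  qed
  moreover have "0 \<le> v x + s_ker e (x - \<xi>') \<and> v x + s_ker e (x - \<xi>') \<le> \<alpha> * (x - \<xi>') + 2" if x: "x > \<xi>'" for x
  proof -
    let ?E = "exp (- (x - \<xi>') / e)"
    have s: "s_ker e (x - \<xi>') = ?E" using x unfolding s_ker_def by simp
    \<comment> \<open>Between \<xi>' and \<xi> the choice of \<xi>' gives v > 1. Beyond \<xi>, where
      u is nonnegative, the comparison starts from \<xi>: if the interface moved, v exceeds 1 there;
      if it stayed, v is at least -1 there and the source covers the deficit.\<close>
    have "0 \<le> v x + ?E"
    proof (cases "x \<le> \<xi>")
      case True
      then show ?thesis using step(6)[OF x] by (smt (verit) exp_gt_zero)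
    next
      case False
      have c: "exp (- (x - \<xi>) / e) * v \<xi> \<le> v x"
        unfolding v_def by (rule conv_g_exp_compare[OF e t]) (use u False in \<open>auto simp: state_bounds_def\<close>)
      show ?thesis
      proof (cases "\<xi>' < \<xi>")
        case True
        then have "0 \<le> exp (- (x - \<xi>) / e) * v \<xi>" using step(5) by simp
        then show ?thesis using c by (smt (verit) exp_gt_zero)
      next
        case False
        then have "\<xi>' = \<xi>" using step(1) by simp
        moreover have "?E * (- 1) \<le> ?E * v \<xi>'" using step by (intro mult_left_mono) auto
        ultimately show ?thesis using c by auto
      qed
    qed
    moreover have "v x + ?E \<le> \<alpha> * (x - \<xi>') + 2"
    proof -
      \<comment> \<open>Affine functions are fixed by the convolution. The new barrier dominates u
        to the right of \<xi>' because its base point has moved left, which only raises it.\<close>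
      let ?h = "\<lambda>y. (\<alpha> * y + (2 - \<alpha> * \<xi>')) - u y"
      have Ph: "conv (g_ker e) ?h z = \<alpha> * z + (2 - \<alpha> * \<xi>') - v z" for z
        unfolding v_def
        by (simp only: conv_g_diff[OF e tame_add[OF tame_cmult[OF tame_id] tame_const] t]
            conv_g_add[OF e tame_cmult[OF tame_id] tame_const] conv_g_id[OF e] conv_g_const[OF e] conv_cmult)
      have "?E * conv (g_ker e) ?h \<xi>' \<le> conv (g_ker e) ?h x"
      proof (rule conv_g_exp_compare[OF e tame_diff[OF tame_add[OF tame_cmult[OF tame_id] tame_const] t]])
        fix y assume y: "y > \<xi>'"
        have a: "0 \<le> \<alpha> * (y - \<xi>')" "\<alpha> * (y - \<xi>) \<le> \<alpha> * (y - \<xi>')" using \<alpha> y step(1) by auto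
        show "0 \<le> (\<alpha> * y + (2 - \<alpha> * \<xi>')) - u y"
        proof (cases "y \<le> \<xi>")
          case True
          then have "u y \<le> 0" using u by (auto simp: state_bounds_def)
          then show ?thesis using a by (simp add: algebra_simps)
        next
          case False
          then have "u y \<le> \<alpha> * (y - \<xi>) + 2" using u by (auto simp: state_bounds_def)
          then show ?thesis using a by (simp add: algebra_simps)
        qed
      qed (use x in auto)
      then have "?E * (2 - v \<xi>') \<le> \<alpha> * (x - \<xi>') + 2 - v x" unfolding Ph by (simp add: algebra_simps)
      moreover have "?E * 1 \<le> ?E * (2 - v \<xi>')" using step by (intro mult_left_mono) auto
      ultimately show ?thesis by linarith
    qed
    ultimately show ?thesis unfolding s by simp
  qed
  ultimately show ?thesis unfolding state_bounds_def by blast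
qed

lemma scheme_Suc:
  "xi_seq e u \<xi> (Suc n) = next_interface (conv (g_ker e) (u_seq e u \<xi> n)) (xi_seq e u \<xi> n)"
  "u_seq e u \<xi> (Suc n) = (\<lambda>x. conv (g_ker e) (u_seq e u \<xi> n) x + s_ker e (x - xi_seq e u \<xi> (Suc n)))"
  unfolding xi_seq_def u_seq_def by (simp_all add: Let_def)

lemma scheme_0: "xi_seq e u \<xi> 0 = \<xi>" "u_seq e u \<xi> 0 = u"
  unfolding xi_seq_def u_seq_def by simp_all

lemma scheme_bounds:
  assumes e: "e > 0" and \<alpha>: "\<alpha> > 0" and u: "state_bounds \<alpha> u \<xi>"
  shows "state_bounds \<alpha> (u_seq e u \<xi> n) (xi_seq e u \<xi> n)"
    "xi_seq e u \<xi> (Suc n) \<le> xi_seq e u \<xi> n"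
    "xi_seq e u \<xi> n - xi_seq e u \<xi> (Suc n) \<le> \<alpha> / 2 * e\<^sup>2"
proof -
  show *: "state_bounds \<alpha> (u_seq e u \<xi> n) (xi_seq e u \<xi> n)" for n
  proof (induction n)
    case 0
    then show ?case using u by (simp add: scheme_0)
  next
    case (Suc n)
    show ?case
      using state_bounds_step[OF e \<alpha> Suc] unfolding scheme_Suc .
  qed
  show "xi_seq e u \<xi> (Suc n) \<le> xi_seq e u \<xi> n"
    "xi_seq e u \<xi> n - xi_seq e u \<xi> (Suc n) \<le> \<alpha> / 2 * e\<^sup>2"
    using next_interface_step(1,2)[OF e \<alpha> *[of n]] unfolding scheme_Suc by auto
qed

section \<open>Iterated convolutions and the splitting into regular part and fluctuations\<close>

text \<open>Replaces the limit hidden in \<open>p_of\<close> by a continuous function known off the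
  interface.\<close>

lemma p_of_eq:
  assumes "isCont w \<xi>" "\<And>x. x \<noteq> \<xi> \<Longrightarrow> u x - sgn (x - \<xi>) = w x"
  shows "p_of u \<xi> = w"
proof
  fix x
  have "((\<lambda>y. u y - sgn (y - \<xi>)) \<longlongrightarrow> w \<xi>) (at \<xi>)"
    by (rule Lim_transform_eventually[OF assms(1)[unfolded isCont_def]])
       (use assms(2) in \<open>auto simp: eventually_at_filter\<close>)
  then have "Lim (at \<xi>) (\<lambda>y. u y - sgn (y - \<xi>)) = w \<xi>" by (intro tendsto_Lim) auto
  then show "p_of u \<xi> x = w x" unfolding p_of_def using assms(2) by auto
qed

lemma g_ker_even: "g_ker e (- x) = g_ker e x" "g_ker e (x - y) = g_ker e (y - x)"
  unfolding g_ker_def by (simp_all add: abs_minus_commute)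

lemma g_ker_integrable: "e > 0 \<Longrightarrow> integrable lborel (\<lambda>y. g_ker e (x - y))"
  using tame_integrable[of e "\<lambda>_. 1" x] by simp

text \<open>Fubini with the inner integration over the kernel, which has mass one: convolution with
  it does not increase the integral of the modulus.\<close>

lemma kernel_pow_integrable:
  assumes e: "e > 0"
  shows "kernel_pow (g_ker e) j \<in> borel_measurable borel \<and> integrable lborel (kernel_pow (g_ker e) j)"
proof (induction j)
  case 0
  then show ?case using g_ker_integrable[OF e, of 0] by (simp add: g_ker_even)
next
  case (Suc j)
  define K where "K = kernel_pow (g_ker e) j"
  have [measurable]: "K \<in> borel_measurable borel" and iK: "integrable lborel K" using Suc K_def by auto
  have "conv (g_ker e) K \<in> borel_measurable borel" unfolding conv_def by measurable
  moreover have "integrable lborel (conv (g_ker e) K)"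
    unfolding conv_def
  proof (rule lborel_pair.integrable_fst)
    have "integrable (lborel \<Otimes>\<^sub>M lborel) (\<lambda>(y, x). g_ker e (x - y) * K y)"
    proof (rule lborel_pair.Fubini_integrable)
      have "(LINT x|lborel. norm (g_ker e (x - y) * K y)) = norm (K y)" for y
        using conv_g_const[OF e, of 1 y] g_ker_nonneg[OF e]
        by (simp add: conv_def abs_mult g_ker_even(2)[of e _ y])
      then show "integrable lborel (\<lambda>x. LINT y|lborel. norm (case (x, y) of (y, x) \<Rightarrow> g_ker e (x - y) * K y))"
        using iK by simp
      show "AE x in lborel. integrable lborel (\<lambda>y. case (x, y) of (y, x) \<Rightarrow> g_ker e (x - y) * K y)"
        using g_ker_integrable[OF e] by (auto simp: g_ker_even(2)[of e _ ])
    qed measurable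
    then show "integrable (lborel \<Otimes>\<^sub>M lborel) (\<lambda>(x, y). g_ker e (x - y) * K y)"
      by (subst (asm) lborel_pair.integrable_product_swap_iff[symmetric]) (simp add: case_prod_beta')
  qed
  ultimately show ?case by (simp add: K_def)
qed

text \<open>Fubini again. On the product, integrating in y first gives at most B times the integral
  of \<bar>K\<bar>, uniformly in w, and the remaining factor is the integrable kernel.\<close>

lemma conv_assoc:
  assumes e: "e > 0" and [measurable]: "K \<in> borel_measurable borel" and iK: "integrable lborel K"
    and [measurable]: "h \<in> borel_measurable borel" and B: "\<And>y. \<bar>h y\<bar> \<le> B"
  shows "conv (conv (g_ker e) K) h x = conv (g_ker e) (conv K h) x"
proof -
  have iKw: "integrable lborel (\<lambda>y. K (w - y))" for w
    using lborel_integrable_real_affine[OF iK, of "-1" w] by simp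
  have nKw: "(LINT y|lborel. \<bar>K (w - y)\<bar>) = (LINT y|lborel. \<bar>K y\<bar>)" for w
    using lborel_integral_real_affine[of "-1" "\<lambda>y. \<bar>K y\<bar>" w] by simp
  have B0: "B \<ge> 0" using B[of 0] by linarith
  have iKh: "integrable lborel (\<lambda>y. K (w - y) * h y)" for w
    by (rule Bochner_Integration.integrable_bound[OF integrable_mult_right[OF iKw, of B w]])
       (use B B0 in \<open>auto simp: abs_mult mult.commute[of B] intro!: mult_left_mono\<close>)
  have "conv (conv (g_ker e) K) h x = (LINT y|lborel. (LINT w|lborel. g_ker e (x - w) * (K (w - y) * h y)))"
    unfolding conv_def
  proof (rule Bochner_Integration.integral_cong[OF refl])
    fix y
    have "(LINT z|lborel. g_ker e (x - y - z) * K z) = (LINT w|lborel. g_ker e (x - w) * K (w - y))"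
      using lborel_integral_real_affine[of 1 "\<lambda>z. g_ker e (x - y - z) * K z" "- y"] by (simp add: algebra_simps)
    then show "(LINT z|lborel. g_ker e (x - y - z) * K z) * h y = (LINT w|lborel. g_ker e (x - w) * (K (w - y) * h y))"
      by (simp flip: mult.assoc)
  qed
  also have "\<dots> = (LINT w|lborel. (LINT y|lborel. g_ker e (x - w) * (K (w - y) * h y)))"
  proof (rule lborel_pair.Fubini_integral)
    show "integrable (lborel \<Otimes>\<^sub>M lborel) (\<lambda>(w, y). g_ker e (x - w) * (K (w - y) * h y))"
    proof (rule lborel_pair.Fubini_integrable)
      have i2: "integrable lborel (\<lambda>w. g_ker e (x - w) * (B * (LINT y|lborel. \<bar>K y\<bar>)))"
        using g_ker_integrable[OF e] by simp
      show "integrable lborel (\<lambda>w. LINT y|lborel. norm (case (w, y) of (w, y) \<Rightarrow> g_ker e (x - w) * (K (w - y) * h y)))"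
      proof (rule Bochner_Integration.integrable_bound[OF i2])
        show "AE w in lborel. norm (LINT y|lborel. norm (case (w, y) of (w, y) \<Rightarrow> g_ker e (x - w) * (K (w - y) * h y)))
           \<le> norm (g_ker e (x - w) * (B * (LINT y|lborel. \<bar>K y\<bar>)))"
        proof (rule AE_I2)
          fix w
          have "(LINT y|lborel. \<bar>K (w - y) * h y\<bar>) \<le> (LINT y|lborel. B * \<bar>K (w - y)\<bar>)"
          proof (rule integral_mono)
            show "integrable lborel (\<lambda>y. \<bar>K (w - y) * h y\<bar>)" using iKh[of w] by simp
            show "integrable lborel (\<lambda>y. B * \<bar>K (w - y)\<bar>)" using iKw[of w] by simp
            show "\<bar>K (w - y) * h y\<bar> \<le> B * \<bar>K (w - y)\<bar>" for y
              using B[of y] by (simp add: abs_mult mult.commute[of B] mult_left_mono)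
          qed
          then have le: "(LINT y|lborel. \<bar>K (w - y) * h y\<bar>) \<le> B * (LINT y|lborel. \<bar>K y\<bar>)" by (simp add: nKw)
          have "(LINT y|lborel. norm (case (w, y) of (w, y) \<Rightarrow> g_ker e (x - w) * (K (w - y) * h y)))
             = g_ker e (x - w) * (LINT y|lborel. \<bar>K (w - y) * h y\<bar>)"
            using g_ker_nonneg[OF e] by (simp add: abs_mult)
          moreover have "0 \<le> (LINT y|lborel. \<bar>K (w - y) * h y\<bar>)" by (rule Bochner_Integration.integral_nonneg) auto
          ultimately show "norm (LINT y|lborel. norm (case (w, y) of (w, y) \<Rightarrow> g_ker e (x - w) * (K (w - y) * h y)))
             \<le> norm (g_ker e (x - w) * (B * (LINT y|lborel. \<bar>K y\<bar>)))"
            using le g_ker_nonneg[OF e, of "x - w"] B0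
            by (auto simp del: norm_mult simp: abs_mult intro!: mult_left_mono)
        qed
      qed measurable
      show "AE w in lborel. integrable lborel (\<lambda>y. case (w, y) of (w, y) \<Rightarrow> g_ker e (x - w) * (K (w - y) * h y))"
        using iKh by auto
    qed measurable
  qed
  also have "\<dots> = conv (g_ker e) (conv K h) x" unfolding conv_def by simp
  finally show ?thesis .
qed

text \<open>Passes from powers of the kernel to powers of the convolution operator, which opens the
  way to monotonicity and induction on the number of steps. It is applied to the source terms, which
  are bounded by 2.\<close>

lemma conv_pow_iterate:
  assumes e: "e > 0" and m: "h \<in> borel_measurable borel" and B: "\<And>y. \<bar>h y\<bar> \<le> B"
  shows "conv_pow (g_ker e) k h = (conv (g_ker e) ^^ k) h"
proof (induction k)
  case 0
  then show ?case by (simp add: conv_pow_def)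
next
  case (Suc k)
  have "conv_pow (g_ker e) (Suc k) h = conv (g_ker e) (conv_pow (g_ker e) k h)"
  proof (cases k)
    case 0
    then show ?thesis by (simp add: conv_pow_def)
  next
    case (Suc j)
    show ?thesis
      using conv_assoc[OF e conjunct1 conjunct2 m B, OF kernel_pow_integrable kernel_pow_integrable, OF e e, of j]
      by (auto simp: Suc conv_pow_def fun_eq_iff)
  qed
  then show ?case using Suc by simp
qed

lemma conv_iterate_bounded:
  assumes e: "e > 0" and m: "h \<in> borel_measurable borel" and B: "\<And>y. \<bar>h y\<bar> \<le> B"
  shows "(conv (g_ker e) ^^ k) h \<in> borel_measurable borel" "\<bar>(conv (g_ker e) ^^ k) h x\<bar> \<le> B"
proof -
  have "(conv (g_ker e) ^^ k) h \<in> borel_measurable borel \<and> (\<forall>x. \<bar>(conv (g_ker e) ^^ k) h x\<bar> \<le> B)"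
  proof (induction k)
    case 0
    then show ?case using assms by simp
  next
    case (Suc k)
    then have "tame ((conv (g_ker e) ^^ k) h)" by (intro tame_bounded) auto
    then show ?case using Suc conv_g_bound[OF e, of "(conv (g_ker e) ^^ k) h" B] tame_measurable[OF tame_conv_g[OF e]] by auto
  qed
  then show "(conv (g_ker e) ^^ k) h \<in> borel_measurable borel" "\<bar>(conv (g_ker e) ^^ k) h x\<bar> \<le> B" by auto
qed

lemma tame_sum: "finite I \<Longrightarrow> (\<And>i. i \<in> I \<Longrightarrow> tame (h i)) \<Longrightarrow> tame (\<lambda>y. \<Sum>i\<in>I. h i y)"
  by (induction I rule: finite_induct) (auto intro: tame_add)

lemma conv_g_sum:
  assumes e: "e > 0"
  shows "finite I \<Longrightarrow> (\<And>i. i \<in> I \<Longrightarrow> tame (h i)) \<Longrightarrow>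
    conv (g_ker e) (\<lambda>y. \<Sum>i\<in>I. h i y) x = (\<Sum>i\<in>I. conv (g_ker e) (h i) x)"
proof (induction I rule: finite_induct)
  case empty
  then show ?case using conv_g_const[OF e, of 0] by simp
next
  case (insert i I)
  then show ?case by (simp add: conv_g_add[OF e] tame_sum)
qed

lemma r_seq_bounded:
  assumes e: "e > 0"
  shows "r_seq e u \<xi> n \<in> borel_measurable borel" "\<bar>r_seq e u \<xi> n x\<bar> \<le> 2"
proof -
  have [measurable]: "conv (g_ker e) (\<lambda>y. sgn (y - a)) \<in> borel_measurable borel" for a
    by (rule tame_measurable[OF tame_conv_g[OF e tame_sgn]])
  show "r_seq e u \<xi> n \<in> borel_measurable borel" unfolding r_seq_def[abs_def] by measurable
  have b: "\<bar>conv (g_ker e) (\<lambda>y. sgn (y - a)) x\<bar> \<le> 1" for a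
    by (rule conv_g_bound[OF e]) (auto simp: sgn_real_def)
  show "\<bar>r_seq e u \<xi> n x\<bar> \<le> 2"
    using b[of "xi_seq e u \<xi> (Suc n)"] b[of "xi_seq e u \<xi> n"] unfolding r_seq_def by linarith
qed

lemma f_seq_0: "f_seq e u \<xi> 0 x = 0"
  unfolding f_seq_def by simp

text \<open>The Duhamel sum as a recursion: older sources are smoothed once more, the newest enters
  unsmoothed.\<close>

lemma f_seq_Suc:
  assumes e: "e > 0"
  shows "f_seq e u \<xi> (Suc n) x = conv (g_ker e) (f_seq e u \<xi> n) x + r_seq e u \<xi> n x"
proof -
  let ?P = "conv (g_ker e)"
  note it = conv_pow_iterate[OF e r_seq_bounded[OF e]]
  have t: "tame (\<lambda>x. (?P ^^ k) (r_seq e u \<xi> i) x)" for k i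
    by (rule tame_bounded[OF conv_iterate_bounded[OF e r_seq_bounded[OF e]]])
  have "?P (f_seq e u \<xi> n) x = (\<Sum>i=1..n. ?P ((?P ^^ (n - i)) (r_seq e u \<xi> (i - 1))) x)"
    unfolding f_seq_def[abs_def] it by (subst conv_g_sum[OF e]) (auto intro: t)
  also have "\<dots> = (\<Sum>i=1..n. (?P ^^ (Suc n - i)) (r_seq e u \<xi> (i - 1)) x)"
    by (intro sum.cong) (auto simp: Suc_diff_le)
  finally show ?thesis unfolding f_seq_def it by simp
qed

lemma f_seq_tame: assumes e: "e > 0" shows "tame (f_seq e u \<xi> n)"
proof (induction n)
  case 0
  then show ?case using f_seq_0 by (metis ext tame_const)
next
  case (Suc n)
  have "f_seq e u \<xi> (Suc n) = (\<lambda>x. conv (g_ker e) (f_seq e u \<xi> n) x + r_seq e u \<xi> n x)" using f_seq_Suc[OF e] by auto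
  moreover have "tame (r_seq e u \<xi> n)" using r_seq_bounded[OF e] by (rule tame_bounded)
  ultimately show ?case using Suc e by (simp add: tame_add tame_conv_g)
qed

lemma p_of_tame:
  assumes "tame u" shows "tame (p_of u \<xi>)"
proof -
  have [measurable]: "u \<in> borel_measurable borel" using assms by (rule tame_measurable)
  define c where "c = Lim (at \<xi>) (\<lambda>y. u y - sgn (y - \<xi>))"
  have eq: "p_of u \<xi> = (\<lambda>x. if x = \<xi> then c else u x - sgn (x - \<xi>))" unfolding p_of_def c_def by auto
  have "tame (\<lambda>x. (\<bar>u x\<bar> + 1) + \<bar>c\<bar>)" by (intro tame_add tame_abs assms tame_const)
  then show ?thesis
  proof (rule tame_le[rotated])
    show "p_of u \<xi> \<in> borel_measurable borel" unfolding eq by measurable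
    show "\<bar>p_of u \<xi> x\<bar> \<le> \<bar>\<bar>u x\<bar> + 1 + \<bar>c\<bar>\<bar>" for x
      unfolding eq by (auto simp: sgn_real_def)
  qed
qed

lemma q_seq_tame: "e > 0 \<Longrightarrow> tame (p_of u \<xi>) \<Longrightarrow> tame (q_seq e u \<xi> n)"
  by (induction n) (auto intro: tame_conv_g)

text \<open>Behind the splitting is the identity \<open>s_ker e (x - a) = sgn (x - a) - conv (g_ker
  e) (\<lambda>y. sgn (y - a)) x\<close> for x \<noteq> a. Subtracting the sign from the new state
  leaves the convolution of u minus the sign at \<xi>'; trading \<xi>' for the old \<xi> costs
  precisely the local fluctuation.\<close>

lemma p_seq_eq:
  assumes e: "e > 0" and \<alpha>: "\<alpha> > 0" and u: "state_bounds \<alpha> u \<xi>"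
  shows "p_seq e u \<xi> n x = q_seq e u \<xi> n x - f_seq e u \<xi> n x"
proof (induction n arbitrary: x)
  case 0
  then show ?case by (simp add: p_seq_def scheme_0 f_seq_0)
next
  case (Suc n)
  let ?P = "conv (g_ker e)"
  let ?u = "u_seq e u \<xi> n" and ?x = "xi_seq e u \<xi> n" and ?x' = "xi_seq e u \<xi> (Suc n)"
  note t = state_bounds_tame[OF scheme_bounds(1)[OF e \<alpha> u] \<alpha>]
  have tq: "tame (q_seq e u \<xi> n)" by (intro q_seq_tame e p_of_tame state_bounds_tame[OF u \<alpha>])
  have "p_seq e u \<xi> (Suc n) = (\<lambda>x. ?P ?u x - ?P (\<lambda>y. sgn (y - ?x')) x)"
    unfolding p_seq_def
  proof (rule p_of_eq)
    show "isCont (\<lambda>x. ?P ?u x - ?P (\<lambda>y. sgn (y - ?x')) x) ?x'"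
      by (intro continuous_diff continuous_conv_g[OF e t] continuous_conv_g[OF e tame_sgn])
    show "u_seq e u \<xi> (Suc n) x - sgn (x - ?x') = ?P ?u x - ?P (\<lambda>y. sgn (y - ?x')) x" if "x \<noteq> ?x'" for x
      unfolding scheme_Suc(2) conv_g_sgn[OF e] using that
      by (auto simp: s_ker_def sgn_real_def diff_divide_distrib)
  qed
  moreover have "?P ?u x = ?P (p_seq e u \<xi> n) x + ?P (\<lambda>y. sgn (y - ?x)) x"
  proof -
    have tp: "tame (p_seq e u \<xi> n)" unfolding p_seq_def by (rule p_of_tame[OF t])
    \<comment> \<open>u and p plus sign can differ only at the interface, where \<open>p_of\<close>
      takes the limit instead.\<close>
    have "?P ?u x = ?P (\<lambda>y. p_seq e u \<xi> n y + sgn (y - ?x)) x"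
      by (rule conv_cong_except[where a="?x"])
         (use tame_measurable[OF t] tame_measurable[OF tame_add[OF tp tame_sgn]] in \<open>auto simp: p_seq_def p_of_def\<close>)
    then show ?thesis by (simp add: conv_g_add[OF e tp tame_sgn])
  qed
  moreover have "?P (p_seq e u \<xi> n) x = ?P (q_seq e u \<xi> n) x - ?P (f_seq e u \<xi> n) x"
  proof -
    have "p_seq e u \<xi> n = (\<lambda>y. q_seq e u \<xi> n y - f_seq e u \<xi> n y)" using Suc by auto
    then show ?thesis by (simp add: conv_g_diff[OF e tq f_seq_tame[OF e]])
  qed
  ultimately show ?case by (simp add: f_seq_Suc[OF e] r_seq_def)
qed

section \<open>Local and global fluctuations\<close>

lemma tame_iterate: "e > 0 \<Longrightarrow> tame h \<Longrightarrow> tame ((conv (g_ker e) ^^ m) h)"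
  by (induction m) (auto intro: tame_conv_g)

lemma iterate_mono:
  assumes e: "e > 0" and "tame h" "tame k" "\<And>y. h y \<le> k y"
  shows "(conv (g_ker e) ^^ m) h x \<le> (conv (g_ker e) ^^ m) k x"
  by (induction m arbitrary: x) (auto intro!: conv_g_mono[OF e] tame_iterate assms)

text \<open>Variances add: m steps of the walk have variance 2 m e^2.\<close>

lemma iterate_quadratic:
  assumes e: "e > 0"
  shows "(conv (g_ker e) ^^ m) (\<lambda>y. A + B * (y - a)\<^sup>2) x = A + B * ((x - a)\<^sup>2 + 2 * (real m * e\<^sup>2))"
proof (induction m arbitrary: x)
  case (Suc m)
  have "(conv (g_ker e) ^^ Suc m) (\<lambda>y. A + B * (y - a)\<^sup>2) x
      = conv (g_ker e) (\<lambda>y. (A + B * (2 * (real m * e\<^sup>2))) + B * (y - a)\<^sup>2) x"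
  proof -
    have "(conv (g_ker e) ^^ m) (\<lambda>y. A + B * (y - a)\<^sup>2) = (\<lambda>y. (A + B * (2 * (real m * e\<^sup>2))) + B * (y - a)\<^sup>2)"
      by (rule ext) (simp only: Suc distrib_left)
    then show ?thesis by simp
  qed
  also have "\<dots> = A + B * (2 * (real m * e\<^sup>2)) + B * ((x - a)\<^sup>2 + 2 * e\<^sup>2)"
    by (simp only: conv_g_add[OF e tame_const tame_cmult[OF tame_square]] conv_g_const[OF e] conv_cmult conv_g_square[OF e])
  finally show ?case by (simp add: algebra_simps)
qed simp

lemma abs_le_quadratic:
  fixes z :: real
  assumes "l > 0" shows "\<bar>z\<bar> \<le> z\<^sup>2 / l + l / 4"
proof -
  have "0 \<le> (\<bar>z\<bar> - l / 2)\<^sup>2 / l" using assms by simp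
  also have "(\<bar>z\<bar> - l / 2)\<^sup>2 / l = z\<^sup>2 / l + l / 4 - \<bar>z\<bar>"
  proof -
    have "(\<bar>z\<bar> - l / 2)\<^sup>2 = z\<^sup>2 - \<bar>z\<bar> * l + l * l / 4"
      by (simp add: power2_eq_square algebra_simps)
    then show ?thesis using assms by (simp add: diff_divide_distrib add_divide_distrib)
  qed
  finally show ?thesis by simp
qed

text \<open>The distance from x is majorised by a parabola of scale 2 s with s = sqrt (m e^2),
  because parabolas have explicit iterates. At x this costs B s / 2 + B s, rounded up to 2 B
  s.\<close>

lemma iterate_displacement:
  assumes e: "e > 0" and h: "tame h" and B: "B \<ge> 0" and le: "\<And>y. \<bar>h y - c\<bar> \<le> A + B * \<bar>y - x\<bar>"
  shows "\<bar>(conv (g_ker e) ^^ m) h x - c\<bar> \<le> A + 2 * B * sqrt (real m * e\<^sup>2)"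
proof (cases "m = 0")
  case True
  then show ?thesis using le[of x] by simp
next
  case False
  define s where "s = sqrt (real m * e\<^sup>2)"
  have s: "s > 0" "s\<^sup>2 = real m * e\<^sup>2" unfolding s_def using False e by auto
  have q: "\<bar>h y - c\<bar> \<le> A + B * s / 2 + B / (2 * s) * (y - x)\<^sup>2" for y
  proof -
    have "B * \<bar>y - x\<bar> \<le> B * ((y - x)\<^sup>2 / (2 * s) + 2 * s / 4)"
      using abs_le_quadratic[of "2 * s" "y - x"] s B by (intro mult_left_mono) auto
    then show ?thesis using le[of y] by (simp add: algebra_simps)
  qed
  have tq: "tame (\<lambda>y. A' + B' * (y - x)\<^sup>2)" for A' B' by (intro tame_add tame_const tame_cmult tame_square)
  have "(conv (g_ker e) ^^ m) h x \<le> (conv (g_ker e) ^^ m) (\<lambda>y. (c + A + B * s / 2) + B / (2 * s) * (y - x)\<^sup>2) x"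
    by (rule iterate_mono[OF e h tq]) (use q in \<open>auto simp: abs_le_iff algebra_simps\<close>)
  moreover have "(conv (g_ker e) ^^ m) (\<lambda>y. (c - A - B * s / 2) + (- B / (2 * s)) * (y - x)\<^sup>2) x \<le> (conv (g_ker e) ^^ m) h x"
    by (rule iterate_mono[OF e tq h]) (use q in \<open>auto simp: abs_le_iff algebra_simps\<close>)
  moreover have "B / (2 * s) * ((x - x)\<^sup>2 + 2 * (real m * e\<^sup>2)) = B * s"
    unfolding s(2)[symmetric] using s(1) by (simp add: power2_eq_square)
  moreover have "- B / (2 * s) * ((x - x)\<^sup>2 + 2 * (real m * e\<^sup>2)) = - (B * s)"
    unfolding s(2)[symmetric] using s(1) by (simp add: power2_eq_square)
  moreover have "0 \<le> B * s" using B s by simp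
  ultimately have "\<bar>(conv (g_ker e) ^^ m) h x - c\<bar> \<le> A + 2 * (B * s)"
    unfolding iterate_quadratic[OF e] abs_le_iff by linarith
  then show ?thesis unfolding s_def[symmetric] by simp
qed

text \<open>The variance of the random walk generated by the kernel controls the increments of the iterates.\<close>

lemma iterate_increment_variance:
  assumes e: "e > 0" and w: "w \<in> borel_measurable borel" and S: "\<And>y. \<bar>w y\<bar> \<le> S"
  defines "P \<equiv> conv (g_ker e)"
  shows "real m * ((P ^^ m) w (x + h) - (P ^^ m) w x)\<^sup>2
    \<le> (exp (\<bar>h\<bar> / e) - 1)\<^sup>2 * ((P ^^ m) (\<lambda>y. (w y)\<^sup>2) x - ((P ^^ m) w x)\<^sup>2)"
proof (induction m arbitrary: x)
  case 0
  then show ?case by simp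
next
  case (Suc m)
  define k where "k = exp (\<bar>h\<bar> / e) - 1"
  have k0: "k \<ge> 0" unfolding k_def using e by simp
  define v where "v = (P ^^ m) w"
  have vm[measurable]: "v \<in> borel_measurable borel" and vS: "\<bar>v y\<bar> \<le> S" for y
    unfolding v_def P_def using conv_iterate_bounded[OF e w S] by auto
  have tv: "tame v" by (rule tame_bounded[OF vm vS])
  have vS2: "\<bar>(v y)\<^sup>2\<bar> \<le> S\<^sup>2" for y using power_mono[OF vS[of y] abs_ge_zero, of 2] by simp
  have tv2: "tame (\<lambda>y. (v y)\<^sup>2)" by (rule tame_bounded[OF _ vS2]) measurable
  define u where "u = (P ^^ m) (\<lambda>y. (w y)\<^sup>2)"
  have wS2: "\<bar>(w y)\<^sup>2\<bar> \<le> S\<^sup>2" for y using power_mono[OF S[of y] abs_ge_zero, of 2] by simp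
  have tu: "tame u" unfolding u_def P_def
    by (intro tame_iterate e tame_bounded[where B="S\<^sup>2"]) (use w wS2 in auto)
  have IH: "real m * (v (y + h) - v y)\<^sup>2 \<le> k\<^sup>2 * (u y - (v y)\<^sup>2)" for y
    using Suc[of y] unfolding v_def u_def k_def .
  have dS: "\<bar>v (y + h) - v y\<bar> \<le> 2 * S" for y using vS[of "y + h"] vS[of y] by linarith
  have dm: "(\<lambda>y. v (y + h) - v y) \<in> borel_measurable borel" by measurable
  have td2: "tame (\<lambda>y. (v (y + h) - v y)\<^sup>2)"
  proof (rule tame_bounded[where B="(2 * S)\<^sup>2"])
    show "\<bar>(v (y + h) - v y)\<^sup>2\<bar> \<le> (2 * S)\<^sup>2" for y using power_mono[OF dS[of y] abs_ge_zero, of 2] by simp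
  qed measurable
  have d: "P v (x + h) - P v x = P (\<lambda>y. v (y + h) - v y) x"
    unfolding P_def by (simp add: conv_g_diff[OF e tame_shift[OF tv] tv] conv_shift)
  \<comment> \<open>Jensen moves the square inside the average, so that the induction hypothesis can
    be used pointwise.\<close>
  have "real m * (P v (x + h) - P v x)\<^sup>2 \<le> real m * P (\<lambda>y. (v (y + h) - v y)\<^sup>2) x"
    unfolding d unfolding P_def using conv_g_jensen(2)[OF e dm dS] by (intro mult_left_mono) auto
  also have "\<dots> \<le> P (\<lambda>y. k\<^sup>2 * (u y - (v y)\<^sup>2)) x"
    unfolding P_def conv_cmult[symmetric, of "real m"]
    by (rule conv_g_mono[OF e tame_cmult[OF td2] tame_cmult[OF tame_diff[OF tu tv2]] IH])
  also have "\<dots> = k\<^sup>2 * (P u x - P (\<lambda>y. (v y)\<^sup>2) x)"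
    unfolding P_def conv_cmult by (simp add: conv_g_diff[OF e tu tv2])
  finally have 1: "real m * (P v (x + h) - P v x)\<^sup>2 \<le> k\<^sup>2 * (P u x - P (\<lambda>y. (v y)\<^sup>2) x)" .
  have "(P v (x + h) - P v x)\<^sup>2 \<le> k\<^sup>2 * (P (\<lambda>y. (v y)\<^sup>2) x - (P v x)\<^sup>2)"
  proof -
    \<comment> \<open>Increments ignore constants; recentring at the mean turns the second moment on
      the right into the variance created by the new step.\<close>
    define c where "c = P v x"
    have tc: "tame (\<lambda>y. v y - c)" by (intro tame_diff tv tame_const)
    have Pc: "P (\<lambda>y. v y - c) z = P v z - c" for z
      unfolding P_def by (simp add: conv_g_diff[OF e tv tame_const] conv_g_const[OF e])
    have "\<bar>P v (x + h) - P v x\<bar> \<le> k * P (\<lambda>y. \<bar>v y - c\<bar>) x"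
      using conv_g_increment[OF e tc, of "x + h" x] Pc unfolding P_def k_def by simp
    then have "\<bar>P v (x + h) - P v x\<bar>\<^sup>2 \<le> (k * P (\<lambda>y. \<bar>v y - c\<bar>) x)\<^sup>2" by (rule power_mono) simp
    also have "\<dots> \<le> k\<^sup>2 * P (\<lambda>y. \<bar>v y - c\<bar>\<^sup>2) x"
      unfolding power_mult_distrib P_def
    proof (intro mult_left_mono conv_g_jensen(2)[OF e])
      show "\<bar>\<bar>v y - c\<bar>\<bar> \<le> S + \<bar>c\<bar>" for y using vS[of y] by linarith
    qed auto
    also have "P (\<lambda>y. \<bar>v y - c\<bar>\<^sup>2) x = P (\<lambda>y. (v y)\<^sup>2) x - 2 * c * P v x + c\<^sup>2"
      unfolding P_def power2_abs by (rule conv_g_jensen(1)[OF e vm vS])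
    finally show ?thesis unfolding c_def by (simp add: power2_eq_square algebra_simps)
  qed
  \<comment> \<open>The average of v^2 cancels between the two bounds: total variance is the
    averaged variance of the first m steps plus that of the new one.\<close>
  then have "real (Suc m) * (P v (x + h) - P v x)\<^sup>2 \<le> k\<^sup>2 * (P u x - (P v x)\<^sup>2)"
    using 1 by (simp add: algebra_simps)
  then show ?case unfolding v_def u_def k_def by simp
qed

text \<open>The variance is at most S^2, so an increment over \<bar>h\<bar> \<le> e is at most S
  (exp(\<bar>h\<bar>/e) - 1) / sqrt m, and exp z - 1 \<le> 2 z on [0, 1] makes this linear. Longer
  distances are cut into \<open>N\<close> pieces of length at most e.\<close>

lemma iterate_lipschitz:
  assumes e: "e > 0" and w: "w \<in> borel_measurable borel" and S: "\<And>y. \<bar>w y\<bar> \<le> S" and m: "m > 0"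
  shows "\<bar>(conv (g_ker e) ^^ m) w x - (conv (g_ker e) ^^ m) w y\<bar> \<le> 2 * S * \<bar>x - y\<bar> / sqrt (real m * e\<^sup>2)"
proof -
  define v where "v = (conv (g_ker e) ^^ m) w"
  have S0: "S \<ge> 0" using S[of 0] by linarith
  have small: "\<bar>v (z + h) - v z\<bar> \<le> 2 * S * \<bar>h\<bar> / (e * sqrt (real m))" if h: "\<bar>h\<bar> \<le> e" for z h
  proof -
    have wS2: "\<bar>(w y)\<^sup>2\<bar> \<le> S\<^sup>2" for y using power_mono[OF S[of y] abs_ge_zero, of 2] by simp
    have "real m * (v (z + h) - v z)\<^sup>2 \<le> (exp (\<bar>h\<bar> / e) - 1)\<^sup>2 * ((conv (g_ker e) ^^ m) (\<lambda>y. (w y)\<^sup>2) z - (v z)\<^sup>2)"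
      unfolding v_def by (rule iterate_increment_variance[OF e w S])
    also have "\<dots> \<le> (exp (\<bar>h\<bar> / e) - 1)\<^sup>2 * S\<^sup>2"
    proof (rule mult_left_mono)
      have "\<bar>(conv (g_ker e) ^^ m) (\<lambda>y. (w y)\<^sup>2) z\<bar> \<le> S\<^sup>2"
        by (rule conv_iterate_bounded(2)[OF e _ wS2]) (use w in measurable)
      then show "(conv (g_ker e) ^^ m) (\<lambda>y. (w y)\<^sup>2) z - (v z)\<^sup>2 \<le> S\<^sup>2" by (smt (verit) zero_le_power2)
    qed auto
    also have "\<dots> \<le> (2 * (\<bar>h\<bar> / e))\<^sup>2 * S\<^sup>2"
    proof (intro mult_right_mono power_mono)
      have t: "0 \<le> \<bar>h\<bar> / e" "\<bar>h\<bar> / e \<le> 1" using e h by auto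
      then have "(\<bar>h\<bar> / e)\<^sup>2 \<le> \<bar>h\<bar> / e" unfolding power2_eq_square by (intro mult_left_le)
      then show "exp (\<bar>h\<bar> / e) - 1 \<le> 2 * (\<bar>h\<bar> / e)" using exp_bound[OF t] by linarith
    qed (use e in auto)
    finally have "sqrt (real m * (v (z + h) - v z)\<^sup>2) \<le> sqrt ((2 * (\<bar>h\<bar> / e))\<^sup>2 * S\<^sup>2)" by simp
    then have "sqrt (real m) * \<bar>v (z + h) - v z\<bar> \<le> 2 * (\<bar>h\<bar> / e) * S"
      using e S0 by (simp add: real_sqrt_mult)
    then have "\<bar>v (z + h) - v z\<bar> \<le> 2 * (\<bar>h\<bar> / e) * S / sqrt (real m)"
      using m by (subst pos_le_divide_eq) (auto simp: mult.commute)
    then show ?thesis by (simp add: mult.commute mult.left_commute)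
  qed
  obtain N :: nat where N: "\<bar>x - y\<bar> / e < real N" using reals_Archimedean2 by blast
  then have N0: "N > 0" using e by (smt (verit) divide_nonneg_pos of_nat_0_less_iff of_nat_0)
  define h where "h = (x - y) / real N"
  have h: "\<bar>h\<bar> \<le> e" using N N0 e unfolding h_def by (simp add: field_simps)
  have chain: "\<bar>v (y + real j * h) - v y\<bar> \<le> real j * (2 * S * \<bar>h\<bar> / (e * sqrt (real m)))" for j
  proof (induction j)
    case (Suc j)
    have eq: "y + real (Suc j) * h = (y + real j * h) + h" by (simp add: algebra_simps)
    have "\<bar>v (y + real (Suc j) * h) - v (y + real j * h)\<bar> \<le> 2 * S * \<bar>h\<bar> / (e * sqrt (real m))"
      unfolding eq by (rule small[OF h])
    then show ?case using Suc by (simp only: of_nat_Suc distrib_right mult_1)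
  qed simp
  have "y + real N * h = x" unfolding h_def using N0 by simp
  moreover have "sqrt (real m * e\<^sup>2) = e * sqrt (real m)" using e by (simp add: real_sqrt_mult)
  moreover have "real N * (2 * S * \<bar>h\<bar> / d) = 2 * S * \<bar>x - y\<bar> / d" for d
  proof -
    have "real N * \<bar>h\<bar> = \<bar>x - y\<bar>" unfolding h_def using N0 by (simp add: abs_divide)
    then have "2 * S * \<bar>x - y\<bar> / d = 2 * S * (real N * \<bar>h\<bar>) / d" by simp
    then show ?thesis by (simp only: mult_ac times_divide_eq_right)
  qed
  ultimately show ?thesis using chain[of N] unfolding v_def by (simp only:)
qed

section \<open>Sources, memory and moduli of continuity of the fluctuations\<close>

text \<open>After rescaling by e the source is F z - F (z - d), where F has derivative
  exp(-\<bar>t\<bar>) and d \<le> \<alpha> e / 2. It is nonnegative because the interface only moves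
  left. On [z - d, z] the derivative is at most exp d exp(-\<bar>z\<bar>), and e exp(-\<bar>z\<bar>)
  is the excess in \<open>conv_g_dist\<close>.\<close>

lemma r_seq_bounds:
  assumes e: "e > 0" and \<alpha>: "\<alpha> > 0" and u: "state_bounds \<alpha> u \<xi>"
  shows "0 \<le> r_seq e u \<xi> n x"
    "r_seq e u \<xi> n x \<le> \<alpha> / 2 * exp (\<alpha> / 2 * e) *
      (conv (g_ker e) (\<lambda>y. \<bar>y - xi_seq e u \<xi> (Suc n)\<bar>) x - \<bar>x - xi_seq e u \<xi> (Suc n)\<bar>)"
proof -
  define L where "L = \<alpha> / 2"
  define a where "a = xi_seq e u \<xi> (Suc n)"
  define b where "b = xi_seq e u \<xi> n"
  define z where "z = (x - a) / e"
  define d where "d = (b - a) / e"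
  have ab: "a \<le> b" "b - a \<le> L * e\<^sup>2" using scheme_bounds(2,3)[OF e \<alpha> u, of n] unfolding a_def b_def L_def by auto
  have d0: "0 \<le> d" unfolding d_def using ab e by simp
  have "(b - a) / e \<le> L * e\<^sup>2 / e" using ab e by (intro divide_right_mono) auto
  then have dL: "d \<le> L * e" unfolding d_def using e by (simp add: power2_eq_square)
  define F where "F t = sgn t * (1 - exp (- \<bar>t\<bar>))" for t :: real
  have F: "conv (g_ker e) (\<lambda>y. sgn (y - c)) x = F ((x - c) / e)" for c
    unfolding conv_g_sgn[OF e] F_def using e by (simp add: sgn_divide abs_divide)
  have "(x - b) / e = z - d" unfolding z_def d_def by (simp add: diff_divide_distrib)
  then have r: "r_seq e u \<xi> n x = F z - F (z - d)"
    unfolding r_seq_def F a_def[symmetric] b_def[symmetric] by (simp add: z_def)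
  have "F (z - d) \<le> F z" and up: "F z - F (z - d) \<le> d * exp d * exp (- \<bar>z\<bar>)"
  proof -
    have ed: "d \<le> d * exp d" using d0 by (simp add: mult_le_cancel_left1)
    have e1: "1 - exp (- t) \<le> t" for t :: real using exp_ge_add_one_self[of "-t"] by linarith
    have Fn: "F t = exp t - 1" if "t \<le> 0" for t unfolding F_def using that by (cases "t = 0") auto
    have Fp: "F t = 1 - exp (- t)" if "t \<ge> 0" for t unfolding F_def using that by (cases "t = 0") auto
    \<comment> \<open>The cases record where 0 lies relative to the interval [z - d, z]; when it is
      interior, both branches of F enter.\<close>
    consider "z \<le> 0" | "0 < z" "z < d" | "d \<le> z" using d0 by linarith
    then have "F (z - d) \<le> F z \<and> F z - F (z - d) \<le> d * exp d * exp (- \<bar>z\<bar>)"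
    proof cases
      case 1
      have "F z - F (z - d) = exp z * (1 - exp (- d))"
        using 1 d0 by (simp add: Fn right_diff_distrib flip: exp_add)
      moreover have "exp z * (1 - exp (- d)) \<le> exp z * (d * exp d)" using e1[of d] ed by (intro mult_left_mono) auto
      moreover have "0 \<le> exp z * (1 - exp (- d))" using d0 by simp
      ultimately show ?thesis using 1 by (simp add: mult.commute)
    next
      case 2
      have *: "F z - F (z - d) = (1 - exp (- z)) + (1 - exp (- (d - z)))" using 2 by (simp add: Fn Fp)
      then have "F z - F (z - d) \<le> d" using e1[of z] e1[of "d - z"] by linarith
      also have "d \<le> d * exp (d - z)" using 2 by (simp add: mult_le_cancel_left1)
      finally have "F z - F (z - d) \<le> d * exp d * exp (- \<bar>z\<bar>)" using 2 by (simp add: exp_diff exp_minus divide_inverse mult.assoc)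
      moreover have "exp (- z) \<le> 1" "exp (- (d - z)) \<le> 1" using 2 by auto
      ultimately show ?thesis using * by linarith
    next
      case 3
      have *: "F z - F (z - d) = exp (- z) * (exp d - 1)"
        using 3 d0 by (simp add: Fp right_diff_distrib flip: exp_add)
      have "exp d - 1 = exp d * (1 - exp (- d))" by (simp add: right_diff_distrib flip: exp_add)
      also have "\<dots> \<le> exp d * d" using e1[of d] by (intro mult_left_mono) auto
      finally have "exp (- z) * (exp d - 1) \<le> exp (- z) * (exp d * d)" by (intro mult_left_mono) auto
      moreover have "0 \<le> exp (- z) * (exp d - 1)" using d0 by simp
      then have "F (z - d) \<le> F z" unfolding *[symmetric] by simp
      ultimately show ?thesis using * 3 d0 by (simp add: mult_ac)
    qed
    then show "F (z - d) \<le> F z" "F z - F (z - d) \<le> d * exp d * exp (- \<bar>z\<bar>)" by auto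
  qed
  then show "0 \<le> r_seq e u \<xi> n x" unfolding r by simp
  have "d * exp d * exp (- \<bar>z\<bar>) \<le> L * e * exp (L * e) * exp (- \<bar>z\<bar>)"
    using dL d0 by (intro mult_right_mono mult_mono) auto
  also have "\<dots> = L * exp (L * e) * (e * exp (- \<bar>x - a\<bar> / e))" unfolding z_def using e by (simp add: abs_divide mult_ac)
  finally show "r_seq e u \<xi> n x \<le> \<alpha> / 2 * exp (\<alpha> / 2 * e) *
      (conv (g_ker e) (\<lambda>y. \<bar>y - xi_seq e u \<xi> (Suc n)\<bar>) x - \<bar>x - xi_seq e u \<xi> (Suc n)\<bar>)"
    using up unfolding r conv_g_dist[OF e] a_def[symmetric] L_def[symmetric] by simp
qed

lemma xi_seq_dist:
  assumes e: "e > 0" and \<alpha>: "\<alpha> > 0" and u: "state_bounds \<alpha> u \<xi>"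
  shows "xi_seq e u \<xi> (n + m) \<le> xi_seq e u \<xi> n"
    "xi_seq e u \<xi> n - xi_seq e u \<xi> (n + m) \<le> \<alpha> / 2 * (real m * e\<^sup>2)"
proof (induction m)
  case (Suc m)
  { case 1 show ?case using scheme_bounds(2)[OF e \<alpha> u, of "n + m"] Suc by simp }
  { case 2 show ?case using scheme_bounds(3)[OF e \<alpha> u, of "n + m"] Suc by (simp add: algebra_simps) }
qed auto

text \<open>Telescoping: the source terms are dominated by increments of the iterates of \<open>\<bar>\<cdot> - \<xi>\<bar>\<close>.\<close>

lemma f_seq_memory:
  assumes e: "e > 0" and \<alpha>: "\<alpha> > 0" and u: "state_bounds \<alpha> u \<xi>"
  defines "P \<equiv> conv (g_ker e)"
  shows "(P ^^ m) (f_seq e u \<xi> n) x \<le> f_seq e u \<xi> (n + m) x"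
    "f_seq e u \<xi> (n + m) x - (P ^^ m) (f_seq e u \<xi> n) x \<le> \<alpha> / 2 * exp (\<alpha> / 2 * e) *
      ((P ^^ m) (\<lambda>y. \<bar>y - xi_seq e u \<xi> n\<bar>) x - \<bar>x - xi_seq e u \<xi> (n + m)\<bar> + \<alpha> / 2 * (real m * e\<^sup>2))"
proof (induction m arbitrary: x)
  case 0
  { case 1 show ?case by simp }
  { case 2 show ?case by simp }
next
  case (Suc m)
  define L where "L = \<alpha> / 2"
  define C where "C = L * exp (L * e)"
  define X where "X k = xi_seq e u \<xi> k" for k
  define f where "f = f_seq e u \<xi>"
  define v where "v = (P ^^ m) (f n)"
  define w where "w = (P ^^ m) (\<lambda>y. \<bar>y - X n\<bar>)"
  have C0: "C \<ge> 0" unfolding C_def L_def using \<alpha> by simp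
  have tabs: "tame (\<lambda>y. \<bar>y - a\<bar>)" for a :: real by (intro tame_abs tame_diff tame_id tame_const)
  have tf: "tame (f k)" for k unfolding f_def by (rule f_seq_tame[OF e])
  have tv: "tame v" unfolding v_def P_def by (rule tame_iterate[OF e tf])
  have tw: "tame w" unfolding w_def P_def by (rule tame_iterate[OF e tabs])
  have IH1: "v y \<le> f (n + m) y" for y using Suc(1)[of y] unfolding v_def f_def .
  have IH2: "f (n + m) y - v y \<le> C * (w y - \<bar>y - X (n + m)\<bar> + L * (real m * e\<^sup>2))" for y
    using Suc(2)[of y] unfolding v_def w_def f_def C_def L_def X_def .
  have fS: "f (n + Suc m) x = P (f (n + m)) x + r_seq e u \<xi> (n + m) x" for x
    unfolding f_def P_def using f_seq_Suc[OF e] by simp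
  have P1: "P v x \<le> P (f (n + m)) x" for x unfolding P_def by (rule conv_g_mono[OF e tv tf IH1])
  have "P (\<lambda>y. f (n + m) y - v y) x \<le> P (\<lambda>y. C * ((w y - \<bar>y - X (n + m)\<bar>) + L * (real m * e\<^sup>2))) x" for x
    unfolding P_def by (rule conv_g_mono[OF e]) (use IH2 in \<open>auto intro!: tame_diff tame_add tame_cmult tf tv tw tabs\<close>)
  then have P2: "P (f (n + m)) x - P v x \<le> C * (P w x - P (\<lambda>y. \<bar>y - X (n + m)\<bar>) x + L * (real m * e\<^sup>2))" for x
    unfolding P_def conv_g_diff[OF e tf tv] conv_cmult conv_g_add[OF e tame_diff[OF tw tabs] tame_const]
      conv_g_diff[OF e tw tabs] conv_g_const[OF e] .
  note r = r_seq_bounds[OF e \<alpha> u, of "n + m", folded L_def, folded C_def]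
  \<comment> \<open>The bound on the new source is centred at the new interface, the sum so far at
    the old one. Changing the centre costs at most \<open>L * e\<^sup>2\<close> per step, which
    accumulates to the term with m e^2.\<close>
  have "P (\<lambda>y. \<bar>y - X (n + Suc m)\<bar>) x \<le> P (\<lambda>y. \<bar>y - X (n + m)\<bar> + L * e\<^sup>2) x" for x
    unfolding P_def
  proof (rule conv_g_mono[OF e tabs tame_add[OF tabs tame_const]])
    show "\<bar>y - X (n + Suc m)\<bar> \<le> \<bar>y - X (n + m)\<bar> + L * e\<^sup>2" for y
      using scheme_bounds(2,3)[OF e \<alpha> u, of "n + m"] unfolding X_def L_def by simp
  qed
  then have P3: "P (\<lambda>y. \<bar>y - X (n + Suc m)\<bar>) x \<le> P (\<lambda>y. \<bar>y - X (n + m)\<bar>) x + L * e\<^sup>2" for x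
    unfolding P_def conv_g_add[OF e tabs tame_const] conv_g_const[OF e] .
  have vS: "(P ^^ Suc m) (f n) x = P v x" for x unfolding v_def by simp
  { case 1 show ?case unfolding f_def[symmetric] vS fS by (rule add_increasing2[OF r(1) P1]) }
  { case (2 x)
    have "f (n + Suc m) x - P v x \<le> C * (P w x - P (\<lambda>y. \<bar>y - X (n + m)\<bar>) x + L * (real m * e\<^sup>2))
        + C * (P (\<lambda>y. \<bar>y - X (n + Suc m)\<bar>) x - \<bar>x - X (n + Suc m)\<bar>)"
      using P2[of x] r(2)[of x] unfolding fS P_def X_def by simp
    also have "\<dots> = C * (P w x - \<bar>x - X (n + Suc m)\<bar> + L * (real m * e\<^sup>2)
        + (P (\<lambda>y. \<bar>y - X (n + Suc m)\<bar>) x - P (\<lambda>y. \<bar>y - X (n + m)\<bar>) x))"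
      by (simp add: algebra_simps)
    also have "\<dots> \<le> C * (P w x - \<bar>x - X (n + Suc m)\<bar> + L * (real m * e\<^sup>2) + L * e\<^sup>2)"
      using P3[of x] C0 by (intro mult_left_mono) auto
    finally show ?case
      unfolding f_def[symmetric] L_def[symmetric] C_def[symmetric] X_def[symmetric]
      unfolding v_def w_def by (simp add: algebra_simps) }
qed

text \<open>Two contributions: the displacement of the walk, at most 2 sqrt \<theta>, and terms from
  the drift of the interface, at most \<alpha> \<theta> together, where \<theta> \<le> sqrt \<theta>
  sqrt T. With e \<le> sqrt T in the exponential factor everything fits under
  \<open>C1 * sqrt \<theta>\<close>.\<close>

lemma f_seq_memory_sqrt:
  assumes e: "e > 0" and \<alpha>: "\<alpha> > 0" and u: "state_bounds \<alpha> u \<xi>"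
    and eT: "e\<^sup>2 \<le> T" and \<theta>: "real m * e\<^sup>2 \<le> \<theta>" "\<theta> \<le> T"
  defines "C1 \<equiv> \<alpha> * exp (\<alpha> / 2 * sqrt T) * (1 + \<alpha> * sqrt T)"
  shows "f_seq e u \<xi> (n + m) x - (conv (g_ker e) ^^ m) (f_seq e u \<xi> n) x \<le> C1 * sqrt \<theta>"
proof -
  define L where "L = \<alpha> / 2"
  define s where "s = sqrt \<theta>"
  define X where "X k = xi_seq e u \<xi> k" for k
  have L0: "L > 0" unfolding L_def using \<alpha> by simp
  have t0: "0 \<le> real m * e\<^sup>2" by simp
  then have th0: "0 \<le> \<theta>" using \<theta> by linarith
  have s0: "0 \<le> s" "s\<^sup>2 = \<theta>" "s \<le> sqrt T" unfolding s_def using \<theta> th0 by auto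
  have ms: "sqrt (real m * e\<^sup>2) \<le> s" unfolding s_def using \<theta> by simp
  have "e = sqrt (e\<^sup>2)" using e by simp
  also have "\<dots> \<le> sqrt T" using eT by (rule real_sqrt_le_mono)
  finally have es: "e \<le> sqrt T" .
  have ta: "tame (\<lambda>y. \<bar>y - X n\<bar>)" by (intro tame_abs tame_diff tame_id tame_const)
  have "\<bar>(conv (g_ker e) ^^ m) (\<lambda>y. \<bar>y - X n\<bar>) x - \<bar>x - X n\<bar>\<bar> \<le> 0 + 2 * 1 * sqrt (real m * e\<^sup>2)"
    by (rule iterate_displacement[OF e ta]) auto
  then have D: "(conv (g_ker e) ^^ m) (\<lambda>y. \<bar>y - X n\<bar>) x \<le> \<bar>x - X n\<bar> + 2 * s" using ms by linarith
  have "L * (real m * e\<^sup>2) \<le> L * \<theta>" using \<theta> L0 by (intro mult_left_mono) auto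
  moreover have "\<bar>x - X n\<bar> - \<bar>x - X (n + m)\<bar> \<le> L * (real m * e\<^sup>2)"
    using xi_seq_dist[OF e \<alpha> u, of n m] unfolding X_def L_def by linarith
  ultimately have "(conv (g_ker e) ^^ m) (\<lambda>y. \<bar>y - X n\<bar>) x - \<bar>x - X (n + m)\<bar> + L * (real m * e\<^sup>2)
      \<le> 2 * s + 2 * (L * \<theta>)" using D by linarith
  also have "\<dots> \<le> 2 * s + 2 * (L * (s * sqrt T))"
    using s0 L0 by (simp add: power2_eq_square mult_left_mono flip: s0(2))
  finally have U: "(conv (g_ker e) ^^ m) (\<lambda>y. \<bar>y - X n\<bar>) x - \<bar>x - X (n + m)\<bar> + L * (real m * e\<^sup>2)
      \<le> 2 * s * (1 + L * sqrt T)" by (simp add: algebra_simps)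
  have "f_seq e u \<xi> (n + m) x - (conv (g_ker e) ^^ m) (f_seq e u \<xi> n) x \<le> L * exp (L * e) *
     ((conv (g_ker e) ^^ m) (\<lambda>y. \<bar>y - X n\<bar>) x - \<bar>x - X (n + m)\<bar> + L * (real m * e\<^sup>2))"
    using f_seq_memory(2)[OF e \<alpha> u, of n m x] unfolding X_def L_def .
  also have "\<dots> \<le> L * exp (L * e) * (2 * s * (1 + L * sqrt T))"
    using U L0 by (intro mult_left_mono) auto
  also have "\<dots> \<le> L * exp (L * sqrt T) * (2 * s * (1 + 2 * L * sqrt T))"
  proof (intro mult_mono)
    show "1 + L * sqrt T \<le> 1 + 2 * L * sqrt T" using L0 order_trans[OF zero_le_power2 eT] by simp
    show "exp (L * e) \<le> exp (L * sqrt T)" using es L0 by simp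
  qed (use L0 s0 order_trans[OF zero_le_power2 eT] in auto)
  also have "\<dots> = C1 * s" unfolding C1_def L_def by simp
  finally show ?thesis unfolding s_def .
qed

lemma f_seq_bounded:
  assumes e: "e > 0" and \<alpha>: "\<alpha> > 0" and u: "state_bounds \<alpha> u \<xi>"
    and eT: "e\<^sup>2 \<le> T" and \<theta>: "real n * e\<^sup>2 \<le> \<theta>" "\<theta> \<le> T"
  defines "C1 \<equiv> \<alpha> * exp (\<alpha> / 2 * sqrt T) * (1 + \<alpha> * sqrt T)"
  shows "0 \<le> f_seq e u \<xi> n x" "f_seq e u \<xi> n x \<le> C1 * sqrt \<theta>"
proof -
  \<comment> \<open>f starts from zero, so the memory estimate from step 0 bounds all of f. Zero is
    the parabola with A = B = 0, hence its iterates vanish.\<close>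
  have "(conv (g_ker e) ^^ m) (f_seq e u \<xi> 0) x = 0" for m
    using iterate_quadratic[OF e, of m 0 0 0 x] by (simp add: f_seq_0[abs_def])
  then show "0 \<le> f_seq e u \<xi> n x" "f_seq e u \<xi> n x \<le> C1 * sqrt \<theta>"
    using f_seq_memory(1)[OF e \<alpha> u, of n 0 x] f_seq_memory_sqrt[OF e \<alpha> u eT \<theta>, of 0 x]
    unfolding C1_def by auto
qed

text \<open>\<theta> is a free window length: \<theta> can be chosen small first and \<bar>x -
  y\<bar> small afterwards, depending on \<theta>. If the elapsed time is shorter than the window, f
  itself is already of order sqrt \<theta>.\<close>

lemma f_seq_space_modulus:
  assumes e: "e > 0" and \<alpha>: "\<alpha> > 0" and u: "state_bounds \<alpha> u \<xi>"
    and \<theta>: "e\<^sup>2 \<le> \<theta>" "\<theta> \<le> T" and n: "real n * e\<^sup>2 \<le> T"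
  defines "C1 \<equiv> \<alpha> * exp (\<alpha> / 2 * sqrt T) * (1 + \<alpha> * sqrt T)"
  shows "\<bar>f_seq e u \<xi> n x - f_seq e u \<xi> n y\<bar> \<le> C1 * sqrt \<theta> + 4 * (C1 * sqrt T) / sqrt \<theta> * \<bar>x - y\<bar>"
proof -
  have eT: "e\<^sup>2 \<le> T" using \<theta> by linarith
  have th: "\<theta> > 0" using \<theta> e by (smt (verit) zero_less_power)
  have T0: "T > 0" using th \<theta> by linarith
  have C0: "C1 \<ge> 0" unfolding C1_def using \<alpha> T0 by (intro mult_nonneg_nonneg add_nonneg_nonneg) auto
  have nonneg: "0 \<le> 4 * (C1 * sqrt T) / sqrt \<theta> * \<bar>x - y\<bar>" using C0 T0 th by (intro mult_nonneg_nonneg divide_nonneg_nonneg) auto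
  show ?thesis
  proof (cases "real n * e\<^sup>2 \<le> \<theta>")
    case True
    note b = f_seq_bounded[OF e \<alpha> u eT True \<theta>(2), folded C1_def]
    show ?thesis using b[of x] b[of y] nonneg by linarith
  next
    case False
    \<comment> \<open>The number of steps in the window. As e^2 \<le> \<theta> it is at least 1, and
      rounding down loses at most a factor 2; hence sqrt (m e^2) \<ge> sqrt \<theta> / 2, the origin
      of the 4 in the bound.\<close>
    define m where "m = nat \<lfloor>\<theta> / e\<^sup>2\<rfloor>"
    have e2: "e\<^sup>2 > 0" using e by simp
    have q: "1 \<le> \<theta> / e\<^sup>2" using \<theta> e2 by simp
    have m1: "real m \<le> \<theta> / e\<^sup>2" "\<theta> / e\<^sup>2 < real m + 1" unfolding m_def using q by linarith+
    have m: "m > 0" unfolding m_def using q by linarith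
    have mt: "real m * e\<^sup>2 \<le> \<theta>" using m1(1) e2 by (simp add: pos_le_divide_eq)
    have "\<theta> < (real m + 1) * e\<^sup>2" using m1(2) e2 by (simp add: pos_divide_less_eq)
    also have "\<dots> \<le> (2 * real m) * e\<^sup>2" using m by (intro mult_right_mono) auto
    finally have mt2: "\<theta> / 2 \<le> real m * e\<^sup>2" by simp
    have "real m * e\<^sup>2 < real n * e\<^sup>2" using mt False by linarith
    then have mn: "m \<le> n" using e2 by simp
    define k where "k = n - m"
    have nk: "n = k + m" unfolding k_def using mn by simp
    have "real k * e\<^sup>2 \<le> real n * e\<^sup>2" unfolding nk using e2 by simp
    then have kT: "real k * e\<^sup>2 \<le> T" using n by linarith
    note b = f_seq_bounded[OF e \<alpha> u eT kT order_refl, folded C1_def]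
    have bS: "\<bar>f_seq e u \<xi> k z\<bar> \<le> C1 * sqrt T" for z using b[of z] by simp
    let ?v = "(conv (g_ker e) ^^ m) (f_seq e u \<xi> k)"
    have lip: "\<bar>?v x - ?v y\<bar> \<le> 2 * (C1 * sqrt T) * \<bar>x - y\<bar> / sqrt (real m * e\<^sup>2)"
      by (rule iterate_lipschitz[OF e tame_measurable[OF f_seq_tame[OF e]] bS m])
    also have "\<dots> \<le> 2 * (C1 * sqrt T) * \<bar>x - y\<bar> / (sqrt \<theta> / 2)"
    proof (rule divide_left_mono)
      have "sqrt \<theta> / 2 = sqrt (\<theta> / 4)" by (simp add: real_sqrt_divide)
      also have "\<dots> \<le> sqrt (real m * e\<^sup>2)" using mt2 th by (intro real_sqrt_le_mono) linarith
      finally show "sqrt \<theta> / 2 \<le> sqrt (real m * e\<^sup>2)" .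
    qed (use C0 T0 th m e in auto)
    finally have "\<bar>?v x - ?v y\<bar> \<le> 4 * (C1 * sqrt T) / sqrt \<theta> * \<bar>x - y\<bar>" by (simp add: mult_ac)
    \<comment> \<open>Both excesses over the smoothed part lie in [0, C1 sqrt \<theta>], so their
      difference costs one such term and not two.\<close>
    moreover have "?v z \<le> f_seq e u \<xi> n z" "f_seq e u \<xi> n z - ?v z \<le> C1 * sqrt \<theta>" for z
      unfolding nk using f_seq_memory(1)[OF e \<alpha> u] f_seq_memory_sqrt[OF e \<alpha> u eT mt \<theta>(2)] C1_def by auto
    ultimately show ?thesis by (smt (verit))
  qed
qed

text \<open>Between the two times f is smoothed k times and receives k sources. The memory estimate
  covers the sources; \<open>iterate_displacement\<close> converts the spatial modulus into a bound
  on the effect of the smoothing.\<close>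

lemma f_seq_time_modulus:
  assumes e: "e > 0" and \<alpha>: "\<alpha> > 0" and u: "state_bounds \<alpha> u \<xi>"
    and \<theta>: "e\<^sup>2 \<le> \<theta>" "\<theta> \<le> T" and n: "real (n + k) * e\<^sup>2 \<le> T"
  defines "C1 \<equiv> \<alpha> * exp (\<alpha> / 2 * sqrt T) * (1 + \<alpha> * sqrt T)"
  defines "s \<equiv> sqrt (real k * e\<^sup>2)"
  shows "\<bar>f_seq e u \<xi> (n + k) x - f_seq e u \<xi> n x\<bar> \<le> C1 * s + C1 * sqrt \<theta> + 8 * (C1 * sqrt T) / sqrt \<theta> * s"
proof -
  have eT: "e\<^sup>2 \<le> T" using \<theta> by linarith
  have th: "\<theta> > 0" using \<theta> e by (smt (verit) zero_less_power)
  have T0: "T > 0" using th \<theta> by linarith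
  have C0: "C1 \<ge> 0" unfolding C1_def using \<alpha> T0 by (intro mult_nonneg_nonneg add_nonneg_nonneg) auto
  have "real n * e\<^sup>2 \<le> real (n + k) * e\<^sup>2" "real k * e\<^sup>2 \<le> real (n + k) * e\<^sup>2" by (intro mult_right_mono; simp)+
  then have nT: "real n * e\<^sup>2 \<le> T" and kT: "real k * e\<^sup>2 \<le> T" using n by auto
  let ?v = "(conv (g_ker e) ^^ k) (f_seq e u \<xi> n)"
  have "\<bar>?v x - f_seq e u \<xi> n x\<bar> \<le> C1 * sqrt \<theta> + 2 * (4 * (C1 * sqrt T) / sqrt \<theta>) * sqrt (real k * e\<^sup>2)"
  proof (rule iterate_displacement[OF e f_seq_tame[OF e]])
    show "0 \<le> 4 * (C1 * sqrt T) / sqrt \<theta>" using C0 T0 th by auto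
    show "\<bar>f_seq e u \<xi> n y - f_seq e u \<xi> n x\<bar> \<le> C1 * sqrt \<theta> + 4 * (C1 * sqrt T) / sqrt \<theta> * \<bar>y - x\<bar>" for y
      unfolding C1_def by (rule f_seq_space_modulus[OF e \<alpha> u \<theta> nT])
  qed
  moreover have "?v x \<le> f_seq e u \<xi> (n + k) x" "f_seq e u \<xi> (n + k) x - ?v x \<le> C1 * s"
    unfolding s_def using f_seq_memory(1)[OF e \<alpha> u] f_seq_memory_sqrt[OF e \<alpha> u eT order_refl kT] C1_def by auto
  ultimately show ?thesis unfolding s_def by (simp add: abs_le_iff)
qed

section \<open>The heat equation\<close>

lemma has_real_derivative_integral:
  fixes f :: "real \<Rightarrow> 'a \<Rightarrow> real"
  assumes r: "r > 0"
    and d: "\<And>s y. \<bar>s - s0\<bar> < r \<Longrightarrow> ((\<lambda>s. f s y) has_real_derivative f' s y) (at s)"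
    and b: "\<And>s y. \<bar>s - s0\<bar> < r \<Longrightarrow> \<bar>f' s y\<bar> \<le> w y" and w: "integrable M w"
    and i: "\<And>s. \<bar>s - s0\<bar> < r \<Longrightarrow> integrable M (f s)" and m: "f' s0 \<in> borel_measurable M"
  shows "((\<lambda>s. integral\<^sup>L M (f s)) has_real_derivative integral\<^sup>L M (f' s0)) (at s0)"
  unfolding DERIV_def tendsto_at_iff_sequentially
proof (intro allI impI)
  fix X :: "nat \<Rightarrow> real" assume X: "\<forall>i. X i \<in> UNIV - {0}" "X \<longlonglongrightarrow> 0"
  \<comment> \<open>Quotients with \<bar>X n\<bar> \<ge> r are replaced by 0, so that the majorant w
    holds for every n; only finitely many n are affected.\<close>
  define s where "s n y = (if \<bar>X n\<bar> < r then (f (s0 + X n) y - f s0 y) / X n else 0)" for n y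
  have ev: "\<forall>\<^sub>F n in sequentially. \<bar>X n\<bar> < r"
    using X(2) r tendstoD[of X 0 sequentially r] by simp
  have lim: "(\<lambda>n. integral\<^sup>L M (s n)) \<longlonglongrightarrow> integral\<^sup>L M (f' s0)"
  proof (rule integral_dominated_convergence[where w=w])
    show "s n \<in> borel_measurable M" for n
      using i[of "s0 + X n"] i[of s0] r unfolding s_def by (cases "\<bar>X n\<bar> < r") (auto dest: borel_measurable_integrable)
    have "(\<lambda>n. s n y) \<longlonglongrightarrow> f' s0 y" for y
    proof -
      have "((\<lambda>h. (f (s0 + h) y - f s0 y) / h) \<longlongrightarrow> f' s0 y) (at 0)"
        using d[of s0 y] r unfolding DERIV_def by simp
      then have "(\<lambda>n. (f (s0 + X n) y - f s0 y) / X n) \<longlonglongrightarrow> f' s0 y"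
        using X unfolding tendsto_at_iff_sequentially comp_def by blast
      then show ?thesis
        by (rule Lim_transform_eventually) (use ev in eventually_elim, auto simp: s_def)
    qed
    then show "AE y in M. (\<lambda>n. s n y) \<longlonglongrightarrow> f' s0 y" by simp
    have w0: "0 \<le> w y" for y
    proof -
      have "\<bar>f' s0 y\<bar> \<le> w y" using b[of s0 y] r by simp
      then show ?thesis by linarith
    qed
    have "\<bar>s n y\<bar> \<le> w y" for n y
    proof (cases "\<bar>X n\<bar> < r")
      case True

      have "norm (f (s0 + X n) y - f s0 y) \<le> w y * norm (s0 + X n - s0)"
      proof (rule field_differentiable_bound[where S="ball s0 r" and f'="\<lambda>s. f' s y"])
        fix z assume z: "z \<in> ball s0 r"
        then have z': "\<bar>z - s0\<bar> < r" by (simp add: dist_real_def abs_minus_commute)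
        then show "((\<lambda>s. f s y) has_field_derivative f' z y) (at z within ball s0 r)"
          by (intro has_field_derivative_at_within[OF d])
        show "norm (f' z y) \<le> w y" using b[OF z'] by simp
      qed (use True r in \<open>auto simp: dist_real_def\<close>)
      moreover have "X n \<noteq> 0" using X(1)[rule_format, of n] by simp
      ultimately show ?thesis using True by (simp add: s_def abs_divide pos_divide_le_eq)
    next
      case False
      then show ?thesis using w0[of y] by (simp add: s_def)
    qed
    then show "AE y in M. norm (s n y) \<le> w y" for n by simp
  qed (use w m in auto)
  show "((\<lambda>h. (integral\<^sup>L M (f (s0 + h)) - integral\<^sup>L M (f s0)) / h) \<circ> X) \<longlonglongrightarrow> integral\<^sup>L M (f' s0)"
    unfolding comp_def
  proof (rule Lim_transform_eventually[OF lim])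
    show "\<forall>\<^sub>F n in sequentially. integral\<^sup>L M (s n) = (integral\<^sup>L M (f (s0 + X n)) - integral\<^sup>L M (f s0)) / X n"
      using ev
    proof eventually_elim
      case (elim n)
      then have "s n = (\<lambda>y. (f (s0 + X n) y - f s0 y) / X n)" by (simp add: s_def fun_eq_iff)
      then show ?case using i[of "s0 + X n"] i[of s0] elim r by (simp add: Bochner_Integration.integral_diff)
    qed
  qed
qed

definition heat_kernel_x :: "real \<Rightarrow> real \<Rightarrow> real" where
  "heat_kernel_x t z = - z / (2 * t) * heat_kernel t z"

definition heat_kernel_xx :: "real \<Rightarrow> real \<Rightarrow> real" where
  "heat_kernel_xx t z = (z\<^sup>2 / (4 * t\<^sup>2) - 1 / (2 * t)) * heat_kernel t z"

lemma heat_kernel_measurable [measurable]: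
  "heat_kernel t \<in> borel_measurable borel" "heat_kernel_x t \<in> borel_measurable borel" "heat_kernel_xx t \<in> borel_measurable borel"
  unfolding heat_kernel_def[abs_def] heat_kernel_x_def[abs_def] heat_kernel_xx_def[abs_def] by measurable

lemma heat_kernel_deriv_x:
  assumes t: "t > 0"
  shows "(heat_kernel t has_real_derivative heat_kernel_x t z) (at z)"
proof -
  have "((\<lambda>z. - z\<^sup>2 / (4 * t)) has_real_derivative - z / (2 * t)) (at z)"
    using t by (auto intro!: derivative_eq_intros simp: field_simps)
  then have "((\<lambda>z. 1 / sqrt (4 * pi * t) * exp (- z\<^sup>2 / (4 * t))) has_real_derivative
      1 / sqrt (4 * pi * t) * (exp (- z\<^sup>2 / (4 * t)) * (- z / (2 * t)))) (at z)"
    by (intro DERIV_cmult DERIV_chain2[OF DERIV_exp])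
  then show ?thesis unfolding heat_kernel_def[abs_def] heat_kernel_x_def by (simp add: mult_ac)
qed

lemma heat_kernel_deriv_xx:
  assumes t: "t > 0"
  shows "(heat_kernel_x t has_real_derivative heat_kernel_xx t z) (at z)"
proof -
  have "((\<lambda>z. - z / (2 * t)) has_real_derivative - 1 / (2 * t)) (at z)"
    using t by (auto intro!: derivative_eq_intros)
  from DERIV_mult'[OF this heat_kernel_deriv_x[OF t, of z]]
  have "(heat_kernel_x t has_real_derivative - z / (2 * t) * heat_kernel_x t z + - 1 / (2 * t) * heat_kernel t z) (at z)"
    unfolding heat_kernel_x_def[abs_def] by simp
  moreover have "- z / (2 * t) * heat_kernel_x t z + - 1 / (2 * t) * heat_kernel t z = heat_kernel_xx t z"
    unfolding heat_kernel_x_def heat_kernel_xx_def by (simp add: power2_eq_square algebra_simps)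
  ultimately show ?thesis by simp
qed

lemma heat_kernel_deriv_t:
  assumes t: "t > 0"
  shows "((\<lambda>t. heat_kernel t z) has_real_derivative heat_kernel_xx t z) (at t)"
proof -
  define S where "S = sqrt (4 * pi * t)"
  have S: "S > 0" "S * S = 4 * pi * t" unfolding S_def using t by auto
  have l: "((\<lambda>t. 4 * pi * t) has_real_derivative 4 * pi) (at t)" by (auto intro!: derivative_eq_intros)
  have "((\<lambda>t. sqrt (4 * pi * t)) has_real_derivative inverse (sqrt (4 * pi * t)) / 2 * (4 * pi)) (at t)"
    by (rule DERIV_chain2[OF DERIV_real_sqrt l]) (use t in simp)
  moreover have "inverse S / 2 * (4 * pi) = 2 * pi / S" using S(1) by (simp add: field_simps)
  ultimately have "((\<lambda>t. sqrt (4 * pi * t)) has_real_derivative 2 * pi / S) (at t)" unfolding S_def by simp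
  from DERIV_inverse_fun[OF this] S(1)[unfolded S_def, THEN less_imp_neq, symmetric]
  have "((\<lambda>t. inverse (sqrt (4 * pi * t))) has_real_derivative - (2 * pi / S * inverse (S ^ Suc (Suc 0)))) (at t)"
    unfolding S_def .
  moreover have "2 * pi / S * inverse (S ^ Suc (Suc 0)) = 1 / (2 * t) * inverse S"
  proof -
    have "2 * pi / S * inverse (S ^ Suc (Suc 0)) = 2 * pi / (S * S) * inverse S" using S(1) by (simp add: field_simps)
    then show ?thesis unfolding S(2) using t by simp
  qed
  ultimately have a: "((\<lambda>t. inverse (sqrt (4 * pi * t))) has_real_derivative - (1 / (2 * t) * inverse S)) (at t)" by simp
  have "((\<lambda>t. (- z\<^sup>2 / 4) * inverse t) has_real_derivative (- z\<^sup>2 / 4) * - (inverse t ^ Suc (Suc 0))) (at t)"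
    using t by (intro DERIV_cmult DERIV_inverse) simp
  moreover have "(\<lambda>t. (- z\<^sup>2 / 4) * inverse t) = (\<lambda>t. - z\<^sup>2 / (4 * t))" by (simp add: fun_eq_iff inverse_eq_divide)
  moreover have "(- z\<^sup>2 / 4) * - (inverse t ^ Suc (Suc 0)) = z\<^sup>2 / (4 * t\<^sup>2)"
    using t by (simp add: power2_eq_square field_simps)
  ultimately have "((\<lambda>t. - z\<^sup>2 / (4 * t)) has_real_derivative z\<^sup>2 / (4 * t\<^sup>2)) (at t)" by (simp only:)
  then have b: "((\<lambda>t. exp (- z\<^sup>2 / (4 * t))) has_real_derivative exp (- z\<^sup>2 / (4 * t)) * (z\<^sup>2 / (4 * t\<^sup>2))) (at t)"
    by (rule DERIV_chain2[OF DERIV_exp])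
  have "((\<lambda>t. inverse (sqrt (4 * pi * t)) * exp (- z\<^sup>2 / (4 * t))) has_real_derivative
      inverse S * (exp (- z\<^sup>2 / (4 * t)) * (z\<^sup>2 / (4 * t\<^sup>2))) + - (1 / (2 * t) * inverse S) * exp (- z\<^sup>2 / (4 * t))) (at t)"
    using DERIV_mult'[OF a b] unfolding S_def .
  moreover have "inverse S * (exp (- z\<^sup>2 / (4 * t)) * (z\<^sup>2 / (4 * t\<^sup>2))) + - (1 / (2 * t) * inverse S) * exp (- z\<^sup>2 / (4 * t)) = heat_kernel_xx t z"
  proof -
    have "i * (E * A) + - (B * i) * E = (A - B) * (i * E)" for i E A B :: real by (simp add: algebra_simps)
    then show ?thesis unfolding heat_kernel_xx_def heat_kernel_def S_def[symmetric] inverse_eq_divide .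
  qed
  ultimately show ?thesis unfolding heat_kernel_def inverse_eq_divide by (simp only:)
qed

lemma heat_kernel_nonneg: "t > 0 \<Longrightarrow> 0 \<le> heat_kernel t z"
  unfolding heat_kernel_def by simp

text \<open>The factor 1 + z^2 covers the polynomial coefficients of the kernel derivatives. Decay
  at rate 2 leaves rate 1 after multiplication with p, whose linear growth is absorbed by exp
  \<bar>y\<bar>.\<close>

lemma heat_kernel_decay:
  assumes ab: "0 < a" "a \<le> b"
  obtains C where "C \<ge> 0" "\<And>t z. a \<le> t \<Longrightarrow> t \<le> b \<Longrightarrow> (1 + z\<^sup>2) * heat_kernel t z \<le> C * exp (- 2 * \<bar>z\<bar>)"
proof -
  define c where "c = 1 / sqrt (4 * pi * a)"
  have c: "c > 0" unfolding c_def using ab by simp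
  have "(1 + z\<^sup>2) * heat_kernel t z \<le> c * (2 * exp (9 * b)) * exp (- 2 * \<bar>z\<bar>)" if t: "a \<le> t" "t \<le> b" for t z
  proof -
    have t0: "t > 0" using ab t by simp
    have "1 / sqrt (4 * pi * t) \<le> c" unfolding c_def using ab t by (intro divide_left_mono) auto
    moreover have "exp (- z\<^sup>2 / (4 * t)) \<le> exp (- z\<^sup>2 / (4 * b))"
      using t t0 ab by (auto simp: field_simps mult_right_mono)
    ultimately have k: "heat_kernel t z \<le> c * exp (- z\<^sup>2 / (4 * b))"
      unfolding heat_kernel_def using c by (intro mult_mono) auto
    have "1 + \<bar>z\<bar> + \<bar>z\<bar>\<^sup>2 / 2 \<le> exp \<bar>z\<bar>" by (rule exp_lower_Taylor_quadratic) simp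
    then have p: "1 + z\<^sup>2 \<le> 2 * exp \<bar>z\<bar>" by simp
    \<comment> \<open>Completing the square gives - z^2 / (4 b) \<le> 9 b - 3 \<bar>z\<bar>; one of
      the three units of decay pays for 1 + z^2 \<le> 2 exp \<bar>z\<bar>.\<close>
    have "0 \<le> (\<bar>z\<bar> - 6 * b)\<^sup>2 / (4 * b)" using ab by simp
    also have "\<dots> = z\<^sup>2 / (4 * b) - 3 * \<bar>z\<bar> + 9 * b" using ab by (simp add: power2_diff field_simps power2_eq_square)
    finally have "\<bar>z\<bar> + - z\<^sup>2 / (4 * b) \<le> 9 * b + - 2 * \<bar>z\<bar>" by simp
    then have e: "exp \<bar>z\<bar> * exp (- z\<^sup>2 / (4 * b)) \<le> exp (9 * b) * exp (- 2 * \<bar>z\<bar>)"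
      unfolding exp_add[symmetric] by simp
    have "(1 + z\<^sup>2) * heat_kernel t z \<le> (2 * exp \<bar>z\<bar>) * (c * exp (- z\<^sup>2 / (4 * b)))"
      using p k heat_kernel_nonneg[OF t0] by (intro mult_mono) auto
    also have "\<dots> = 2 * c * (exp \<bar>z\<bar> * exp (- z\<^sup>2 / (4 * b)))" by simp
    also have "\<dots> \<le> 2 * c * (exp (9 * b) * exp (- 2 * \<bar>z\<bar>))" using e c by (intro mult_left_mono) auto
    finally show ?thesis by (simp add: mult_ac)
  qed
  then show ?thesis using c by (intro that[of "c * (2 * exp (9 * b))"]) auto
qed

lemma exp_abs_integrable: "integrable lborel (\<lambda>y::real. C * exp (- \<bar>y\<bar>))"
proof -
  have "integrable lborel (\<lambda>y. (2 * C) * g_ker 1 (0 - y))" using g_ker_integrable[of 1 0] by simp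
  then show ?thesis by (simp add: g_ker_def)
qed

section \<open>Gaussian averages\<close>

text \<open>One majorant for all Gaussian averages below: 1 + z^2 dominates the factor z^2 - 1 of
  the second derivative, 1 + \<bar>z\<bar> the linear growth of p.\<close>

definition gauss_weight :: "real \<Rightarrow> real" where
  "gauss_weight z = std_normal_density z * ((1 + z\<^sup>2) * (1 + \<bar>z\<bar>))"

lemma gauss_weight_integrable: "integrable lborel gauss_weight"
proof -
  have a: "integrable lborel (\<lambda>z. std_normal_density z * z ^ (2 * k))" for k
    using std_normal_moment_even[of k] by (simp add: has_bochner_integral_iff)
  have b: "integrable lborel (\<lambda>z. std_normal_density z * \<bar>z\<bar> ^ (2 * k + 1))" for k
    using std_normal_moment_abs_odd[of k] by (simp add: has_bochner_integral_iff)
  have eq: "gauss_weight = (\<lambda>z. (std_normal_density z * z ^ (2 * 0) + std_normal_density z * z ^ (2 * 1))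
      + (std_normal_density z * \<bar>z\<bar> ^ (2 * 0 + 1) + std_normal_density z * \<bar>z\<bar> ^ (2 * 1 + 1)))"
    by (rule ext) (simp add: gauss_weight_def algebra_simps power2_eq_square power3_eq_cube abs_mult_self_eq numeral_eq_Suc)
  show ?thesis unfolding eq by (intro Bochner_Integration.integrable_add a b)
qed

abbreviation "gauss_mass \<equiv> LINT z|lborel. gauss_weight z"

lemma gauss_mass_nonneg: "gauss_mass \<ge> 0"
  by (rule Bochner_Integration.integral_nonneg) (simp add: gauss_weight_def)

lemma gauss_integrable:
  assumes [measurable]: "k \<in> borel_measurable borel" and k: "\<And>z. \<bar>k z\<bar> \<le> C * ((1 + z\<^sup>2) * (1 + \<bar>z\<bar>))"
  shows "integrable lborel (\<lambda>z. std_normal_density z * k z)"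
    "\<bar>LINT z|lborel. std_normal_density z * k z\<bar> \<le> C * (LINT z|lborel. gauss_weight z)"
proof -
  have C: "C \<ge> 0" using k[of 0] by simp
  have le: "\<bar>std_normal_density z * k z\<bar> \<le> C * gauss_weight z" for z
    using mult_left_mono[OF k[of z] normal_density_nonneg[of 0 1 z]] unfolding gauss_weight_def
    by (simp add: abs_mult mult_ac)
  have iW: "integrable lborel (\<lambda>z. C * gauss_weight z)" using gauss_weight_integrable by simp
  show i: "integrable lborel (\<lambda>z. std_normal_density z * k z)"
  proof (rule Bochner_Integration.integrable_bound[OF iW])
    show "AE z in lborel. norm (std_normal_density z * k z) \<le> norm (C * gauss_weight z)"
    proof (rule AE_I2)
      fix z show "norm (std_normal_density z * k z) \<le> norm (C * gauss_weight z)"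
        using le[of z] unfolding real_norm_def by linarith
    qed
  qed measurable
  have "\<bar>LINT z|lborel. std_normal_density z * k z\<bar> \<le> (LINT z|lborel. \<bar>std_normal_density z * k z\<bar>)"
    by (rule integral_abs_bound)
  also have "\<dots> \<le> (LINT z|lborel. C * gauss_weight z)" by (rule integral_mono) (use i iW le in auto)
  finally show "\<bar>LINT z|lborel. std_normal_density z * k z\<bar> \<le> C * (LINT z|lborel. gauss_weight z)" by simp
qed

lemma gauss_moments:
  "(LINT z|lborel. std_normal_density z * c) = c"
  "(LINT z|lborel. std_normal_density z * (z\<^sup>2 - 1)) = 0"
proof -
  have 0: "has_bochner_integral lborel std_normal_density 1" using std_normal_moment_even[of 0] by simp
  have 2: "has_bochner_integral lborel (\<lambda>z. std_normal_density z * z\<^sup>2) 1" using std_normal_moment_even[of 1] by simp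
  show "(LINT z|lborel. std_normal_density z * c) = c" using 0 by (simp add: has_bochner_integral_iff)
  have "has_bochner_integral lborel (\<lambda>z. std_normal_density z * z\<^sup>2 - std_normal_density z) (1 - 1)"
    by (intro has_bochner_integral_diff 0 2)
  then show "(LINT z|lborel. std_normal_density z * (z\<^sup>2 - 1)) = 0"
    by (simp add: has_bochner_integral_iff right_diff_distrib)
qed

lemma sqrt_diff_le:
  assumes "0 \<le> s" "0 \<le> t" shows "\<bar>sqrt t - sqrt s\<bar> \<le> sqrt \<bar>t - s\<bar>"
proof -
  have "sqrt y - sqrt x \<le> sqrt (y - x)" if "0 \<le> x" "x \<le> y" for x y
  proof -
    have "sqrt y = sqrt (x + (y - x))" by simp
    also have "\<dots> \<le> sqrt x + sqrt (y - x)" by (rule sqrt_add_le_add_sqrt) (use that in auto)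
    finally show ?thesis by simp
  qed
  from this[of s t] this[of t s] show ?thesis using assms by (cases "s \<le> t") (auto simp: abs_minus_commute)
qed

section \<open>The heat flow of Lipschitz initial data\<close>

context
  fixes p :: "real \<Rightarrow> real" and M :: real
  assumes lip: "\<And>x y. \<bar>p x - p y\<bar> \<le> M * \<bar>x - y\<bar>" and M: "M \<ge> 0"
begin

lemma lip_measurable [measurable]: "p \<in> borel_measurable borel"
proof (rule borel_measurable_continuous_onI, rule continuous_at_imp_continuous_on, intro ballI)
  fix x
  have "((\<lambda>y. p y - p x) \<longlongrightarrow> 0) (at x)"
  proof (rule Lim_null_comparison)
    show "\<forall>\<^sub>F y in at x. norm (p y - p x) \<le> M * \<bar>y - x\<bar>" using lip by simp
    have "((\<lambda>y. M * \<bar>y - x\<bar>) \<longlongrightarrow> M * \<bar>x - x\<bar>) (at x)" by (intro tendsto_intros)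
    then show "((\<lambda>y. M * \<bar>y - x\<bar>) \<longlongrightarrow> 0) (at x)" by simp
  qed
  then show "isCont p x" unfolding isCont_def by (rule LIM_zero_cancel)
qed

lemma lip_tame: "tame p"
proof (rule tame_linear_growth[where A="\<bar>p 0\<bar>" and B=M])
  show "\<bar>p x\<bar> \<le> \<bar>p 0\<bar> + M * \<bar>x\<bar>" for x using lip[of x 0] by simp
qed (use M in auto)

text \<open>With y = x - sqrt (2 t) z the density is fixed and t enters only through the argument of
  p. Lipschitz continuity of p then gives Hoelder continuity of order 1/2 in time, including t =
  0.\<close>

lemma heat_flow_gauss:
  assumes t: "t \<ge> 0"
  shows "heat_flow p t x = (LINT z|lborel. std_normal_density z * p (x - sqrt (2 * t) * z))"
proof (cases "t = 0")
  case True
  then show ?thesis unfolding heat_flow_def by (simp add: gauss_moments(1))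
next
  case False
  then have t: "t > 0" using t by simp
  define \<sigma> where "\<sigma> = sqrt (2 * t)"
  have \<sigma>: "\<sigma> > 0" "\<sigma>\<^sup>2 = 2 * t" unfolding \<sigma>_def using t by auto
  have "heat_flow p t x = (LINT y|lborel. heat_kernel t (x - y) * p y)" unfolding heat_flow_def conv_def using t by simp
  also have "\<dots> = (LINT z|lborel. \<sigma> * (heat_kernel t (\<sigma> * z) * p (x - \<sigma> * z)))"
    using lborel_integral_real_affine[of "- \<sigma>" "\<lambda>y. heat_kernel t (x - y) * p y" x] \<sigma> by simp
  also have "\<dots> = (LINT z|lborel. std_normal_density z * p (x - \<sigma> * z))"
  proof (rule Bochner_Integration.integral_cong[OF refl])
    fix z
    have "\<sigma> * heat_kernel t (\<sigma> * z) = std_normal_density z"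
    proof -
      have "sqrt (4 * pi * t) = sqrt ((2 * pi) * (2 * t))" by (simp add: mult_ac)
      also have "\<dots> = sqrt (2 * pi) * \<sigma>" unfolding \<sigma>_def by (rule real_sqrt_mult)
      finally show ?thesis
        unfolding heat_kernel_def std_normal_density_def power_mult_distrib \<sigma>(2) using \<sigma>(1) t by simp
    qed
    then show "\<sigma> * (heat_kernel t (\<sigma> * z) * p (x - \<sigma> * z)) = std_normal_density z * p (x - \<sigma> * z)"
      by (simp flip: mult.assoc)
  qed
  finally show ?thesis unfolding \<sigma>_def .
qed

definition heat_xx :: "real \<Rightarrow> real \<Rightarrow> real" where
  "heat_xx t x = (LINT y|lborel. heat_kernel_xx t (x - y) * p y)"

lemma gauss_p_bound:
  "\<bar>p (x - a * z)\<bar> \<le> (\<bar>p x\<bar> + M * \<bar>a\<bar>) * ((1 + z\<^sup>2) * (1 + \<bar>z\<bar>))"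
  "\<bar>(z\<^sup>2 - 1) * (p (x - a * z) - p (x - b * z))\<bar> \<le> (M * \<bar>a - b\<bar>) * ((1 + z\<^sup>2) * (1 + \<bar>z\<bar>))"
  "\<bar>p (x - a * z) - p (x - b * z)\<bar> \<le> (M * \<bar>a - b\<bar>) * ((1 + z\<^sup>2) * (1 + \<bar>z\<bar>))"
proof -
  have one: "1 \<le> (1 + z\<^sup>2) * (1 + \<bar>z\<bar>)" and ab: "\<bar>z\<bar> \<le> (1 + z\<^sup>2) * (1 + \<bar>z\<bar>)"
    by (simp_all add: distrib_left distrib_right)
  have z1: "\<bar>z\<^sup>2 - 1\<bar> \<le> 1 + z\<^sup>2" by (simp add: abs_le_iff)
  have d: "\<bar>p (x - a * z) - p (x - b * z)\<bar> \<le> M * \<bar>a - b\<bar> * \<bar>z\<bar>"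
  proof -
    have "x - a * z - (x - b * z) = (b - a) * z" by (simp add: algebra_simps)
    then show ?thesis using lip[of "x - a * z" "x - b * z"] by (simp add: abs_mult abs_minus_commute mult.assoc)
  qed
  have "\<bar>(z\<^sup>2 - 1) * (p (x - a * z) - p (x - b * z))\<bar> \<le> (1 + z\<^sup>2) * (M * \<bar>a - b\<bar> * \<bar>z\<bar>)"
    unfolding abs_mult[of "z\<^sup>2 - 1"] using z1 d by (intro mult_mono) auto
  also have "\<dots> = (M * \<bar>a - b\<bar>) * ((1 + z\<^sup>2) * \<bar>z\<bar>)" by simp
  also have "\<dots> \<le> (M * \<bar>a - b\<bar>) * ((1 + z\<^sup>2) * (1 + \<bar>z\<bar>))" using M by (intro mult_left_mono) auto
  finally show "\<bar>(z\<^sup>2 - 1) * (p (x - a * z) - p (x - b * z))\<bar> \<le> (M * \<bar>a - b\<bar>) * ((1 + z\<^sup>2) * (1 + \<bar>z\<bar>))" .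
  have "M * \<bar>a - b\<bar> * \<bar>z\<bar> \<le> (M * \<bar>a - b\<bar>) * ((1 + z\<^sup>2) * (1 + \<bar>z\<bar>))" using M ab by (intro mult_left_mono) auto
  then show "\<bar>p (x - a * z) - p (x - b * z)\<bar> \<le> (M * \<bar>a - b\<bar>) * ((1 + z\<^sup>2) * (1 + \<bar>z\<bar>))" using d by linarith
  have "\<bar>p (x - a * z)\<bar> \<le> \<bar>p x\<bar> + M * \<bar>a\<bar> * \<bar>z\<bar>" using lip[of "x - a * z" x] by (simp add: abs_mult mult.assoc)
  also have "\<dots> \<le> \<bar>p x\<bar> * ((1 + z\<^sup>2) * (1 + \<bar>z\<bar>)) + M * \<bar>a\<bar> * ((1 + z\<^sup>2) * (1 + \<bar>z\<bar>))"
    using one ab M by (intro add_mono mult_left_mono) (auto simp: mult_le_cancel_left1)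
  finally show "\<bar>p (x - a * z)\<bar> \<le> (\<bar>p x\<bar> + M * \<bar>a\<bar>) * ((1 + z\<^sup>2) * (1 + \<bar>z\<bar>))" by (simp add: distrib_right)
qed

text \<open>The weight z^2 - 1 has mean zero, so p x may be subtracted. The Lipschitz bound then
  supplies a factor sqrt (2 t), which softens the singularity 1/t to 1/sqrt t.\<close>

lemma heat_xx_gauss:
  assumes t: "t > 0"
  shows "heat_xx t x = 1 / (2 * t) * (LINT z|lborel. std_normal_density z * ((z\<^sup>2 - 1) * (p (x - sqrt (2 * t) * z) - p x)))"
proof -
  define \<sigma> where "\<sigma> = sqrt (2 * t)"
  have \<sigma>: "\<sigma> > 0" "\<sigma>\<^sup>2 = 2 * t" unfolding \<sigma>_def using t by auto
  have "heat_xx t x = (LINT z|lborel. \<sigma> * (heat_kernel_xx t (\<sigma> * z) * p (x - \<sigma> * z)))"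
    unfolding heat_xx_def
    using lborel_integral_real_affine[of "- \<sigma>" "\<lambda>y. heat_kernel_xx t (x - y) * p y" x] \<sigma> by simp
  also have "\<dots> = (LINT z|lborel. 1 / (2 * t) * (std_normal_density z * ((z\<^sup>2 - 1) * (p (x - \<sigma> * z) - p x)) + p x * (std_normal_density z * (z\<^sup>2 - 1))))"
  proof (rule Bochner_Integration.integral_cong[OF refl])
    fix z
    have N: "\<sigma> * heat_kernel t (\<sigma> * z) = std_normal_density z"
    proof -
      have "sqrt (4 * pi * t) = sqrt ((2 * pi) * (2 * t))" by (simp add: mult_ac)
      also have "\<dots> = sqrt (2 * pi) * \<sigma>" unfolding \<sigma>_def by (rule real_sqrt_mult)
      finally show ?thesis
        unfolding heat_kernel_def std_normal_density_def power_mult_distrib \<sigma>(2) using \<sigma>(1) t by simp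
    qed
    have "(\<sigma> * z)\<^sup>2 / (4 * t\<^sup>2) - 1 / (2 * t) = 1 / (2 * t) * (z\<^sup>2 - 1)"
      unfolding power_mult_distrib \<sigma>(2) using t by (simp add: power2_eq_square field_simps)
    then have "\<sigma> * (heat_kernel_xx t (\<sigma> * z) * p (x - \<sigma> * z)) = 1 / (2 * t) * (z\<^sup>2 - 1) * (\<sigma> * heat_kernel t (\<sigma> * z)) * p (x - \<sigma> * z)"
      unfolding heat_kernel_xx_def by (simp add: mult_ac)
    then show "\<sigma> * (heat_kernel_xx t (\<sigma> * z) * p (x - \<sigma> * z)) =
       1 / (2 * t) * (std_normal_density z * ((z\<^sup>2 - 1) * (p (x - \<sigma> * z) - p x)) + p x * (std_normal_density z * (z\<^sup>2 - 1)))"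
      unfolding N by (simp add: algebra_simps diff_divide_distrib)
  qed
  also have "\<dots> = 1 / (2 * t) * ((LINT z|lborel. std_normal_density z * ((z\<^sup>2 - 1) * (p (x - \<sigma> * z) - p x))) + p x * (LINT z|lborel. std_normal_density z * (z\<^sup>2 - 1)))"
  proof -
    have i1: "integrable lborel (\<lambda>z. std_normal_density z * ((z\<^sup>2 - 1) * (p (x - \<sigma> * z) - p x)))"
      by (rule gauss_integrable(1)[where C="M * \<bar>\<sigma> - 0\<bar>"]) (use gauss_p_bound(2)[of _ x \<sigma> 0] in auto)
    have i2: "integrable lborel (\<lambda>z. p x * (std_normal_density z * (z\<^sup>2 - 1)))"
    proof (rule integrable_mult_right, rule gauss_integrable(1)[where C=1])
      show "\<bar>z\<^sup>2 - 1\<bar> \<le> 1 * ((1 + z\<^sup>2) * (1 + \<bar>z\<bar>))" for z :: real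
        by (simp add: abs_le_iff distrib_left distrib_right)
    qed measurable
    show ?thesis using Bochner_Integration.integral_add[OF i1 i2] by simp
  qed
  finally show ?thesis unfolding gauss_moments(2) \<sigma>_def by simp
qed

lemma heat_flow_dist:
  assumes "s \<ge> 0" "t \<ge> 0"
  shows "\<bar>heat_flow p t x - heat_flow p s y\<bar> \<le> M * gauss_mass * sqrt (2 * \<bar>t - s\<bar>) + M * \<bar>x - y\<bar>"
proof -
  have i: "integrable lborel (\<lambda>z. std_normal_density z * p (x - a * z))" for a x
    by (rule gauss_integrable(1)[OF _ gauss_p_bound(1)]) measurable
  have "heat_flow p t x - heat_flow p s x = (LINT z|lborel. std_normal_density z * (p (x - sqrt (2 * t) * z) - p (x - sqrt (2 * s) * z)))"
    unfolding heat_flow_gauss[OF assms(1)] heat_flow_gauss[OF assms(2)] right_diff_distrib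
    by (rule Bochner_Integration.integral_diff[symmetric]) (rule i)+
  also have "\<bar>\<dots>\<bar> \<le> M * \<bar>sqrt (2 * t) - sqrt (2 * s)\<bar> * gauss_mass"
    by (rule gauss_integrable(2)[OF _ gauss_p_bound(3)]) measurable
  also have "\<dots> \<le> M * sqrt (2 * \<bar>t - s\<bar>) * gauss_mass"
  proof (intro mult_right_mono mult_left_mono gauss_mass_nonneg M)
    have "\<bar>2 * t - 2 * s\<bar> = 2 * \<bar>t - s\<bar>" by (auto simp: abs_if)
    then show "\<bar>sqrt (2 * t) - sqrt (2 * s)\<bar> \<le> sqrt (2 * \<bar>t - s\<bar>)"
      using sqrt_diff_le[of "2 * s" "2 * t"] assms by simp
  qed
  finally have 1: "\<bar>heat_flow p t x - heat_flow p s x\<bar> \<le> M * gauss_mass * sqrt (2 * \<bar>t - s\<bar>)" by (simp add: mult_ac)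
  have eq: "heat_flow p s x - heat_flow p s y = (LINT z|lborel. std_normal_density z * (p (x - sqrt (2 * s) * z) - p (y - sqrt (2 * s) * z)))"
    unfolding heat_flow_gauss[OF assms(1)] right_diff_distrib
    by (rule Bochner_Integration.integral_diff[symmetric]) (rule i)+
  have "\<bar>heat_flow p s x - heat_flow p s y\<bar> \<le> (LINT z|lborel. \<bar>std_normal_density z * (p (x - sqrt (2 * s) * z) - p (y - sqrt (2 * s) * z))\<bar>)"
    unfolding eq by (rule integral_abs_bound)
  also have "\<dots> \<le> (LINT z|lborel. std_normal_density z * (M * \<bar>x - y\<bar>))"
  proof (rule integral_mono)
    show "integrable lborel (\<lambda>z. \<bar>std_normal_density z * (p (x - sqrt (2 * s) * z) - p (y - sqrt (2 * s) * z))\<bar>)"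
      unfolding right_diff_distrib by (intro integrable_abs Bochner_Integration.integrable_diff i)
    show "integrable lborel (\<lambda>z. std_normal_density z * (M * \<bar>x - y\<bar>))"
      using std_normal_moment_even[of 0] by (simp add: has_bochner_integral_iff)
    show "\<bar>std_normal_density z * (p (x - sqrt (2 * s) * z) - p (y - sqrt (2 * s) * z))\<bar> \<le> std_normal_density z * (M * \<bar>x - y\<bar>)" for z
      using lip[of "x - sqrt (2 * s) * z" "y - sqrt (2 * s) * z"] by (simp add: abs_mult mult_left_mono)
  qed
  also have "\<dots> = M * \<bar>x - y\<bar>" by (rule gauss_moments(1))
  finally show ?thesis using 1 by linarith
qed

lemma heat_xx_bound:
  assumes "t > 0" shows "\<bar>heat_xx t x\<bar> \<le> 1 / (2 * t) * (M * sqrt (2 * t) * gauss_mass)"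
proof -
  have "\<bar>LINT z|lborel. std_normal_density z * ((z\<^sup>2 - 1) * (p (x - sqrt (2 * t) * z) - p x))\<bar> \<le> M * \<bar>sqrt (2 * t) - 0\<bar> * gauss_mass"
    by (rule gauss_integrable(2)) (use gauss_p_bound(2)[of _ x "sqrt (2 * t)" 0] in auto)
  then have "1 / (2 * t) * \<bar>LINT z|lborel. std_normal_density z * ((z\<^sup>2 - 1) * (p (x - sqrt (2 * t) * z) - p x))\<bar>
      \<le> 1 / (2 * t) * (M * sqrt (2 * t) * gauss_mass)"
    using assms by (intro mult_left_mono) auto
  then show ?thesis unfolding heat_xx_gauss[OF assms] abs_mult using assms by simp
qed

text \<open>The prefactor 1/(2 t) and the Gaussian average \<open>J\<close> are varied one after the
  other, at times at least \<delta>. The negative powers of \<delta> keep the Euler comparison away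
  from t = 0.\<close>

lemma heat_xx_time:
  assumes \<delta>: "\<delta> > 0" and st: "\<delta> \<le> s" "\<delta> \<le> t" "s \<le> B" "t \<le> B"
  shows "\<bar>heat_xx t x - heat_xx s x\<bar> \<le> M * gauss_mass * (\<bar>t - s\<bar> * sqrt (2 * B) / (2 * \<delta>\<^sup>2) + sqrt (2 * \<bar>t - s\<bar>) / (2 * \<delta>))"
proof -
  have pos: "t > 0" "s > 0" using \<delta> st by auto
  define J where "J a = (LINT z|lborel. std_normal_density z * ((z\<^sup>2 - 1) * (p (x - a * z) - p x)))" for a
  have i: "integrable lborel (\<lambda>z. std_normal_density z * ((z\<^sup>2 - 1) * (p (x - a * z) - p x)))" for a
    by (rule gauss_integrable(1)[where C="M * \<bar>a - 0\<bar>"]) (use gauss_p_bound(2)[of _ x a 0] in auto)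
  have J: "\<bar>J a\<bar> \<le> M * \<bar>a\<bar> * gauss_mass" for a
    unfolding J_def by (rule gauss_integrable(2)) (use gauss_p_bound(2)[of _ x a 0] in auto)
  have Jd: "\<bar>J a - J b\<bar> \<le> M * \<bar>a - b\<bar> * gauss_mass" for a b
  proof -
    have "J a - J b = (LINT z|lborel. std_normal_density z * ((z\<^sup>2 - 1) * (p (x - a * z) - p (x - b * z))))"
      unfolding J_def by (subst Bochner_Integration.integral_diff[OF i i, symmetric]) (simp add: algebra_simps)
    also have "\<bar>\<dots>\<bar> \<le> M * \<bar>a - b\<bar> * gauss_mass" by (rule gauss_integrable(2)[OF _ gauss_p_bound(2)]) measurable
    finally show ?thesis .
  qed
  have "heat_xx t x - heat_xx s x = (1 / (2 * t) - 1 / (2 * s)) * J (sqrt (2 * t)) + 1 / (2 * s) * (J (sqrt (2 * t)) - J (sqrt (2 * s)))"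
    unfolding heat_xx_gauss[OF pos(1)] heat_xx_gauss[OF pos(2)] J_def[symmetric] by (simp add: algebra_simps)
  also have "\<bar>\<dots>\<bar> \<le> \<bar>1 / (2 * t) - 1 / (2 * s)\<bar> * \<bar>J (sqrt (2 * t))\<bar> + \<bar>1 / (2 * s)\<bar> * \<bar>J (sqrt (2 * t)) - J (sqrt (2 * s))\<bar>"
    unfolding abs_mult[symmetric] by (rule abs_triangle_ineq)
  also have "\<dots> \<le> (\<bar>t - s\<bar> / (2 * \<delta>\<^sup>2)) * (M * sqrt (2 * B) * gauss_mass) + (1 / (2 * \<delta>)) * (M * sqrt (2 * \<bar>t - s\<bar>) * gauss_mass)"
  proof (intro add_mono mult_mono)
    have "1 / (2 * t) - 1 / (2 * s) = (s - t) / (2 * (t * s))" using pos by (simp add: field_simps)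
    then have "\<bar>1 / (2 * t) - 1 / (2 * s)\<bar> = \<bar>t - s\<bar> / (2 * (t * s))" using pos by (simp add: abs_divide abs_minus_commute)
    also have "\<dots> \<le> \<bar>t - s\<bar> / (2 * \<delta>\<^sup>2)"
      using pos \<delta> st unfolding power2_eq_square by (intro divide_left_mono mult_left_mono mult_mono) auto
    finally show "\<bar>1 / (2 * t) - 1 / (2 * s)\<bar> \<le> \<bar>t - s\<bar> / (2 * \<delta>\<^sup>2)" .
    have "M * \<bar>sqrt (2 * t)\<bar> * gauss_mass \<le> M * sqrt (2 * B) * gauss_mass"
      using st pos by (intro mult_right_mono mult_left_mono gauss_mass_nonneg M) auto
    then show "\<bar>J (sqrt (2 * t))\<bar> \<le> M * sqrt (2 * B) * gauss_mass" using J[of "sqrt (2 * t)"] by linarith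
    show "\<bar>1 / (2 * s)\<bar> \<le> 1 / (2 * \<delta>)" using pos st \<delta> by (simp add: field_simps)
    have "\<bar>2 * t - 2 * s\<bar> = 2 * \<bar>t - s\<bar>" by (auto simp: abs_if)
    then have "\<bar>sqrt (2 * t) - sqrt (2 * s)\<bar> \<le> sqrt (2 * \<bar>t - s\<bar>)"
      using sqrt_diff_le[of "2 * s" "2 * t"] pos by simp
    then have "M * \<bar>sqrt (2 * t) - sqrt (2 * s)\<bar> * gauss_mass \<le> M * sqrt (2 * \<bar>t - s\<bar>) * gauss_mass"
      by (intro mult_right_mono mult_left_mono gauss_mass_nonneg M)
    then show "\<bar>J (sqrt (2 * t)) - J (sqrt (2 * s))\<bar> \<le> M * sqrt (2 * \<bar>t - s\<bar>) * gauss_mass"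
      using Jd[of "sqrt (2 * t)" "sqrt (2 * s)"] by linarith
  qed (use \<delta> in auto)
  finally show ?thesis by (simp add: algebra_simps)
qed

lemma heat_dominated:
  assumes ab: "0 < a" "a \<le> b" and R: "R \<ge> 0"
  obtains C where "\<And>t x y. a \<le> t \<Longrightarrow> t \<le> b \<Longrightarrow> \<bar>x\<bar> \<le> R \<Longrightarrow> \<bar>heat_kernel t (x - y) * p y\<bar> \<le> C * exp (- \<bar>y\<bar>)"
    "\<And>t x y. a \<le> t \<Longrightarrow> t \<le> b \<Longrightarrow> \<bar>x\<bar> \<le> R \<Longrightarrow> \<bar>heat_kernel_x t (x - y) * p y\<bar> \<le> C * exp (- \<bar>y\<bar>)"
    "\<And>t x y. a \<le> t \<Longrightarrow> t \<le> b \<Longrightarrow> \<bar>x\<bar> \<le> R \<Longrightarrow> \<bar>heat_kernel_xx t (x - y) * p y\<bar> \<le> C * exp (- \<bar>y\<bar>)"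
proof -
  obtain C0 where C0: "C0 \<ge> 0" "\<And>t z. a \<le> t \<Longrightarrow> t \<le> b \<Longrightarrow> (1 + z\<^sup>2) * heat_kernel t z \<le> C0 * exp (- 2 * \<bar>z\<bar>)"
    using heat_kernel_decay[OF ab] by metis
  \<comment> \<open>c bounds the coefficients 1, z/(2 t) and z^2/(4 t^2) - 1/(2 t) relative to 1 +
    z^2 for all t \<ge> a, so that one majorant serves the kernel and its derivatives.\<close>
  define c where "c = 1 + 1 / (2 * a) + 1 / (4 * a\<^sup>2)"
  have c: "c \<ge> 1" unfolding c_def using ab by simp
  define C where "C = c * (C0 * exp (2 * R)) * (\<bar>p 0\<bar> + M)"
  have key: "c * ((1 + (x - y)\<^sup>2) * heat_kernel t (x - y)) * \<bar>p y\<bar> \<le> C * exp (- \<bar>y\<bar>)"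
    if t: "a \<le> t" "t \<le> b" and x: "\<bar>x\<bar> \<le> R" for t x y
  proof -
    have "\<bar>p y\<bar> \<le> \<bar>p 0\<bar> + M * \<bar>y\<bar>" using lip[of y 0] by simp
    also have "\<dots> \<le> (\<bar>p 0\<bar> + M) * exp \<bar>y\<bar>"
    proof -
      have "\<bar>y\<bar> \<le> exp \<bar>y\<bar>" using exp_ge_add_one_self[of "\<bar>y\<bar>"] by linarith
      then show ?thesis
        unfolding distrib_right using M by (intro add_mono mult_left_mono) (auto simp: mult_le_cancel_left1)
    qed
    finally have p: "\<bar>p y\<bar> \<le> (\<bar>p 0\<bar> + M) * exp \<bar>y\<bar>" .
    have "(1 + (x - y)\<^sup>2) * heat_kernel t (x - y) \<le> C0 * exp (- 2 * \<bar>x - y\<bar>)" by (rule C0(2)[OF t])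
    also have "\<dots> \<le> C0 * exp (2 * R + - 2 * \<bar>y\<bar>)"
    proof -
      have "\<bar>y\<bar> \<le> \<bar>x\<bar> + \<bar>x - y\<bar>" using abs_triangle_ineq4[of x "x - y"] by simp
      moreover have "- 2 * v \<le> 2 * R + - 2 * w" if "w \<le> u + v" "u \<le> R" for u v w :: real
        using that by linarith
      ultimately have "- 2 * \<bar>x - y\<bar> \<le> 2 * R + - 2 * \<bar>y\<bar>" using x by blast
      then show ?thesis using C0(1) by (intro mult_left_mono) auto
    qed
    finally have k: "(1 + (x - y)\<^sup>2) * heat_kernel t (x - y) \<le> C0 * exp (2 * R) * exp (- 2 * \<bar>y\<bar>)" by (simp only: exp_add mult.assoc)
    have "c * ((1 + (x - y)\<^sup>2) * heat_kernel t (x - y)) * \<bar>p y\<bar>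
       \<le> c * (C0 * exp (2 * R) * exp (- 2 * \<bar>y\<bar>)) * ((\<bar>p 0\<bar> + M) * exp \<bar>y\<bar>)"
      by (rule mult_mono[OF mult_left_mono[OF k] p]) (use c C0(1) in auto)
    also have "\<dots> = C * (exp (- 2 * \<bar>y\<bar>) * exp \<bar>y\<bar>)" unfolding C_def by (simp only: mult_ac)
    also have "\<dots> = C * exp (- \<bar>y\<bar>)" by (simp flip: exp_add)
    finally show ?thesis .
  qed
  have coef: "\<bar>A * heat_kernel t (x - y) * p y\<bar> \<le> C * exp (- \<bar>y\<bar>)"
    if t: "a \<le> t" "t \<le> b" and x: "\<bar>x\<bar> \<le> R" and A: "\<bar>A\<bar> \<le> c * (1 + (x - y)\<^sup>2)" for A t x y
  proof -
    have k0: "0 \<le> heat_kernel t (x - y)" using t ab by (intro heat_kernel_nonneg) simp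
    have "\<bar>A * heat_kernel t (x - y) * p y\<bar> = \<bar>A\<bar> * heat_kernel t (x - y) * \<bar>p y\<bar>" using k0 by (simp add: abs_mult)
    also have "\<dots> \<le> (c * (1 + (x - y)\<^sup>2)) * heat_kernel t (x - y) * \<bar>p y\<bar>"
      using A k0 by (intro mult_right_mono) auto
    also have "\<dots> \<le> C * exp (- \<bar>y\<bar>)" using key[OF t x] by (simp only: mult.assoc)
    finally show ?thesis .
  qed
  have coefs: "\<bar>1\<bar> \<le> c * (1 + z\<^sup>2)" "\<bar>- z / (2 * t)\<bar> \<le> c * (1 + z\<^sup>2)" "\<bar>z\<^sup>2 / (4 * t\<^sup>2) - 1 / (2 * t)\<bar> \<le> c * (1 + z\<^sup>2)"
    if t: "a \<le> t" for t z
  proof -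
    have t0: "t > 0" using t ab by simp
    have i1: "1 / (2 * t) \<le> 1 / (2 * a)" using t ab by (simp add: frac_le)
    have "a\<^sup>2 \<le> t\<^sup>2" using t ab by (intro power_mono) auto
    then have i2: "1 / (4 * t\<^sup>2) \<le> 1 / (4 * a\<^sup>2)" using ab by (simp add: frac_le)
    have "1 * 1 \<le> c * (1 + z\<^sup>2)" using c by (intro mult_mono) auto
    then show "\<bar>1\<bar> \<le> c * (1 + z\<^sup>2)" by simp
    have "1 / (2 * t) * \<bar>z\<bar> \<le> c * (1 + z\<^sup>2)"
      using i1 abs_le_one_plus_square[of z] ab t0 unfolding c_def by (intro mult_mono) (auto intro: order_trans)
    then show "\<bar>- z / (2 * t)\<bar> \<le> c * (1 + z\<^sup>2)" using t0 by (simp add: abs_divide)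
    have "\<bar>z\<^sup>2 / (4 * t\<^sup>2) - 1 / (2 * t)\<bar> \<le> 1 / (4 * t\<^sup>2) * z\<^sup>2 + 1 / (2 * t) * 1"
      using t0 by (simp add: abs_le_iff)
    also have "\<dots> \<le> 1 / (4 * a\<^sup>2) * (1 + z\<^sup>2) + 1 / (2 * a) * (1 + z\<^sup>2)"
      using i1 i2 ab by (intro add_mono mult_mono) auto
    also have "\<dots> \<le> c * (1 + z\<^sup>2)" unfolding c_def distrib_right by simp
    finally show "\<bar>z\<^sup>2 / (4 * t\<^sup>2) - 1 / (2 * t)\<bar> \<le> c * (1 + z\<^sup>2)" .
  qed
  show ?thesis
  proof (rule that[of C])
    fix t x y :: real assume h: "a \<le> t" "t \<le> b" "\<bar>x\<bar> \<le> R"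
    show "\<bar>heat_kernel t (x - y) * p y\<bar> \<le> C * exp (- \<bar>y\<bar>)" using coef[OF h coefs(1)[OF h(1)], of y] by simp
    show "\<bar>heat_kernel_x t (x - y) * p y\<bar> \<le> C * exp (- \<bar>y\<bar>)" unfolding heat_kernel_x_def by (rule coef[OF h coefs(2)[OF h(1)]])
    show "\<bar>heat_kernel_xx t (x - y) * p y\<bar> \<le> C * exp (- \<bar>y\<bar>)" unfolding heat_kernel_xx_def by (rule coef[OF h coefs(3)[OF h(1)]])
  qed
qed

definition heat_x :: "real \<Rightarrow> real \<Rightarrow> real" where
  "heat_x t x = (LINT y|lborel. heat_kernel_x t (x - y) * p y)"

lemma heat_flow_pos: "t > 0 \<Longrightarrow> heat_flow p t x = (LINT y|lborel. heat_kernel t (x - y) * p y)"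
  unfolding heat_flow_def conv_def by simp

lemma heat_derivatives:
  assumes t: "t > 0"
  shows "(heat_flow p t has_real_derivative heat_x t x) (at x)"
    "(heat_x t has_real_derivative heat_xx t x) (at x)"
    "((\<lambda>s. heat_flow p s x) has_real_derivative heat_xx t x) (at t)"
proof -
  have ab: "0 < t / 2" "t / 2 \<le> 2 * t" using t by auto
  obtain C where C: "\<And>s z y. t / 2 \<le> s \<Longrightarrow> s \<le> 2 * t \<Longrightarrow> \<bar>z\<bar> \<le> \<bar>x\<bar> + 1 \<Longrightarrow> \<bar>heat_kernel s (z - y) * p y\<bar> \<le> C * exp (- \<bar>y\<bar>)"
    "\<And>s z y. t / 2 \<le> s \<Longrightarrow> s \<le> 2 * t \<Longrightarrow> \<bar>z\<bar> \<le> \<bar>x\<bar> + 1 \<Longrightarrow> \<bar>heat_kernel_x s (z - y) * p y\<bar> \<le> C * exp (- \<bar>y\<bar>)"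
    "\<And>s z y. t / 2 \<le> s \<Longrightarrow> s \<le> 2 * t \<Longrightarrow> \<bar>z\<bar> \<le> \<bar>x\<bar> + 1 \<Longrightarrow> \<bar>heat_kernel_xx s (z - y) * p y\<bar> \<le> C * exp (- \<bar>y\<bar>)"
    by (rule heat_dominated[OF ab, of "\<bar>x\<bar> + 1"]) auto
  have int: "integrable lborel h" if "h \<in> borel_measurable borel" "\<And>y. \<bar>h y\<bar> \<le> C * exp (- \<bar>y\<bar>)" for h :: "real \<Rightarrow> real"
  proof (rule Bochner_Integration.integrable_bound[OF exp_abs_integrable[of C]])
    show "AE y in lborel. norm (h y) \<le> norm (C * exp (- \<bar>y\<bar>))"
    proof (rule AE_I2)
      fix y show "norm (h y) \<le> norm (C * exp (- \<bar>y\<bar>))" using that(2)[of y] unfolding real_norm_def by linarith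
    qed
  qed (use that in auto)
  have sh: "((\<lambda>s. s - y) has_real_derivative 1) (at z)" for z y :: real by (auto intro!: derivative_eq_intros)
  have zb: "\<bar>z - x\<bar> < 1 \<Longrightarrow> \<bar>z\<bar> \<le> \<bar>x\<bar> + 1" for z by linarith
  have t2: "t / 2 \<le> t" "t \<le> 2 * t" using t by auto
  have "((\<lambda>z. LINT y|lborel. heat_kernel t (z - y) * p y) has_real_derivative (LINT y|lborel. heat_kernel_x t (x - y) * p y)) (at x)"
  proof (rule has_real_derivative_integral[where r=1 and w="\<lambda>y. C * exp (- \<bar>y\<bar>)"])
    fix z assume z: "\<bar>z - x\<bar> < 1"
    show "((\<lambda>s. heat_kernel t (s - y) * p y) has_real_derivative heat_kernel_x t (z - y) * p y) (at z)" for y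
    proof (rule DERIV_cmult_right)
      show "((\<lambda>s. heat_kernel t (s - y)) has_real_derivative heat_kernel_x t (z - y)) (at z)"
        using DERIV_chain2[OF heat_kernel_deriv_x[OF t] sh[of y z]] by simp
    qed
    show "\<bar>heat_kernel_x t (z - y) * p y\<bar> \<le> C * exp (- \<bar>y\<bar>)" for y by (rule C(2)[OF t2 zb[OF z]])
    show "integrable lborel (\<lambda>y. heat_kernel t (z - y) * p y)" by (rule int[OF _ C(1)[OF t2 zb[OF z]]]) measurable
  qed (use exp_abs_integrable in auto)
  then show "(heat_flow p t has_real_derivative heat_x t x) (at x)"
    unfolding heat_x_def heat_flow_pos[OF t, abs_def] .
  have "((\<lambda>z. LINT y|lborel. heat_kernel_x t (z - y) * p y) has_real_derivative (LINT y|lborel. heat_kernel_xx t (x - y) * p y)) (at x)"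
  proof (rule has_real_derivative_integral[where r=1 and w="\<lambda>y. C * exp (- \<bar>y\<bar>)"])
    fix z assume z: "\<bar>z - x\<bar> < 1"
    show "((\<lambda>s. heat_kernel_x t (s - y) * p y) has_real_derivative heat_kernel_xx t (z - y) * p y) (at z)" for y
    proof (rule DERIV_cmult_right)
      show "((\<lambda>s. heat_kernel_x t (s - y)) has_real_derivative heat_kernel_xx t (z - y)) (at z)"
        using DERIV_chain2[OF heat_kernel_deriv_xx[OF t] sh[of y z]] by simp
    qed
    show "\<bar>heat_kernel_xx t (z - y) * p y\<bar> \<le> C * exp (- \<bar>y\<bar>)" for y by (rule C(3)[OF t2 zb[OF z]])
    show "integrable lborel (\<lambda>y. heat_kernel_x t (z - y) * p y)" by (rule int[OF _ C(2)[OF t2 zb[OF z]]]) measurable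
  qed (use exp_abs_integrable in auto)
  then show "(heat_x t has_real_derivative heat_xx t x) (at x)"
    unfolding heat_x_def[abs_def] heat_xx_def .
  have "((\<lambda>s. LINT y|lborel. heat_kernel s (x - y) * p y) has_real_derivative (LINT y|lborel. heat_kernel_xx t (x - y) * p y)) (at t)"
  proof (rule has_real_derivative_integral[where r="t / 2" and w="\<lambda>y. C * exp (- \<bar>y\<bar>)"])
    fix s assume "\<bar>s - t\<bar> < t / 2"
    then have s: "s > 0" "t / 2 \<le> s" "s \<le> 2 * t" using t by linarith+
    show "((\<lambda>s. heat_kernel s (x - y) * p y) has_real_derivative heat_kernel_xx s (x - y) * p y) (at s)" for y
      by (rule DERIV_cmult_right[OF heat_kernel_deriv_t[OF s(1)]])
    show "\<bar>heat_kernel_xx s (x - y) * p y\<bar> \<le> C * exp (- \<bar>y\<bar>)" for y by (rule C(3)[OF s(2,3)]) simp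
    show "integrable lborel (\<lambda>y. heat_kernel s (x - y) * p y)" by (rule int[OF _ C(1)[OF s(2,3)]]) auto
  qed (use t exp_abs_integrable in auto)
  then have "((\<lambda>s. LINT y|lborel. heat_kernel s (x - y) * p y) has_real_derivative heat_xx t x) (at t)" unfolding heat_xx_def .
  \<comment> \<open>\<open>heat_flow\<close> is defined by cases at t = 0; the integral formula
    holds on the open set of positive times, which determines the derivative at t.\<close>
  then show "((\<lambda>s. heat_flow p s x) has_real_derivative heat_xx t x) (at t)"
    by (rule has_field_derivative_transform_within_open[where S="{0<..}"]) (use t in \<open>auto simp: heat_flow_pos\<close>)
qed

lemma heat_flow_solves: "solves_heat_eq T p (heat_flow p)"
  unfolding solves_heat_eq_def
proof (intro conjI ballI)
  show "heat_flow p 0 = p" by (simp add: heat_flow_def)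
  fix t assume "t \<in> {0<..T}"
  then have t: "t > 0" by simp
  show "\<exists>qx qxx. (\<forall>x. (heat_flow p t has_real_derivative qx x) (at x)) \<and> (\<forall>x. (qx has_real_derivative qxx x) (at x)) \<and>
      (\<forall>x. ((\<lambda>s. heat_flow p s x) has_real_derivative qxx x) (at t within {0..T}))"
    using heat_derivatives[OF t] has_field_derivative_at_within[OF heat_derivatives(3)[OF t]]
    by (intro exI[of _ "heat_x t"] exI[of _ "heat_xx t"]) auto
qed

lemma heat_flow_continuous: "continuous_on ({0..T} \<times> UNIV) (\<lambda>(t, x). heat_flow p t x)"
  unfolding continuous_on_def
proof
  fix z :: "real \<times> real" assume z: "z \<in> {0..T} \<times> UNIV"
  let ?g = "\<lambda>z'. M * gauss_mass * sqrt (2 * \<bar>fst z' - fst z\<bar>) + M * \<bar>snd z' - snd z\<bar>"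
  have "((\<lambda>z'. (case z' of (t, x) \<Rightarrow> heat_flow p t x) - (case z of (t, x) \<Rightarrow> heat_flow p t x)) \<longlongrightarrow> 0) (at z within {0..T} \<times> UNIV)"
  proof (rule Lim_null_comparison[where g="?g"])
    show "\<forall>\<^sub>F z' in at z within {0..T} \<times> UNIV.
        norm ((case z' of (t, x) \<Rightarrow> heat_flow p t x) - (case z of (t, x) \<Rightarrow> heat_flow p t x)) \<le> ?g z'"
      using z heat_flow_dist by (auto simp: eventually_at_filter split: prod.splits intro!: always_eventually)
    have "(?g \<longlongrightarrow> M * gauss_mass * sqrt (2 * \<bar>fst z - fst z\<bar>) + M * \<bar>snd z - snd z\<bar>) (at z within {0..T} \<times> UNIV)"
      by (intro tendsto_intros)
    then show "(?g \<longlongrightarrow> 0) (at z within {0..T} \<times> UNIV)" by simp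
  qed
  then show "((\<lambda>(t, x). heat_flow p t x) \<longlongrightarrow> (case z of (t, x) \<Rightarrow> heat_flow p t x)) (at z within {0..T} \<times> UNIV)"
    by (rule LIM_zero_cancel)
qed

lemma heat_flow_tame: assumes "t \<ge> 0" shows "tame (heat_flow p t)" "\<bar>heat_flow p t y\<bar> \<le> (\<bar>heat_flow p t 0\<bar> + M) * (1 + y\<^sup>2)"
proof -
  have l: "\<bar>heat_flow p t x - heat_flow p t y\<bar> \<le> M * \<bar>x - y\<bar>" for x y
    using heat_flow_dist[OF assms assms, of x y] by simp
  show b: "\<bar>heat_flow p t y\<bar> \<le> (\<bar>heat_flow p t 0\<bar> + M) * (1 + y\<^sup>2)" for y
  proof -
    have "\<bar>heat_flow p t y\<bar> \<le> \<bar>heat_flow p t 0\<bar> * 1 + M * \<bar>y\<bar>" using l[of y 0] by simp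
    also have "\<dots> \<le> \<bar>heat_flow p t 0\<bar> * (1 + y\<^sup>2) + M * (1 + y\<^sup>2)"
      using M abs_le_one_plus_square[of y] by (intro add_mono mult_left_mono) auto
    finally show ?thesis by (simp add: distrib_right)
  qed
  show "tame (heat_flow p t)"
  proof (rule tameI[OF _ b])
    show "heat_flow p t \<in> borel_measurable borel"
      unfolding heat_flow_def[abs_def] conv_def by (cases "t = 0") auto
  qed
qed

lemma heat_x_bound: assumes t: "t > 0" shows "\<bar>heat_x t x\<bar> \<le> M"
proof (rule tendsto_upperbound)
  have "((\<lambda>h. (heat_flow p t (x + h) - heat_flow p t x) / h) \<longlongrightarrow> heat_x t x) (at 0)"
    using heat_derivatives(1)[OF t, of x] unfolding DERIV_def .
  then show "((\<lambda>h. \<bar>(heat_flow p t (x + h) - heat_flow p t x) / h\<bar>) \<longlongrightarrow> \<bar>heat_x t x\<bar>) (at 0)" by (rule tendsto_rabs)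
  have "\<bar>(heat_flow p t (x + h) - heat_flow p t x) / h\<bar> \<le> M" if "h \<noteq> 0" for h
    using heat_flow_dist[of t t "x + h" x] t that by (simp add: abs_divide pos_divide_le_eq)
  then show "\<forall>\<^sub>F h in at 0. \<bar>(heat_flow p t (x + h) - heat_flow p t x) / h\<bar> \<le> M"
    by (auto simp: eventually_at_filter)
qed simp

text \<open>The iteration is the implicit Euler scheme for the heat equation, so the consistency error is
  controlled by the modulus of continuity in time of the second space derivative.\<close>

lemma implicit_euler_error:
  assumes e: "e > 0" and \<delta>: "\<delta> > 0" and k: "real k * e\<^sup>2 \<le> T"
  defines "\<omega> \<equiv> M * gauss_mass * (e\<^sup>2 * sqrt (2 * (T + \<delta>)) / (2 * \<delta>\<^sup>2) + sqrt (2 * e\<^sup>2) / (2 * \<delta>))"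
  shows "\<bar>heat_flow p (real k * e\<^sup>2 + \<delta>) x - (conv (g_ker e) ^^ k) p x\<bar> \<le> M * gauss_mass * sqrt (2 * \<delta>) + real k * e\<^sup>2 * \<omega>"
  using k
proof (induction k arbitrary: x)
  \<comment> \<open>The flow runs a time \<delta> ahead, so all times in the induction step are at
    least \<delta>; the base case pays with the distance between p and its flow at time
    \<delta>.\<close>
  case 0
  have "heat_flow p 0 = p" by (simp add: heat_flow_def)
  then show ?case using heat_flow_dist[of 0 \<delta> x x] \<delta> by simp
next
  case (Suc k)
  define s where "s = real k * e\<^sup>2 + \<delta>"
  define t where "t = real (Suc k) * e\<^sup>2 + \<delta>"
  have e2: "e\<^sup>2 > 0" using e by simp
  have ts: "t = s + e\<^sup>2" unfolding t_def s_def by (simp add: algebra_simps)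
  have s: "\<delta> \<le> s" "s > 0" unfolding s_def using \<delta> e2 by (auto intro: add_nonneg_pos)
  have "t \<le> T + \<delta>" using Suc.prems unfolding t_def by simp
  moreover have "t > 0" "\<delta> \<le> t" using ts s e2 by linarith+
  ultimately have t: "t > 0" "\<delta> \<le> t" "t \<le> T + \<delta>" by auto
  have "real (Suc k) * e\<^sup>2 = real k * e\<^sup>2 + e\<^sup>2" by (simp add: algebra_simps)
  then have kT: "real k * e\<^sup>2 \<le> T" using Suc.prems e2 by linarith
  define v where "v = (conv (g_ker e) ^^ k) p"
  have tv: "tame v" unfolding v_def by (rule tame_iterate[OF e lip_tame])
  have cxx: "heat_xx t \<in> borel_measurable borel" unfolding heat_xx_def[abs_def] by measurable
  have txx: "tame (heat_xx t)" by (rule tame_bounded[OF cxx heat_xx_bound[OF t(1)]])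
  note tQ = heat_flow_tame(1)[OF less_imp_le[OF t(1)]]
  have tw: "tame (\<lambda>y. heat_flow p t y - e\<^sup>2 * heat_xx t y)" by (intro tame_diff tQ tame_cmult txx)
  \<comment> \<open>By the resolvent identity the exact flow, too, is a convolution with the kernel.
    The error is therefore an average, and its sup norm grows only by the consistency error.\<close>
  have "conv (g_ker e) (\<lambda>y. heat_flow p t y - e\<^sup>2 * heat_xx t y) x = heat_flow p t x"
  proof (rule conv_g_resolvent[OF e tw heat_derivatives(1,2)[OF t(1)], where C="\<bar>heat_flow p t 0\<bar> + M"])
    show "\<bar>heat_flow p t y\<bar> \<le> (\<bar>heat_flow p t 0\<bar> + M) * (1 + y\<^sup>2)" for y using heat_flow_tame(2)[of t y] t by simp
    have "M * 1 \<le> (\<bar>heat_flow p t 0\<bar> + M) * (1 + y\<^sup>2)" for y :: real using M by (intro mult_mono) auto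
    then show "\<bar>heat_x t y\<bar> \<le> (\<bar>heat_flow p t 0\<bar> + M) * (1 + y\<^sup>2)" for y using heat_x_bound[OF t(1), of y] by (smt (verit))
  qed
  then have eq: "heat_flow p t x - conv (g_ker e) v x = conv (g_ker e) (\<lambda>y. (heat_flow p t y - e\<^sup>2 * heat_xx t y) - v y) x"
    by (simp add: conv_g_diff[OF e tw tv])
  have step: "\<bar>(heat_flow p t y - e\<^sup>2 * heat_xx t y) - heat_flow p s y\<bar> \<le> e\<^sup>2 * \<omega>" for y
  proof -
    have "\<exists>z. s < z \<and> z < t \<and> heat_flow p t y - heat_flow p s y = (t - s) * heat_xx z y"
      by (rule MVT2) (use ts e2 s heat_derivatives(3) in auto)
    then obtain z where z: "s < z" "z < t" "heat_flow p t y - heat_flow p s y = e\<^sup>2 * heat_xx z y" using ts by auto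
    then have "(heat_flow p t y - e\<^sup>2 * heat_xx t y) - heat_flow p s y = e\<^sup>2 * (heat_xx z y - heat_xx t y)"
      by (simp add: algebra_simps)
    then have "\<bar>(heat_flow p t y - e\<^sup>2 * heat_xx t y) - heat_flow p s y\<bar> = e\<^sup>2 * \<bar>heat_xx z y - heat_xx t y\<bar>"
      by (simp add: abs_mult)
    also have "\<dots> \<le> e\<^sup>2 * \<omega>"
    proof (rule mult_left_mono)
      have d: "\<bar>z - t\<bar> \<le> e\<^sup>2" using z ts by auto
      have "\<bar>heat_xx z y - heat_xx t y\<bar> \<le> M * gauss_mass * (\<bar>z - t\<bar> * sqrt (2 * (T + \<delta>)) / (2 * \<delta>\<^sup>2) + sqrt (2 * \<bar>z - t\<bar>) / (2 * \<delta>))"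
        by (rule heat_xx_time[OF \<delta>]) (use z t s in auto)
      also have "\<dots> \<le> \<omega>" unfolding \<omega>_def
        using d \<delta> t by (intro mult_left_mono add_mono divide_right_mono mult_right_mono mult_nonneg_nonneg gauss_mass_nonneg M) auto
      finally show "\<bar>heat_xx z y - heat_xx t y\<bar> \<le> \<omega>" .
    qed simp
    finally show ?thesis .
  qed
  have "\<bar>conv (g_ker e) (\<lambda>y. (heat_flow p t y - e\<^sup>2 * heat_xx t y) - v y) x\<bar> \<le> M * gauss_mass * sqrt (2 * \<delta>) + real k * e\<^sup>2 * \<omega> + e\<^sup>2 * \<omega>"
  proof (rule conv_g_bound[OF e tame_measurable[OF tame_diff[OF tw tv]]])
    fix y
    show "\<bar>heat_flow p t y - e\<^sup>2 * heat_xx t y - v y\<bar> \<le> M * gauss_mass * sqrt (2 * \<delta>) + real k * e\<^sup>2 * \<omega> + e\<^sup>2 * \<omega>"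
      using step[of y] Suc.IH[OF kT, of y] unfolding s_def v_def by linarith
  qed
  then show ?case unfolding eq[symmetric] unfolding t_def v_def by (simp add: algebra_simps)
qed

text \<open>\<delta> is fixed before e0, since the consistency error contains negative powers of
  \<delta>. The time shift is paid twice, at the start and when it is removed at the end.\<close>

lemma heat_iteration_convergence:
  assumes T: "T > 0" and \<eta>: "\<eta> > 0"
  obtains e0 where "e0 > 0" "\<And>e k x. 0 < e \<Longrightarrow> e < e0 \<Longrightarrow> real k * e\<^sup>2 \<le> T \<Longrightarrow>
    \<bar>(conv (g_ker e) ^^ k) p x - heat_flow p (real k * e\<^sup>2) x\<bar> \<le> \<eta>"
proof -
  have "((\<lambda>\<delta>. 2 * (M * gauss_mass * sqrt (2 * \<delta>))) \<longlongrightarrow> 2 * (M * gauss_mass * sqrt (2 * 0))) (at_right 0)"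
    by (intro tendsto_intros)
  then have "\<forall>\<^sub>F \<delta> in at_right 0. 2 * (M * gauss_mass * sqrt (2 * \<delta>)) < \<eta> / 2"
    using \<eta> by (intro order_tendstoD(2)) auto
  then have "\<forall>\<^sub>F \<delta> in at_right 0. 2 * (M * gauss_mass * sqrt (2 * \<delta>)) < \<eta> / 2 \<and> \<delta> > 0"
    using eventually_at_right_less[of "0::real"] by eventually_elim auto
  then obtain \<delta> where \<delta>: "2 * (M * gauss_mass * sqrt (2 * \<delta>)) < \<eta> / 2" "\<delta> > 0"
    using eventually_happens'[OF trivial_limit_at_right_real] by blast
  define \<omega> where "\<omega> e = M * gauss_mass * (e\<^sup>2 * sqrt (2 * (T + \<delta>)) / (2 * \<delta>\<^sup>2) + sqrt (2 * e\<^sup>2) / (2 * \<delta>))" for e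
  have "((\<lambda>e. T * \<omega> e) \<longlongrightarrow> T * \<omega> 0) (at_right 0)" unfolding \<omega>_def using \<delta>(2) by (intro tendsto_intros) auto
  then have "\<forall>\<^sub>F e in at_right 0. T * \<omega> e < \<eta> / 2"
    using \<eta> by (intro order_tendstoD(2)) (auto simp: \<omega>_def)
  then obtain e0 where e0: "e0 > 0" "\<And>e. 0 < e \<Longrightarrow> e < e0 \<Longrightarrow> T * \<omega> e < \<eta> / 2"
    unfolding eventually_at_right_field by auto
  show ?thesis
  proof (rule that[OF e0(1)])
    fix e x :: real and k :: nat assume e: "0 < e" "e < e0" and k: "real k * e\<^sup>2 \<le> T"
    have w0: "0 \<le> \<omega> e" unfolding \<omega>_def using M gauss_mass_nonneg \<delta>(2) T by (intro mult_nonneg_nonneg add_nonneg_nonneg divide_nonneg_nonneg) auto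
    have "\<bar>heat_flow p (real k * e\<^sup>2 + \<delta>) x - (conv (g_ker e) ^^ k) p x\<bar> \<le> M * gauss_mass * sqrt (2 * \<delta>) + real k * e\<^sup>2 * \<omega> e"
      unfolding \<omega>_def by (rule implicit_euler_error[OF e(1) \<delta>(2) k])
    moreover have "real k * e\<^sup>2 * \<omega> e \<le> T * \<omega> e" by (rule mult_right_mono[OF k w0])
    moreover have "\<bar>heat_flow p (real k * e\<^sup>2 + \<delta>) x - heat_flow p (real k * e\<^sup>2) x\<bar> \<le> M * gauss_mass * sqrt (2 * \<delta>)"
      using heat_flow_dist[of "real k * e\<^sup>2" "real k * e\<^sup>2 + \<delta>" x x] \<delta>(2) by simp
    ultimately show "\<bar>(conv (g_ker e) ^^ k) p x - heat_flow p (real k * e\<^sup>2) x\<bar> \<le> \<eta>"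
      using e0(2)[OF e] \<delta>(1) by linarith
  qed
qed

end

declare lip_measurable [measurable del]

section \<open>Compactness\<close>

text \<open>The interpolated functions jump in time, so equicontinuity holds only asymptotically in the index.\<close>

lemma asymptotic_arzela_ascoli:
  fixes F :: "nat \<Rightarrow> 'a::euclidean_space \<Rightarrow> real"
  assumes bd: "\<And>k z. z \<in> D \<Longrightarrow> \<bar>F k z\<bar> \<le> M"
    and eq: "\<And>\<eta>. \<eta> > 0 \<Longrightarrow> \<exists>\<delta>>0. \<exists>k0. \<forall>k\<ge>k0. \<forall>z\<in>D. \<forall>z'\<in>D. dist z z' < \<delta> \<longrightarrow> \<bar>F k z - F k z'\<bar> \<le> \<eta>"
  obtains r f where "strict_mono (r :: nat \<Rightarrow> nat)"
    "\<And>\<eta>. \<eta> > 0 \<Longrightarrow> \<exists>\<delta>>0. \<forall>z\<in>D. \<forall>z'\<in>D. dist z z' < \<delta> \<longrightarrow> \<bar>f z - f z'\<bar> \<le> \<eta>"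
    "\<And>z. z \<in> D \<Longrightarrow> \<bar>f z\<bar> \<le> M"
    "\<And>z. z \<in> D \<Longrightarrow> (\<lambda>k. F (r k) z) \<longlonglongrightarrow> f z"
    "\<And>K. compact K \<Longrightarrow> K \<subseteq> D \<Longrightarrow> uniform_limit K (\<lambda>k. F (r k)) f sequentially"
proof -
  \<comment> \<open>Convergence is arranged on a countable dense set by a diagonal subsequence;
    asymptotic equicontinuity then carries it to all of D.\<close>
  obtain S where S: "countable S" "S \<subseteq> D" "D \<subseteq> closure S" by (rule separable)
  obtain r where r: "strict_mono (r :: nat \<Rightarrow> nat)" and lim: "\<And>x. x \<in> S \<Longrightarrow> \<exists>l. (\<lambda>n. F (r n) x) \<longlonglongrightarrow> l"
  proof (rule function_convergent_subsequence[OF S(1), of F M])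
    show "norm (F n x) \<le> M" if "x \<in> S" for n x using bd that S(2) by auto
  qed (use that in blast)
  have eq': "\<exists>\<delta>>0. \<exists>k0. \<forall>k\<ge>k0. \<forall>z\<in>D. \<forall>z'\<in>D. dist z z' < \<delta> \<longrightarrow> \<bar>F (r k) z - F (r k) z'\<bar> \<le> \<eta>" if "\<eta> > 0" for \<eta>
    using eq[OF that] seq_suble[OF r] by (meson order_trans)
  have "Cauchy (\<lambda>k. F (r k) z)" if z: "z \<in> D" for z
  proof (rule metric_CauchyI)
    fix \<eta> :: real assume "\<eta> > 0"
    then obtain \<delta> k0 where \<delta>: "\<delta> > 0" and k0': "\<forall>k\<ge>k0. \<forall>z\<in>D. \<forall>z'\<in>D. dist z z' < \<delta> \<longrightarrow> \<bar>F (r k) z - F (r k) z'\<bar> \<le> \<eta> / 4"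
      using eq'[of "\<eta> / 4"] by auto
    then have k0: "\<And>k z z'. k \<ge> k0 \<Longrightarrow> z \<in> D \<Longrightarrow> z' \<in> D \<Longrightarrow> dist z z' < \<delta> \<Longrightarrow> \<bar>F (r k) z - F (r k) z'\<bar> \<le> \<eta> / 4"
      by blast
    obtain s where s: "s \<in> S" "dist s z < \<delta>" using S(3) z \<delta> closure_approachable by blast
    have "Cauchy (\<lambda>n. F (r n) s)" using lim[OF s(1)] convergent_Cauchy convergent_def by blast
    then obtain N where N: "\<And>i j. i \<ge> N \<Longrightarrow> j \<ge> N \<Longrightarrow> dist (F (r i) s) (F (r j) s) < \<eta> / 4"
      using \<open>\<eta> > 0\<close> metric_CauchyD[of "\<lambda>n. F (r n) s" "\<eta> / 4"] by auto
    have "dist (F (r i) z) (F (r j) z) < \<eta>" if "i \<ge> max N k0" "j \<ge> max N k0" for i j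
    proof -
      have "s \<in> D" using s S(2) by auto
      then show ?thesis using k0[of i s z] k0[of j s z] N[of i j] that s z \<open>\<eta> > 0\<close> unfolding dist_real_def by linarith
    qed
    then show "\<exists>M. \<forall>m\<ge>M. \<forall>n\<ge>M. dist (F (r m) z) (F (r n) z) < \<eta>" by blast
  qed
  then have "\<forall>z\<in>D. \<exists>l. (\<lambda>k. F (r k) z) \<longlonglongrightarrow> l" using Cauchy_convergent convergent_def by blast
  then obtain f where f: "\<And>z. z \<in> D \<Longrightarrow> (\<lambda>k. F (r k) z) \<longlonglongrightarrow> f z" by metis
  have fM: "\<bar>f z\<bar> \<le> M" if "z \<in> D" for z
    by (rule tendsto_upperbound[OF tendsto_rabs[OF f[OF that]]]) (use bd[OF that] in auto)
  \<comment> \<open>The limit inherits the modulus with the same \<delta>, now free of the index; so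
    it can be continuous although the F k jump.\<close>
  have both: "\<exists>\<delta>>0. \<exists>k0. (\<forall>k\<ge>k0. \<forall>z\<in>D. \<forall>z'\<in>D. dist z z' < \<delta> \<longrightarrow> \<bar>F (r k) z - F (r k) z'\<bar> \<le> \<eta>)
      \<and> (\<forall>z\<in>D. \<forall>z'\<in>D. dist z z' < \<delta> \<longrightarrow> \<bar>f z - f z'\<bar> \<le> \<eta>)" if \<eta>: "\<eta> > 0" for \<eta>
  proof -
    obtain \<delta> k0 where \<delta>: "\<delta> > 0" and k0: "\<forall>k\<ge>k0. \<forall>z\<in>D. \<forall>z'\<in>D. dist z z' < \<delta> \<longrightarrow> \<bar>F (r k) z - F (r k) z'\<bar> \<le> \<eta>"
      using eq'[OF \<eta>] by auto
    have "\<bar>f z - f z'\<bar> \<le> \<eta>" if z: "z \<in> D" "z' \<in> D" "dist z z' < \<delta>" for z z'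
    proof (rule tendsto_upperbound[OF tendsto_rabs[OF tendsto_diff[OF f[OF z(1)] f[OF z(2)]]]])
      show "\<forall>\<^sub>F k in sequentially. \<bar>F (r k) z - F (r k) z'\<bar> \<le> \<eta>"
        using eventually_ge_at_top[of k0] by eventually_elim (use k0 z in blast)
    qed simp
    then show ?thesis using \<delta> k0 by blast
  qed
  have unif: "uniform_limit K (\<lambda>k. F (r k)) f sequentially" if K: "compact K" "K \<subseteq> D" for K
  proof (rule uniform_limitI)
    fix \<eta> :: real assume \<eta>: "\<eta> > 0"
    obtain \<delta> k0 where \<delta>: "\<delta> > 0" and k0: "\<forall>k\<ge>k0. \<forall>z\<in>D. \<forall>z'\<in>D. dist z z' < \<delta> \<longrightarrow> \<bar>F (r k) z - F (r k) z'\<bar> \<le> \<eta> / 4"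
      and fd: "\<forall>z\<in>D. \<forall>z'\<in>D. dist z z' < \<delta> \<longrightarrow> \<bar>f z - f z'\<bar> \<le> \<eta> / 4"
      using both[of "\<eta> / 4"] \<eta> by auto
    have cover: "K \<subseteq> (\<Union>c\<in>K. ball c \<delta>)" using \<delta> by force
    obtain C where C: "finite C" "C \<subseteq> K" "K \<subseteq> (\<Union>c\<in>C. ball c \<delta>)"
      by (rule compactE_image[OF K(1) open_ball cover])
    have "\<forall>\<^sub>F k in sequentially. \<forall>c\<in>C. dist (F (r k) c) (f c) < \<eta> / 4"
      using C K \<eta> by (intro eventually_ball_finite ballI tendstoD f) auto
    then show "\<forall>\<^sub>F k in sequentially. \<forall>z\<in>K. dist (F (r k) z) (f z) < \<eta>"
      using eventually_ge_at_top[of k0]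
    proof eventually_elim
      case (elim k)
      show ?case
      proof
        fix z assume z: "z \<in> K"
        then obtain c where c: "c \<in> C" "dist c z < \<delta>" using C(3) by auto
        have "c \<in> D" "z \<in> D" using c z C K by auto
        then have "\<bar>F (r k) c - F (r k) z\<bar> \<le> \<eta> / 4" "\<bar>f c - f z\<bar> \<le> \<eta> / 4"
          using k0 fd c elim by auto
        moreover have "\<bar>F (r k) c - f c\<bar> < \<eta> / 4" using elim c by (auto simp: dist_real_def)
        ultimately show "dist (F (r k) z) (f z) < \<eta>" using \<eta> unfolding dist_real_def by linarith
      qed
    qed
  qed
  have fc: "\<exists>\<delta>>0. \<forall>z\<in>D. \<forall>z'\<in>D. dist z z' < \<delta> \<longrightarrow> \<bar>f z - f z'\<bar> \<le> \<eta>" if "\<eta> > 0" for \<eta> using both[OF that] by blast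
  show ?thesis by (rule that[OF r fc fM f unif])
qed

section \<open>Regularity of the initial data\<close>

text \<open>Derivatives are carried as witnesses instead of through \<open>deriv\<close>, so that
  sums, products and affine substitutions go by induction;
  \<open>times_differentiable_iterated_deriv\<close> translates into the form of
  \<open>test_function\<close>.\<close>

primrec times_differentiable :: "nat \<Rightarrow> (real \<Rightarrow> real) \<Rightarrow> bool" where
  "times_differentiable 0 f \<longleftrightarrow> True"
| "times_differentiable (Suc n) f \<longleftrightarrow>
    (\<exists>f'. (\<forall>x. (f has_real_derivative f' x) (at x)) \<and> times_differentiable n f')"

lemma times_differentiable_SucD: "times_differentiable (Suc n) f \<Longrightarrow> times_differentiable n f"
  by (induction n arbitrary: f) (simp, metis times_differentiable.simps(2))

lemma times_differentiable_add:
  "times_differentiable n f \<Longrightarrow> times_differentiable n g \<Longrightarrow> times_differentiable n (\<lambda>x. f x + g x)"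
proof (induction n arbitrary: f g)
  case (Suc n)
  then obtain f' g' where "\<And>x. (f has_real_derivative f' x) (at x)" "times_differentiable n f'"
    "\<And>x. (g has_real_derivative g' x) (at x)" "times_differentiable n g'" by auto
  then show ?case using Suc.IH[of f' g'] by (auto intro!: exI[of _ "\<lambda>x. f' x + g' x"] derivative_intros)
qed simp

lemma times_differentiable_mult:
  "times_differentiable n f \<Longrightarrow> times_differentiable n g \<Longrightarrow> times_differentiable n (\<lambda>x. f x * g x)"
proof (induction n arbitrary: f g)
  case (Suc n)
  then obtain f' g' where d: "\<And>x. (f has_real_derivative f' x) (at x)" "times_differentiable n f'"
    "\<And>x. (g has_real_derivative g' x) (at x)" "times_differentiable n g'" by auto
  note s = times_differentiable_SucD[OF Suc.prems(1)] times_differentiable_SucD[OF Suc.prems(2)]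
  have "times_differentiable n (\<lambda>x. f x * g' x + f' x * g x)"
    by (intro times_differentiable_add Suc.IH s d)
  moreover have "((\<lambda>x. f x * g x) has_real_derivative f x * g' x + f' x * g x) (at x)" for x
    by (rule DERIV_mult'[OF d(1) d(3)])
  ultimately show ?case by (auto intro!: exI[of _ "\<lambda>x. f x * g' x + f' x * g x"])
qed simp

lemma times_differentiable_const: "times_differentiable n (\<lambda>x. c)"
  by (induction n arbitrary: c) (auto intro!: exI[of _ "\<lambda>x. 0"])

lemma times_differentiable_affine:
  "times_differentiable n f \<Longrightarrow> times_differentiable n (\<lambda>x. f (a * x + b))"
proof (induction n arbitrary: f)
  case (Suc n)
  then obtain f' where d: "\<And>x. (f has_real_derivative f' x) (at x)" "times_differentiable n f'" by auto
  have "((\<lambda>x. f (a * x + b)) has_real_derivative f' (a * x + b) * a) (at x)" for x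
    by (rule DERIV_chain2[OF d(1)]) (auto intro!: derivative_eq_intros)
  moreover have "times_differentiable n (\<lambda>x. f' (a * x + b) * a)"
    by (intro times_differentiable_mult times_differentiable_const Suc.IH d)
  ultimately show ?case by (auto intro!: exI[of _ "\<lambda>x. f' (a * x + b) * a"])
qed simp

lemma times_differentiable_iterated_deriv:
  "times_differentiable (Suc k) f \<Longrightarrow> (deriv ^^ k) f differentiable_on UNIV"
proof (induction k arbitrary: f)
  case 0
  then show ?case by (auto simp: differentiable_on_def real_differentiable_def)
next
  case (Suc k)
  then obtain f' where d: "\<And>x. (f has_real_derivative f' x) (at x)" "times_differentiable (Suc k) f'"
    using times_differentiable.simps(2)[of "Suc k" f] by blast
  have "deriv f = f'" using d(1) DERIV_imp_deriv by blast
  moreover have "(deriv ^^ Suc k) f = (deriv ^^ k) (deriv f)" by (simp only: funpow_Suc_right comp_apply)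
  ultimately show ?case using Suc.IH[OF d(2)] by simp
qed

text \<open>This family is closed under differentiation, which makes its members smooth at \<open>0\<close>.\<close>

definition flat_exp :: "real poly \<Rightarrow> real \<Rightarrow> real" where
  "flat_exp P x = (if x > 0 then poly P (1 / x) * exp (- (1 / x)) else 0)"

lemma poly_exp_decay: "((\<lambda>t::real. poly P t * exp (- t)) \<longlongrightarrow> 0) at_top"
proof -
  have "((\<lambda>t::real. \<Sum>i\<le>degree P. coeff P i * (t ^ i / exp t)) \<longlongrightarrow> (\<Sum>i\<le>degree P. coeff P i * 0)) at_top"
    by (intro tendsto_intros tendsto_power_div_exp_0)
  then show ?thesis by (simp add: poly_altdef sum_distrib_right exp_minus divide_inverse mult.assoc)
qed

text \<open>With s = 1/x, d/dx = - s^2 d/ds maps P(s) exp(-s) to s^2 (P - P')(s) exp(-s). At 0 the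
  right difference quotient is s P(s) exp(-s), which tends to 0.\<close>

lemma flat_exp_deriv:
  "(flat_exp P has_real_derivative flat_exp ([:0, 0, 1:] * (P - pderiv P)) x) (at x)"
proof -
  consider "x > 0" | "x < 0" | "x = 0" by linarith
  then show ?thesis
  proof cases
    case 1
    have inv: "((\<lambda>y. 1 / y) has_real_derivative - 1 / (x * x)) (at x)"
      using 1 by (auto intro!: derivative_eq_intros simp: power2_eq_square)
    have "((\<lambda>y. poly P (1 / y) * exp (- (1 / y))) has_real_derivative
        poly P (1 / x) * (exp (- (1 / x)) * - (- 1 / (x * x))) + (poly (pderiv P) (1 / x) * (- 1 / (x * x))) * exp (- (1 / x))) (at x)"
      by (intro DERIV_mult' DERIV_chain2[OF poly_DERIV inv] DERIV_chain2[OF DERIV_exp DERIV_minus[OF inv]])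
    moreover have "poly P (1 / x) * (exp (- (1 / x)) * - (- 1 / (x * x))) + (poly (pderiv P) (1 / x) * (- 1 / (x * x))) * exp (- (1 / x))
       = flat_exp ([:0, 0, 1:] * (P - pderiv P)) x"
      using 1 by (simp add: flat_exp_def field_simps)
    ultimately have "((\<lambda>y. poly P (1 / y) * exp (- (1 / y))) has_real_derivative flat_exp ([:0, 0, 1:] * (P - pderiv P)) x) (at x)" by simp
    then show ?thesis
      by (rule has_field_derivative_transform_within_open[where S="{0<..}"]) (use 1 in \<open>auto simp: flat_exp_def\<close>)
  next
    case 2
    have "((\<lambda>y. 0) has_real_derivative flat_exp ([:0, 0, 1:] * (P - pderiv P)) x) (at x)"
      using 2 by (simp add: flat_exp_def)
    then show ?thesis
      by (rule has_field_derivative_transform_within_open[where S="{..<0}"]) (use 2 in \<open>auto simp: flat_exp_def\<close>)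
  next
    case 3
    have "((\<lambda>h. flat_exp P h / h) \<longlongrightarrow> 0) (at 0)"
    proof (rule filterlim_split_at)
      show "((\<lambda>h. flat_exp P h / h) \<longlongrightarrow> 0) (at_left 0)"
        by (rule tendsto_eventually) (auto simp: eventually_at_filter flat_exp_def)
      have "((\<lambda>h. poly ([:0, 1:] * P) (inverse h) * exp (- (inverse h))) \<longlongrightarrow> 0) (at_right (0::real))"
        by (rule filterlim_compose[OF poly_exp_decay filterlim_inverse_at_top_right])
      then show "((\<lambda>h. flat_exp P h / h) \<longlongrightarrow> 0) (at_right 0)"
        by (rule Lim_transform_eventually) (auto simp: eventually_at_filter flat_exp_def divide_inverse)
    qed
    then show ?thesis unfolding 3 DERIV_def by (simp add: flat_exp_def)
  qed
qed

lemma times_differentiable_flat_exp: "times_differentiable n (flat_exp P)"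
  by (induction n arbitrary: P) (use flat_exp_deriv in auto)

lemma antiderivative_exists:
  fixes f :: "real \<Rightarrow> real"
  assumes "\<And>x. isCont f x"
  obtains F where "\<And>x. (F has_real_derivative f x) (at x)" "F 0 = 0"
proof -
  obtain F where F: "\<And>x. (F has_vector_derivative f x) (at x)"
    using einterval_antiderivative[of "-\<infinity>" "\<infinity>" f] assms by auto
  show ?thesis
  proof (rule that[of "\<lambda>x. F x - F 0"])
    show "((\<lambda>x. F x - F 0) has_real_derivative f x) (at x)" for x
      using F[of x] by (auto intro!: derivative_eq_intros simp: has_real_derivative_iff_has_vector_derivative)
  qed simp
qed

text \<open>E is a smoothed step of height c, G a smoothed ramp that is affine with slope c beyond
  a. The mass c is left unnormalised and is divided out by the user of the lemma.\<close>

lemma bump_exists: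
  assumes a: "a > 0"
  obtains \<eta> E G :: "real \<Rightarrow> real" and c where
    "\<And>n. times_differentiable n G" "\<And>x. (G has_real_derivative E x) (at x)" "\<And>x. (E has_real_derivative \<eta> x) (at x)"
    "\<And>x. 0 \<le> \<eta> x" "\<And>x. x \<le> 0 \<or> a \<le> x \<Longrightarrow> \<eta> x = 0" "c > 0" "\<And>x. 0 \<le> E x" "\<And>x. E x \<le> c"
    "\<And>x. x \<le> 0 \<Longrightarrow> G x = 0" "\<And>x. x \<ge> a \<Longrightarrow> G x = G a + c * (x - a)"
    "has_bochner_integral lborel \<eta> c" "\<And>x. isCont \<eta> x"
proof -
  define \<eta> where "\<eta> x = flat_exp [:1:] x * flat_exp [:1:] ((- 1) * x + a)" for x
  have sm: "times_differentiable n \<eta>" for n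
    unfolding \<eta>_def by (intro times_differentiable_mult times_differentiable_flat_exp times_differentiable_affine)
  obtain \<eta>' where "\<And>x. (\<eta> has_real_derivative \<eta>' x) (at x)" using sm[of "Suc 0"] by auto
  then have cont: "isCont \<eta> x" for x using DERIV_isCont by blast
  have nonneg: "0 \<le> \<eta> x" for x unfolding \<eta>_def flat_exp_def by auto
  have pos: "0 < \<eta> x" if "0 < x" "x < a" for x unfolding \<eta>_def flat_exp_def using that by auto
  have zero: "\<eta> x = 0" if "x \<le> 0 \<or> a \<le> x" for x unfolding \<eta>_def flat_exp_def using that by auto
  obtain E where E: "\<And>x. (E has_real_derivative \<eta> x) (at x)" "E 0 = 0" using antiderivative_exists[of \<eta>] cont by blast
  obtain G where G: "\<And>x. (G has_real_derivative E x) (at x)" "G 0 = 0"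
    using antiderivative_exists[of E] DERIV_isCont[OF E(1)] by blast
  have Emono: "E x \<le> E y" if "x \<le> y" for x y
    by (rule DERIV_nonneg_imp_nondecreasing[OF that]) (use E nonneg in blast)
  have const: "F x = F y" if "x \<le> y" "\<And>t. x \<le> t \<Longrightarrow> t \<le> y \<Longrightarrow> (F has_real_derivative 0) (at t)" for F :: "real \<Rightarrow> real" and x y
  proof (rule order_antisym)
    show "F x \<le> F y" by (rule DERIV_nonneg_imp_nondecreasing[OF that(1)]) (use that(2) in blast)
    show "F y \<le> F x" by (rule DERIV_nonpos_imp_nonincreasing[OF that(1)]) (use that(2) in blast)
  qed
  have E0: "E x = 0" if "x \<le> 0" for x
  proof -
    have "E x = E 0"
    proof (rule const[OF that])
      show "(E has_real_derivative 0) (at t)" if "t \<le> 0" for t using E(1)[of t] zero[of t] that by simp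
    qed
    then show ?thesis using E(2) by simp
  qed
  have Ec: "E x = E a" if "x \<ge> a" for x
  proof (rule const[OF that, symmetric])
    show "(E has_real_derivative 0) (at t)" if "a \<le> t" for t using E(1)[of t] zero[of t] that by simp
  qed
  \<comment> \<open>Positivity of the mass: on the middle third both flat factors are positive, so E
    increases strictly.\<close>
  have "E (a / 3) < E (2 * a / 3)"
  proof (rule DERIV_pos_imp_increasing[where f=E])
    show "\<exists>y. (E has_real_derivative y) (at x) \<and> 0 < y" if "a / 3 \<le> x" "x \<le> 2 * a / 3" for x
      by (intro exI[of _ "\<eta> x"] conjI E(1) pos) (use that a in auto)
  qed (use a in auto)
  then have c: "E a > 0" using Emono[of "2 * a / 3" a] Emono[of 0 "a / 3"] E a by simp
  have El: "0 \<le> E x" "E x \<le> E a" for x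
  proof -
    show "0 \<le> E x" using E0[of x] Emono[of 0 x] E(2) by linarith
    show "E x \<le> E a" using Ec[of x] Emono[of x a] by linarith
  qed
  have G0: "G x = 0" if "x \<le> 0" for x
  proof -
    have "G x = G 0"
    proof (rule const[OF that])
      show "(G has_real_derivative 0) (at t)" if "t \<le> 0" for t using G(1)[of t] E0[of t] that by simp
    qed
    then show ?thesis using G by simp
  qed
  have Ga: "G x = G a + E a * (x - a)" if "x \<ge> a" for x
  proof -
    have "G a - E a * (a - a) = G x - E a * (x - a)"
    proof (rule const[OF that, of "\<lambda>x. G x - E a * (x - a)"])
      fix t assume "a \<le> t"
      then show "((\<lambda>x. G x - E a * (x - a)) has_real_derivative 0) (at t)"
        using Ec[of t] by (auto intro!: derivative_eq_intros G(1))
    qed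
    then show ?thesis by simp
  qed
  have smG: "times_differentiable n G" for n
  proof (rule times_differentiable_SucD, rule times_differentiable_SucD)
    show "times_differentiable (Suc (Suc n)) G" using G E sm[of n] by auto
  qed
  have "has_bochner_integral lborel (\<lambda>x. indicator {0..a} x *\<^sub>R \<eta> x) (E a - E 0)"
    using E(1) cont a by (intro has_bochner_integral_FTC_Icc)
      (auto simp: has_real_derivative_iff_has_vector_derivative[symmetric] intro: has_field_derivative_at_within continuous_at_imp_continuous_on)
  moreover have "(\<lambda>x. indicator {0..a} x *\<^sub>R \<eta> x) = \<eta>"
  proof
    show "indicator {0..a} x *\<^sub>R \<eta> x = \<eta> x" for x
      using zero[of x] by (cases "x \<le> 0 \<or> a \<le> x") (auto simp: indicator_def)
  qed
  ultimately have int: "has_bochner_integral lborel \<eta> (E a)" using E by simp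
  show ?thesis by (rule that[OF smG G(1) E(1) nonneg zero c El G0 Ga int cont])
qed

text \<open>The test function is a mollified second antiderivative of a difference of two dipoles; both its
  moments of order 0 and 1 cancel, so that it has compact support.\<close>

lemma second_difference_bound:
  assumes p: "second_derivative_finite_measure p" and cont: "\<And>x. isCont p x"
  obtains M where "M \<ge> 0" "\<And>x z h. h \<ge> 0 \<Longrightarrow> \<bar>(p (x + h) - p x) - (p (z + h) - p z)\<bar> \<le> M * h"
proof -
  obtain \<mu> \<nu> :: "real measure" where \<mu>: "finite_measure \<mu>" "sets \<mu> = sets borel" and \<nu>: "finite_measure \<nu>" "sets \<nu> = sets borel"
    and eq: "\<And>\<phi>. test_function UNIV \<phi> \<Longrightarrow>
          (LINT x|lborel. p x * deriv (deriv \<phi>) x) = (LINT x|\<mu>. \<phi> x) - (LINT x|\<nu>. \<phi> x)"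
    using p unfolding second_derivative_finite_measure_def by blast
  define M where "M = measure \<mu> (space \<mu>) + measure \<nu> (space \<nu>)"
  have bnd: "\<bar>LINT x|\<kappa>. \<phi> x\<bar> \<le> B * measure \<kappa> (space \<kappa>)"
    if \<kappa>: "finite_measure \<kappa>" "sets \<kappa> = sets borel" and c: "continuous_on UNIV \<phi>" and B: "\<And>x. \<bar>\<phi> x\<bar> \<le> B" for \<kappa> :: "real measure" and \<phi> B
  proof -
    interpret finite_measure \<kappa> by (rule \<kappa>)
    have "\<phi> \<in> borel_measurable borel" using c by (rule borel_measurable_continuous_onI)
    then have m: "\<phi> \<in> borel_measurable \<kappa>" using measurable_cong_sets[OF \<kappa>(2) refl] by blast
    have i: "integrable \<kappa> \<phi>" by (rule integrable_const_bound[where B=B]) (use B m in auto)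
    have "\<bar>LINT x|\<kappa>. \<phi> x\<bar> \<le> (LINT x|\<kappa>. \<bar>\<phi> x\<bar>)" by (rule integral_abs_bound)
    also have "\<dots> \<le> (LINT x|\<kappa>. B)" by (rule integral_mono) (use i B in auto)
    finally show ?thesis by (simp add: mult.commute)
  qed
  have main: "\<bar>(p (x + h) - p x) - (p (z + h) - p z)\<bar> \<le> M * h + 4 * \<tau>" if h: "h \<ge> 0" and \<tau>: "\<tau> > 0" for x z h \<tau>
  proof -
    have loc: "\<exists>d>0. \<forall>y. \<bar>y - w\<bar> < d \<longrightarrow> \<bar>p y - p w\<bar> < \<tau>" for w
      using cont[of w] \<tau> unfolding continuous_at_eps_delta by (auto simp: dist_real_def)
    obtain d where d: "\<And>w. d w > 0" "\<And>w y. \<bar>y - w\<bar> < d w \<Longrightarrow> \<bar>p y - p w\<bar> < \<tau>" using loc by metis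
    \<comment> \<open>The width of the mollifier: half the smallest of the four radii, so that over
      each bump p stays within \<tau> of its value at the corresponding point.\<close>
    define a where "a = Min {d x, d (x + h), d z, d (z + h)} / 2"
    have a: "a > 0" "a < d x" "a < d (x + h)" "a < d z" "a < d (z + h)"
    proof -
      let ?S = "{d x, d (x + h), d z, d (z + h)}"
      have pos: "0 < Min ?S" using d(1) by simp
      have le: "Min ?S \<le> d x" "Min ?S \<le> d (x + h)" "Min ?S \<le> d z" "Min ?S \<le> d (z + h)"
        by (rule Min_le; simp)+
      show "a > 0" "a < d x" "a < d (x + h)" "a < d z" "a < d (z + h)" using pos le unfolding a_def by linarith+
    qed
    obtain \<eta> E G :: "real \<Rightarrow> real" and c where sm: "\<And>n. times_differentiable n G"
      and dG: "\<And>x. (G has_real_derivative E x) (at x)" and dE: "\<And>x. (E has_real_derivative \<eta> x) (at x)"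
      and nn: "\<And>x. 0 \<le> \<eta> x" and zero: "\<And>x. x \<le> 0 \<or> a \<le> x \<Longrightarrow> \<eta> x = 0" and c: "c > 0" and E0: "\<And>x. 0 \<le> E x" and Ec: "\<And>x. E x \<le> c"
      and G0: "\<And>x. x \<le> 0 \<Longrightarrow> G x = 0" and Ga: "\<And>x. x \<ge> a \<Longrightarrow> G x = G a + c * (x - a)"
      and int: "has_bochner_integral lborel \<eta> c" and \<eta>c: "\<And>x. isCont \<eta> x"
      using bump_exists[OF a(1)] by metis
    define I where "I w = (LINT y|lborel. p y * \<eta> (y - w))" for w
    have \<eta>m[measurable]: "\<eta> \<in> borel_measurable borel" 
      using \<eta>c by (intro borel_measurable_continuous_onI) (simp add: continuous_at_imp_continuous_on)
    have pm[measurable]: "p \<in> borel_measurable borel" 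
      using cont by (intro borel_measurable_continuous_onI) (simp add: continuous_at_imp_continuous_on)
    have \<eta>w: "has_bochner_integral lborel (\<lambda>y. \<eta> (y - w)) c" for w
      using int lborel_has_bochner_integral_real_affine_iff[of 1 "\<eta>" c "-w"] by simp
    have near: "integrable lborel (\<lambda>y. p y * \<eta> (y - w)) \<and> \<bar>I w - c * p w\<bar> \<le> \<tau> * c" if aw: "a < d w" for w
    proof -
      have le: "\<bar>(p y - p w) * \<eta> (y - w)\<bar> \<le> \<tau> * \<eta> (y - w)" for y
      proof (cases "w < y \<and> y < w + a")
        case True
        then have "\<bar>p y - p w\<bar> \<le> \<tau>" using d(2)[of y w] aw by auto
        then show ?thesis unfolding abs_mult using nn[of "y - w"] by (simp add: mult_right_mono)
      next
        case False
        then show ?thesis using zero[of "y - w"] by auto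
      qed
      have i1: "integrable lborel (\<lambda>y. \<tau> * \<eta> (y - w))" using \<eta>w[of w] by (auto simp: has_bochner_integral_iff)
      have i2: "integrable lborel (\<lambda>y. (p y - p w) * \<eta> (y - w))"
      proof (rule Bochner_Integration.integrable_bound[OF i1])
        show "AE y in lborel. norm ((p y - p w) * \<eta> (y - w)) \<le> norm (\<tau> * \<eta> (y - w))"
        proof (rule AE_I2)
          fix y show "norm ((p y - p w) * \<eta> (y - w)) \<le> norm (\<tau> * \<eta> (y - w))"
            using le[of y] unfolding real_norm_def by linarith
        qed
      qed measurable
      have i3: "integrable lborel (\<lambda>y. p w * \<eta> (y - w))" using \<eta>w[of w] by (auto simp: has_bochner_integral_iff)
      have i4: "integrable lborel (\<lambda>y. p y * \<eta> (y - w))"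
        using Bochner_Integration.integrable_add[OF i2 i3] by (simp add: algebra_simps)
      have "I w - c * p w = (LINT y|lborel. (p y - p w) * \<eta> (y - w))"
        using Bochner_Integration.integral_diff[OF i4 i3] has_bochner_integral_integral_eq[OF \<eta>w[of w]]
        by (simp add: I_def algebra_simps)
      also have "\<bar>\<dots>\<bar> \<le> (LINT y|lborel. \<bar>(p y - p w) * \<eta> (y - w)\<bar>)" by (rule integral_abs_bound)
      also have "\<dots> \<le> (LINT y|lborel. \<tau> * \<eta> (y - w))" by (rule integral_mono) (use i1 i2 le in auto)
      also have "\<dots> = \<tau> * c" using has_bochner_integral_integral_eq[OF \<eta>w[of w]] by simp
      finally show ?thesis using i4 by simp
    qed
    \<comment> \<open>G'' is the bump, so the second derivative of \<phi> is the sum of four bumps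
      at x + h, x, z + h and z, with the signs of the claim.\<close>
    define \<phi> where "\<phi> y = (G (1 * y + (- x - h)) + (- 1) * G (1 * y + (- x))) + (- 1) * (G (1 * y + (- z - h)) + (- 1) * G (1 * y + (- z)))" for y
    define \<phi>1 where "\<phi>1 y = (E (1 * y + (- x - h)) + (- 1) * E (1 * y + (- x))) + (- 1) * (E (1 * y + (- z - h)) + (- 1) * E (1 * y + (- z)))" for y
    have ch: "((\<lambda>y. F (1 * y + b)) has_real_derivative F' (1 * y + b)) (at y)" if "\<And>x. (F has_real_derivative F' x) (at x)" for F F' :: "real \<Rightarrow> real" and b y
    proof -
      have "((\<lambda>y. 1 * y + b) has_real_derivative 1) (at y)" by (auto intro!: derivative_eq_intros)
      then show ?thesis using DERIV_chain2[OF that, of "\<lambda>y. 1 * y + b" 1 y UNIV] by simp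
    qed
    have "(\<phi> has_real_derivative \<phi>1 y) (at y)" for y
      unfolding \<phi>_def \<phi>1_def by (intro DERIV_add DERIV_cmult ch dG)
    then have d1: "deriv \<phi> = \<phi>1" using DERIV_imp_deriv by blast
    have "(\<phi>1 has_real_derivative (\<eta> (1 * y + (- x - h)) + (- 1) * \<eta> (1 * y + (- x))) + (- 1) * (\<eta> (1 * y + (- z - h)) + (- 1) * \<eta> (1 * y + (- z)))) (at y)" for y
      unfolding \<phi>1_def by (intro DERIV_add DERIV_cmult ch dE)
    then have d2: "deriv (deriv \<phi>) y = (\<eta> (y - (x + h)) - \<eta> (y - x)) - (\<eta> (y - (z + h)) - \<eta> (y - z))" for y
      unfolding d1 by (subst DERIV_imp_deriv) (auto simp: algebra_simps)
    have sm\<phi>: "times_differentiable n \<phi>" for n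
      unfolding \<phi>_def by (intro times_differentiable_add times_differentiable_mult times_differentiable_const times_differentiable_affine sm)
    define lo where "lo = min x z"
    define hi where "hi = max x z + h + a"
    have supp: "\<phi> y = 0" if "y < lo \<or> y > hi" for y
    proof (cases "y < lo")
      case True
      then show ?thesis unfolding \<phi>_def lo_def using h by (simp add: G0)
    next
      case False
      \<comment> \<open>Beyond all four bumps each G is affine with slope c, and the alternating sum
        of the four affine functions vanishes.\<close>
      then have y: "y > hi" using that by simp
      have "G (1 * y + (- w)) = G a + c * (y - w - a)" if "w \<le> max x z + h" for w
        using Ga[of "1 * y + (- w)"] y that unfolding hi_def by (simp add: algebra_simps)
      moreover have "x \<le> max x z + h" "x + h \<le> max x z + h" "z \<le> max x z + h" "z + h \<le> max x z + h"
        using h by auto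
      ultimately have "G (1 * y + (- x)) = G a + c * (y - x - a)" "G (1 * y + (- (x + h))) = G a + c * (y - (x + h) - a)"
        "G (1 * y + (- z)) = G a + c * (y - z - a)" "G (1 * y + (- (z + h))) = G a + c * (y - (z + h) - a)" by blast+
      then show ?thesis unfolding \<phi>_def by (simp add: algebra_simps)
    qed
    have "closure {y. \<phi> y \<noteq> 0} \<subseteq> {lo..hi}"
      by (rule closure_minimal) (use supp in force)+
    then have "compact (closure {y. \<phi> y \<noteq> 0})"
      by (meson bounded_closed_interval bounded_subset closed_closure compact_eq_bounded_closed)
    then have tf: "test_function UNIV \<phi>"
      unfolding test_function_def using times_differentiable_iterated_deriv[OF sm\<phi>] by blast
    \<comment> \<open>As 0 \<le> E \<le> c, both brackets of \<phi> lie in the same interval of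
      length c h; hence the bound c h instead of 2 c h.\<close>
    have Gh: "0 \<le> G t - G (t - h) \<and> G t - G (t - h) \<le> c * h" for t
    proof -
      have "G (t - h) \<le> G t" by (rule DERIV_nonneg_imp_nondecreasing) (use h dG E0 in auto)
      moreover have Gc: "((\<lambda>t. c * t - G t) has_real_derivative c - E s) (at s) \<and> 0 \<le> c - E s" for s
        using Ec[of s] by (auto intro!: derivative_eq_intros dG)
      have "c * t - G t \<ge> c * (t - h) - G (t - h)"
        by (rule DERIV_nonneg_imp_nondecreasing[where f="\<lambda>t. c * t - G t"])
           (use h Gc in \<open>auto intro!: exI[of _ "c - E _"]\<close>)
      ultimately show ?thesis by (simp add: algebra_simps)
    qed
    have \<phi>B: "\<bar>\<phi> y\<bar> \<le> c * h" for y
      using Gh[of "y - x"] Gh[of "y - z"] unfolding \<phi>_def abs_le_iff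
      by (simp add: algebra_simps)
    have \<phi>c: "continuous_on UNIV \<phi>"
      using \<open>\<And>y. (\<phi> has_real_derivative \<phi>1 y) (at y)\<close> DERIV_isCont by (blast intro: continuous_at_imp_continuous_on)
    \<comment> \<open>The tested identity bounds the mollified difference by c h M; replacing the
      four averages by c times point values costs another 4 \<tau> c.\<close>
    have "(LINT y|lborel. p y * deriv (deriv \<phi>) y) = (I (x + h) - I x) - (I (z + h) - I z)"
      unfolding d2 I_def right_diff_distrib using near a by simp
    then have "\<bar>(I (x + h) - I x) - (I (z + h) - I z)\<bar> \<le> c * h * M"
      using eq[OF tf] bnd[OF \<mu> \<phi>c \<phi>B] bnd[OF \<nu> \<phi>c \<phi>B] unfolding M_def distrib_left by linarith
    then have "\<bar>c * ((p (x + h) - p x) - (p (z + h) - p z))\<bar> \<le> c * h * M + 4 * (\<tau> * c)"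
      using near[OF a(2)] near[OF a(3)] near[OF a(4)] near[OF a(5)]
      unfolding right_diff_distrib by linarith
    also have "c * h * M + 4 * (\<tau> * c) = c * (M * h + 4 * \<tau>)" by (simp add: algebra_simps)
    finally show ?thesis using c unfolding abs_mult by (simp only: abs_of_pos mult_le_cancel_left_pos)
  qed
  show ?thesis
  proof (rule that)
    show "M \<ge> 0" unfolding M_def by simp
    show "\<bar>(p (x + h) - p x) - (p (z + h) - p z)\<bar> \<le> M * h" if "h \<ge> 0" for x z h
    proof (rule field_le_epsilon)
      fix \<tau> :: real assume "\<tau> > 0"
      then show "\<bar>(p (x + h) - p x) - (p (z + h) - p z)\<bar> \<le> M * h + \<tau>" using main[OF that, of "\<tau> / 4" x z] by simp
    qed
  qed
qed

text \<open>Increments of equal length h differ by at most M h anywhere on the line. An increment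
  larger than M h would force increments of one sign, bounded away from zero, all along the far
  left, where p is bounded by B.\<close>

lemma lipschitz_of_second_derivative:
  assumes p: "second_derivative_finite_measure p" and cont: "\<And>x. isCont p x"
    and B: "\<And>x. x < \<xi> \<Longrightarrow> \<bar>p x\<bar> \<le> B"
  obtains M where "M \<ge> 0" "\<And>x y. \<bar>p x - p y\<bar> \<le> M * \<bar>x - y\<bar>"
proof -
  obtain M where M: "M \<ge> 0" "\<And>x z h. h \<ge> 0 \<Longrightarrow> \<bar>(p (x + h) - p x) - (p (z + h) - p z)\<bar> \<le> M * h"
    using second_difference_bound[OF p cont] by metis
  have inc: "\<bar>p (x + h) - p x\<bar> \<le> M * h" if h: "h \<ge> 0" for x h
  proof -
    define A where "A = p (x + h) - p x"
    define w where "w = \<xi> - 1"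
    have w: "\<bar>p (w - t)\<bar> \<le> B" if "t \<ge> 0" for t using B[of "w - t"] that unfolding w_def by simp
    \<comment> \<open>n adjacent increments left of w telescope to p w - p (w - n h), at most 2 B in
      modulus, while each differs from A by at most M h. Large n forces \<bar>A\<bar> \<le> M
      h.\<close>
    have sum: "\<bar>real n * A - (p w - p (w - real n * h))\<bar> \<le> real n * (M * h)" for n
    proof (induction n)
      case (Suc n)
      have "\<bar>A - (p (w - real n * h) - p (w - real (Suc n) * h))\<bar> \<le> M * h"
        using M(2)[OF h, of x "w - real (Suc n) * h"] unfolding A_def by (simp add: algebra_simps)
      then show ?case using Suc by (simp only: of_nat_Suc distrib_right mult_1)
    qed simp
    have "real n * (\<bar>A\<bar> - M * h) \<le> 2 * B" for n
    proof -
      have "real n * \<bar>A\<bar> = \<bar>real n * A\<bar>" by (simp add: abs_mult)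
      moreover have "\<bar>p w\<bar> \<le> B" "\<bar>p (w - real n * h)\<bar> \<le> B" using w[of 0] w[of "real n * h"] h by auto
      ultimately show ?thesis using sum[of n] unfolding right_diff_distrib by linarith
    qed
    then have "\<not> 0 < \<bar>A\<bar> - M * h"
      using reals_Archimedean3[of "\<bar>A\<bar> - M * h"] by (metis not_less)
    then show ?thesis unfolding A_def by simp
  qed
  show ?thesis
  proof (rule that[OF M(1)])
    show "\<bar>p x - p y\<bar> \<le> M * \<bar>x - y\<bar>" for x y
    proof (cases "y \<le> x")
      case True
      then show ?thesis using inc[of "x - y" y] by simp
    next
      case False
      then show ?thesis using inc[of "y - x" x] by (simp add: abs_minus_commute)
    qed
  qed
qed

text \<open>The jump 2 of u is that of the sign function, so the one-sided limits l + 1 and r - 1 of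
  the difference agree.\<close>

lemma p_of_admissible:
  assumes "admissible_state u \<xi>"
  shows "isCont (p_of u \<xi>) x" "x < \<xi> \<Longrightarrow> \<bar>p_of u \<xi> x\<bar> \<le> 1"
proof -
  obtain l r where l: "(u \<longlongrightarrow> l) (at_left \<xi>)" and r: "(u \<longlongrightarrow> r) (at_right \<xi>)" and lr: "r - l = 2"
    and cl: "continuous_on {..<\<xi>} u" and cr: "continuous_on {\<xi><..} u"
    and b: "\<And>x. x \<le> \<xi> \<Longrightarrow> -2 \<le> u x \<and> u x \<le> 0"
    using assms unfolding admissible_state_def by blast
  show "x < \<xi> \<Longrightarrow> \<bar>p_of u \<xi> x\<bar> \<le> 1" using b[of x] unfolding p_of_def by auto
  have lim: "((\<lambda>y. u y - sgn (y - \<xi>)) \<longlongrightarrow> l + 1) (at \<xi>)"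
  proof (rule filterlim_split_at)
    have "((\<lambda>y. u y + 1) \<longlongrightarrow> l + 1) (at_left \<xi>)" by (intro tendsto_intros l)
    then show "((\<lambda>y. u y - sgn (y - \<xi>)) \<longlongrightarrow> l + 1) (at_left \<xi>)"
      by (rule Lim_transform_eventually) (auto simp: eventually_at_filter)
    have "((\<lambda>y. u y - 1) \<longlongrightarrow> r - 1) (at_right \<xi>)" by (intro tendsto_intros r)
    moreover have "r - 1 = l + 1" using lr by simp
    ultimately have "((\<lambda>y. u y - 1) \<longlongrightarrow> l + 1) (at_right \<xi>)" by simp
    then show "((\<lambda>y. u y - sgn (y - \<xi>)) \<longlongrightarrow> l + 1) (at_right \<xi>)"
      by (rule Lim_transform_eventually) (auto simp: eventually_at_filter)
  qed
  then have "p_of u \<xi> \<xi> = l + 1" unfolding p_of_def by (simp add: tendsto_Lim)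
  moreover have "(p_of u \<xi> \<longlongrightarrow> l + 1) (at \<xi>)"
    by (rule Lim_transform_eventually[OF lim]) (auto simp: eventually_at_filter p_of_def)
  ultimately have at: "isCont (p_of u \<xi>) \<xi>" unfolding isCont_def by simp
  have "continuous_on {..<\<xi>} (\<lambda>y. u y + 1)" "continuous_on {\<xi><..} (\<lambda>y. u y - 1)"
    by (intro continuous_intros cl cr)+
  then have "continuous_on {..<\<xi>} (p_of u \<xi>)" "continuous_on {\<xi><..} (p_of u \<xi>)"
    by (auto simp: p_of_def elim!: continuous_on_eq)
  then show "isCont (p_of u \<xi>) x"
    using at continuous_on_eq_continuous_at[of "{..<\<xi>}" "p_of u \<xi>"] continuous_on_eq_continuous_at[of "{\<xi><..}" "p_of u \<xi>"]
    by (cases x \<xi> rule: linorder_cases) auto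
qed

section \<open>Weak differentiability of the limit interface\<close>

lemma in_LinfI:
  assumes "f \<in> borel_measurable M" "\<And>x. x \<in> space M \<Longrightarrow> \<bar>f x\<bar> \<le> B"
  shows "in_Linf M f"
proof -
  have "esssup M (\<lambda>x. ennreal \<bar>f x\<bar>) \<le> ennreal B"
    by (rule esssup_I) (use assms in \<open>auto intro!: AE_I2 ennreal_leI\<close>)
  then show ?thesis using assms(1) unfolding in_Linf_def by (auto intro: le_less_trans)
qed

text \<open>Lebesgue measure is identified through open intervals (\<open>lborel_eqI\<close>),
  whereas Stieltjes measures are given on half-open ones; continuity of H removes the mass of the
  endpoint.\<close>

lemma emeasure_interval_measure_Ioo:
  assumes m: "\<And>x y. x \<le> y \<Longrightarrow> H x \<le> H y" and c: "continuous_on UNIV H" and lu: "l \<le> u"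
  shows "emeasure (interval_measure H) {l<..<u} = ennreal (H u - H l)"
proof (cases "l = u")
  case False
  then have lu': "l < u" using lu by simp
  have cr: "continuous (at_right a) H" for a
    using c by (simp add: continuous_on_eq_continuous_within continuous_at_imp_continuous_at_within)
  have "emeasure (interval_measure H) {u..u} = ennreal (H u - H u)"
    by (rule emeasure_interval_measure_Icc) (use m c continuous_on_subset in auto)
  then have "{u} \<in> null_sets (interval_measure H)" by (auto simp: null_sets_def)
  moreover have "{l<..u} = {l<..<u} \<union> {u}" using lu' by auto
  ultimately have "emeasure (interval_measure H) {l<..u} = emeasure (interval_measure H) {l<..<u}"
    using emeasure_Un_null_set[of "{l<..<u}" "interval_measure H" "{u}"] by simp
  then show ?thesis using emeasure_interval_measure_Ioc[OF lu m cr] by simp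
qed auto

text \<open>The Stieltjes measures of \<open>H\<close> and of \<open>x - H x\<close> add up to the Lebesgue measure.\<close>

lemma interval_measure_density:
  fixes H :: "real \<Rightarrow> real"
  assumes m: "\<And>x y. x \<le> y \<Longrightarrow> H x \<le> H y" and l: "\<And>x y. x \<le> y \<Longrightarrow> H y - H x \<le> y - x"
  obtains w where "w \<in> borel_measurable borel" "\<And>x. 0 \<le> w x" "\<And>x. w x \<le> (1::real)"
    "\<And>a b. a \<le> b \<Longrightarrow> (LINT t|lborel. w t * indicator {a<..b} t) = H b - H a"
proof -
  define G where "G x = x - H x" for x
  have abs: "\<bar>H x - H y\<bar> \<le> \<bar>x - y\<bar>" for x y using m[of x y] m[of y x] l[of x y] l[of y x] by linarith
  have cH: "continuous_on UNIV H"
  proof (rule continuous_at_imp_continuous_on, intro ballI)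
    fix x show "isCont H x" unfolding continuous_at_eps_delta
      using abs le_less_trans by (metis dist_real_def)
  qed
  have cG: "continuous_on UNIV G" unfolding G_def by (intro continuous_intros cH)
  have mG: "x \<le> y \<Longrightarrow> G x \<le> G y" for x y using l[of x y] unfolding G_def by simp
  have cr: "continuous (at_right a) F" if "continuous_on UNIV F" for F :: "real \<Rightarrow> real" and a
    using that by (simp add: continuous_on_eq_continuous_within continuous_at_imp_continuous_at_within)
  define \<mu> where "\<mu> = interval_measure H"
  define \<nu> where "\<nu> = interval_measure G"
  have s: "sets \<mu> = sets borel" "sets \<nu> = sets borel" unfolding \<mu>_def \<nu>_def by auto
  define \<rho> where "\<rho> = measure_of UNIV (sets borel) (\<lambda>A::real set. emeasure \<mu> A + emeasure \<nu> A)"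
  have \<rho>: "emeasure \<rho> A = emeasure \<mu> A + emeasure \<nu> A" if "A \<in> sets borel" for A
    unfolding \<rho>_def
  proof (rule emeasure_measure_of_sigma)
    show "sigma_algebra UNIV (sets (borel :: real measure))" using sets.sigma_algebra_axioms[of "borel :: real measure"] by simp
    show "positive (sets borel) (\<lambda>A. emeasure \<mu> A + emeasure \<nu> A)" unfolding positive_def by simp
    show "countably_additive (sets borel) (\<lambda>A. emeasure \<mu> A + emeasure \<nu> A)"
    proof (rule countably_additiveI)
      fix A :: "nat \<Rightarrow> real set" assume A: "range A \<subseteq> sets borel" "disjoint_family A"
      have "(\<Sum>i. emeasure \<mu> (A i) + emeasure \<nu> (A i)) = (\<Sum>i. emeasure \<mu> (A i)) + (\<Sum>i. emeasure \<nu> (A i))"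
        by (rule suminf_add[symmetric]) auto
      also have "\<dots> = emeasure \<mu> (\<Union> (range A)) + emeasure \<nu> (\<Union> (range A))"
        using suminf_emeasure[of A \<mu>] suminf_emeasure[of A \<nu>] A s by simp
      finally show "(\<Sum>i. emeasure \<mu> (A i) + emeasure \<nu> (A i)) = emeasure \<mu> (\<Union> (range A)) + emeasure \<nu> (\<Union> (range A))" .
    qed
  qed (use that in auto)
  have "lborel = \<rho>"
  proof (rule lborel_eqI)
    show "sets \<rho> = sets borel" unfolding \<rho>_def using sets.sigma_sets_eq[of "borel :: real measure"] by simp
    fix l u :: real assume "\<And>b. b \<in> Basis \<Longrightarrow> l \<bullet> b \<le> u \<bullet> b"
    then have lu: "l \<le> u" by simp
    have "emeasure \<rho> {l<..<u} = ennreal (H u - H l) + ennreal (G u - G l)"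
      using emeasure_interval_measure_Ioo[OF m cH lu] emeasure_interval_measure_Ioo[OF mG cG lu]
      by (simp add: \<rho> \<mu>_def \<nu>_def)
    also have "\<dots> = ennreal (u - l)"
      using m[OF lu] mG[OF lu] by (subst ennreal_plus[symmetric]) (auto simp: G_def)
    finally show "emeasure \<rho> (box l u) = ennreal (\<Prod>b\<in>Basis. (u - l) \<bullet> b)" by (simp add: box_real)
  qed
  then have sum: "emeasure lborel A = emeasure \<mu> A + emeasure \<nu> A" if "A \<in> sets borel" for A
    using \<rho>[OF that] by simp
  have "absolutely_continuous lborel \<mu>" "absolutely_continuous lborel \<nu>"
    unfolding absolutely_continuous_def null_sets_def using sum s by auto
  then obtain f g where f: "f \<in> borel_measurable lborel" "density lborel f = \<mu>" and g: "g \<in> borel_measurable lborel" "density lborel g = \<nu>"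
    using sigma_finite_measure.Radon_Nikodym[OF lborel.sigma_finite_measure_axioms, of \<mu>]
      sigma_finite_measure.Radon_Nikodym[OF lborel.sigma_finite_measure_axioms, of \<nu>] s by auto
  have [measurable]: "f \<in> borel_measurable borel" "g \<in> borel_measurable borel" using f g by auto
  \<comment> \<open>The two densities add up to 1 almost everywhere, hence the first is at most 1:
    the Lipschitz bound in differential form.\<close>
  have "density lborel (\<lambda>x. f x + g x) = density lborel (\<lambda>x. 1)"
  proof (rule measure_eqI)
    fix A assume "A \<in> sets (density lborel (\<lambda>x. f x + g x))"
    then have [measurable]: "A \<in> sets borel" by simp
    have "emeasure (density lborel (\<lambda>x. f x + g x)) A = (\<integral>\<^sup>+x. f x * indicator A x + g x * indicator A x \<partial>lborel)"
      by (subst emeasure_density) (auto simp: distrib_right)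
    also have "\<dots> = emeasure (density lborel f) A + emeasure (density lborel g) A"
      by (subst nn_integral_add) (auto simp: emeasure_density)
    also have "\<dots> = emeasure lborel A" unfolding f g sum[OF \<open>A \<in> sets borel\<close>] ..
    finally show "emeasure (density lborel (\<lambda>x. f x + g x)) A = emeasure (density lborel (\<lambda>x. 1)) A"
      by (simp add: density_1)
  qed simp
  then have "AE x in lborel. f x + g x = 1"
    by (subst (asm) sigma_finite_measure.density_unique_iff[OF lborel.sigma_finite_measure_axioms]) auto
  then have f1: "AE x in lborel. f x \<le> 1"
    by eventually_elim (metis add_increasing2 order_refl zero_le)
  \<comment> \<open>Truncation at 1 changes f on a null set only and makes the bounds on w hold
    everywhere.\<close>
  define w where "w x = enn2real (min 1 (f x))" for x
  have wm[measurable]: "w \<in> borel_measurable borel" unfolding w_def by measurable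
  have w1: "w x \<le> 1" for x
  proof -
    have "enn2real (min 1 (f x)) \<le> enn2real 1" by (rule enn2real_mono) auto
    then show ?thesis unfolding w_def by simp
  qed
  have w0: "0 \<le> w x" for x unfolding w_def by simp
  have ew: "ennreal (w x) = min 1 (f x)" for x unfolding w_def by (rule ennreal_enn2real) (simp add: min_less_iff_disj)
  show ?thesis
  proof (rule that[OF wm w0 w1])
    fix a b :: real assume ab: "a \<le> b"
    have "(LINT t|lborel. w t * indicator {a<..b} t) = enn2real (\<integral>\<^sup>+t. ennreal (w t * indicator {a<..b} t) \<partial>lborel)"
      by (rule integral_eq_nn_integral) (use w0 in auto)
    also have "(\<integral>\<^sup>+t. ennreal (w t * indicator {a<..b} t) \<partial>lborel) = (\<integral>\<^sup>+t. f t * indicator {a<..b} t \<partial>lborel)"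
      by (rule nn_integral_cong_AE) (use f1 in \<open>eventually_elim, auto simp: ew indicator_def min_def\<close>)
    also have "\<dots> = emeasure \<mu> {a<..b}" unfolding f(2)[symmetric] by (simp add: emeasure_density)
    also have "\<dots> = ennreal (H b - H a)" unfolding \<mu>_def by (rule emeasure_interval_measure_Ioc[OF ab m cr[OF cH]])
    finally show "(LINT t|lborel. w t * indicator {a<..b} t) = H b - H a" using m[OF ab] by simp
  qed
qed

lemma lebesgue_on_integral_eq:
  fixes f :: "real \<Rightarrow> real"
  assumes "f \<in> borel_measurable borel"
  shows "(LINT t|lebesgue_on {a..b}. f t) = (LINT t|lborel. indicator {a..b} t * f t)"
  using assms by (subst integral_restrict_space) (auto simp: integral_completion)

text \<open>The weak derivative is - L w, with w the density belonging to the increasing 1-Lipschitz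
  function H = - F / L. Integration by parts is Fubini for w(t) \<phi>'(s) on the triangle 0 < t
  \<le> s \<le> T.\<close>

lemma decreasing_lipschitz_W1_inf:
  fixes F :: "real \<Rightarrow> real"
  assumes T: "T > 0" and L: "L > 0"
    and F: "\<And>x y. 0 \<le> x \<Longrightarrow> x \<le> y \<Longrightarrow> y \<le> T \<Longrightarrow> F y \<le> F x \<and> F x - F y \<le> L * (y - x)"
  shows "W1_inf 0 T F"
proof -
  \<comment> \<open>Projection onto [0, T] extends F to the line by its boundary values and keeps
    monotonicity and the Lipschitz bound.\<close>
  define cl where "cl t = max 0 (min T t)" for t
  define H where "H t = - F (cl t) / L" for t
  have cl: "0 \<le> cl t" "cl t \<le> T" "s \<le> t \<Longrightarrow> cl s \<le> cl t" "s \<le> t \<Longrightarrow> cl t - cl s \<le> t - s" for s t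
    unfolding cl_def using T by auto
  have Hm: "H x \<le> H y" if "x \<le> y" for x y
    unfolding H_def using F[OF cl(1) cl(3)[OF that] cl(2)] L by (simp add: divide_right_mono)
  have Hl: "H y - H x \<le> y - x" if "x \<le> y" for x y
  proof -
    have "F (cl x) - F (cl y) \<le> L * (cl y - cl x)" using F[OF cl(1) cl(3)[OF that] cl(2)] by simp
    also have "\<dots> \<le> L * (y - x)" using cl(4)[OF that] L by (intro mult_left_mono) auto
    finally show ?thesis unfolding H_def using L by (simp add: field_simps)
  qed
  obtain w where wm[measurable]: "w \<in> borel_measurable borel" and w: "\<And>x. 0 \<le> w x" "\<And>x. w x \<le> (1::real)"
    and wH: "\<And>a b. a \<le> b \<Longrightarrow> (LINT t|lborel. w t * indicator {a<..b} t) = H b - H a"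
    using interval_measure_density[OF Hm Hl] by metis
  have [measurable]: "H \<in> borel_measurable borel"
    by (rule borel_measurable_mono) (auto simp: mono_def Hm)
  \<comment> \<open>Not a derivative: \<open>F'\<close> is the extended F, a Borel function on the
    line that agrees with F on [0, T].\<close>
  define F' where "F' t = - L * H t" for t
  have F'm[measurable]: "F' \<in> borel_measurable borel" unfolding F'_def by measurable
  have FF': "F t = F' t" if "t \<in> {0..T}" for t using that L unfolding F'_def H_def cl_def by (cases "t = T") (auto simp: min_def max_def)
  have leb: "f \<in> borel_measurable (lebesgue_on {0..T})" if "f \<in> borel_measurable borel" for f :: "real \<Rightarrow> real"
    using that by (intro measurable_restrict_space1 measurable_completion) simp
  have "in_Linf (lebesgue_on {0..T}) F"
  proof (rule in_LinfI[where B="\<bar>F 0\<bar> + \<bar>F T\<bar>"])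
    have "F' \<in> borel_measurable (lebesgue_on {0..T})" by (rule leb[OF F'm])
    then show "F \<in> borel_measurable (lebesgue_on {0..T})"
      by (subst measurable_cong[where g=F']) (use FF' in auto)
    show "\<bar>F x\<bar> \<le> \<bar>F 0\<bar> + \<bar>F T\<bar>" if "x \<in> space (lebesgue_on {0..T})" for x
    proof -
      have "0 \<le> x" "x \<le> T" using that by auto
      then show ?thesis using F[of 0 x] F[of x T] by linarith
    qed
  qed
  moreover have "in_Linf (lebesgue_on {0..T}) (\<lambda>t. - L * w t)"
  proof (rule in_LinfI[where B=L])
    show "\<bar>- L * w x\<bar> \<le> L" for x using w[of x] L by (simp add: abs_mult mult_left_le)
  qed (intro leb, measurable)
  moreover have "(LINT t|lebesgue_on {0..T}. F t * deriv \<phi> t) = - (LINT t|lebesgue_on {0..T}. (- L * w t) * \<phi> t)"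
    if \<phi>: "test_function {0<..<T} \<phi>" for \<phi>
  proof -
    have dk: "(deriv ^^ k) \<phi> differentiable_on UNIV" for k using \<phi> unfolding test_function_def by blast
    have d0: "(\<phi> has_real_derivative deriv \<phi> t) (at t)" for t
      using dk[of 0] unfolding DERIV_deriv_iff_real_differentiable differentiable_on_def by simp
    have c1: "continuous_on UNIV (deriv \<phi>)"
      using dk[of 1] by (intro differentiable_imp_continuous_on) simp
    have c0: "continuous_on UNIV \<phi>" using dk[of 0] by (intro differentiable_imp_continuous_on) simp
    have [measurable]: "deriv \<phi> \<in> borel_measurable borel" "\<phi> \<in> borel_measurable borel"
      using c0 c1 borel_measurable_continuous_onI by blast+
    have z: "\<phi> t = 0" if "t \<notin> {0<..<T}" for t
    proof (rule ccontr)
      assume "\<phi> t \<noteq> 0"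
      then have "t \<in> closure {x. \<phi> x \<noteq> 0}" using closure_subset[of "{x. \<phi> x \<noteq> 0}"] by auto
      then show False using \<phi> that unfolding test_function_def by auto
    qed
    obtain B where B: "B \<ge> 0" "\<And>t. t \<in> {0..T} \<Longrightarrow> \<bar>deriv \<phi> t\<bar> \<le> B"
      using continuous_on_compact_bound[of "{0..T}" "deriv \<phi>"] continuous_on_subset[OF c1] by auto
    have ftc: "(LINT s|lborel. indicator {t..T} s * deriv \<phi> s) = - \<phi> t" if "t \<le> T" for t
    proof -
      have "(LINT s|lborel. deriv \<phi> s * indicator {t..T} s) = \<phi> T - \<phi> t"
        by (rule integral_FTC_Icc_real[OF that]) (use d0 c1 in \<open>auto simp: continuous_on_eq_continuous_at\<close>)
      then show ?thesis using z[of T] by (simp add: mult.commute)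
    qed
    define K where "K t s = indicator {0<..T} t * w t * (indicator {t..T} s * deriv \<phi> s)" for t s
    have K: "K t s = indicator {0..T} s * deriv \<phi> s * (w t * indicator {0<..s} t)" for t s
      unfolding K_def by (auto simp: indicator_def)

    have Km: "(\<lambda>(t, s). K t s) \<in> borel_measurable (lborel \<Otimes>\<^sub>M lborel)"
    proof -
      have "(\<lambda>(t, s). K t s) = (\<lambda>z. indicator {0..T} (snd z) * deriv \<phi> (snd z) * (w (fst z) * (if 0 < fst z \<and> fst z \<le> snd z then 1 else 0)))"
        unfolding K by (auto simp: indicator_def fun_eq_iff)
      then show ?thesis by simp
    qed
    have Ki: "integrable (lborel \<Otimes>\<^sub>M lborel) (\<lambda>(t, s). K t s)"
    proof (rule integrableI_bounded_set[where A="{0..T} \<times> {0..T}" and B=B])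
      show "emeasure (lborel \<Otimes>\<^sub>M lborel) ({0..T} \<times> {0..T}) < \<infinity>"
        using T by (subst lborel.emeasure_pair_measure_Times) (auto simp: ennreal_mult_less_top)
      have "\<bar>K t s\<bar> \<le> B" for t s
      proof -
        have "\<bar>w t * deriv \<phi> s\<bar> \<le> 1 * B" if "s \<in> {0..T}"
          unfolding abs_mult using w[of t] B(2)[OF that] by (intro mult_mono) auto
        then show ?thesis unfolding K_def using B(1) by (auto simp: indicator_def)
      qed
      then show "AE z in lborel \<Otimes>\<^sub>M lborel. z \<in> {0..T} \<times> {0..T} \<longrightarrow> norm (case z of (t, s) \<Rightarrow> K t s) \<le> B" by auto
      show "AE z in lborel \<Otimes>\<^sub>M lborel. z \<notin> {0..T} \<times> {0..T} \<longrightarrow> (case z of (t, s) \<Rightarrow> K t s) = 0"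
        by (rule AE_I2) (auto simp: K_def indicator_def)
    qed (use Km in auto)
    have fub: "(LINT s|lborel. LINT t|lborel. K t s) = (LINT t|lborel. LINT s|lborel. K t s)"
      using lborel_pair.Fubini_integral[OF Ki] by simp
    have right: "(LINT s|lborel. K t s) = - (indicator {0..T} t * (w t * \<phi> t))" for t
    proof (cases "t \<in> {0<..T}")
      case True
      then have "(LINT s|lborel. K t s) = w t * (LINT s|lborel. indicator {t..T} s * deriv \<phi> s)"
        unfolding K_def by simp
      also have "\<dots> = - (w t * \<phi> t)" using ftc[of t] True by simp
      finally show ?thesis using True by simp
    next
      case False
      then have "t = 0 \<or> t \<notin> {0..T}" by auto
      then show ?thesis using z[of 0] False unfolding K_def by auto
    qed
    have left: "(LINT t|lborel. K t s) = indicator {0..T} s * deriv \<phi> s * (H s - H 0)" for s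
    proof (cases "s \<in> {0..T}")
      case True
      then have "(LINT t|lborel. w t * indicator {0<..s} t) = H s - H 0" using wH[of 0 s] by simp
      then show ?thesis unfolding K by simp
    qed (simp add: K)
    have bi: "integrable lborel (\<lambda>s. indicator {0..T} s * deriv \<phi> s * k s)"
      if [measurable]: "k \<in> borel_measurable borel" and "\<And>s. \<bar>k s\<bar> \<le> D" for k :: "real \<Rightarrow> real" and D
    proof (rule integrableI_bounded_set[where A="{0..T}" and B="B * D"])
      have "\<bar>deriv \<phi> s * k s\<bar> \<le> B * D" if "s \<in> {0..T}" for s
        unfolding abs_mult using B that \<open>\<And>s. \<bar>k s\<bar> \<le> D\<close> by (intro mult_mono) auto
      then show "AE x in lborel. x \<in> {0..T} \<longrightarrow> norm (indicator {0..T} x * deriv \<phi> x * k x) \<le> B * D" by auto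
    qed (use T in auto)
    have Hb: "\<bar>H s\<bar> \<le> \<bar>H 0\<bar> + \<bar>H T\<bar>" for s
    proof -
      have "H 0 \<le> H (cl s)" "H (cl s) \<le> H T" using Hm cl by auto
      moreover have "H (cl s) = H s" unfolding H_def cl_def using T by (auto simp: min_def max_def)
      ultimately show ?thesis by linarith
    qed
    have "(LINT s|lborel. indicator {0..T} s * deriv \<phi> s * (H s - H 0))
       = (LINT s|lborel. indicator {0..T} s * deriv \<phi> s * H s) - (LINT s|lborel. indicator {0..T} s * deriv \<phi> s * H 0)"
      unfolding right_diff_distrib
      by (rule Bochner_Integration.integral_diff) (use bi[OF _ Hb] bi[of "\<lambda>_. H 0" "\<bar>H 0\<bar>"] in auto)
    \<comment> \<open>The integral of \<phi>' over [0, T] vanishes, so the constant H 0 left by the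
      inner integral drops out.\<close>
    moreover have "(LINT s|lborel. indicator {0..T} s * deriv \<phi> s * H 0) = 0"
      using ftc[of 0] z[of 0] T by simp
    ultimately have "(LINT s|lborel. indicator {0..T} s * deriv \<phi> s * H s) = (LINT t|lborel. - (indicator {0..T} t * (w t * \<phi> t)))"
      using fub unfolding left right by simp
    then have main: "(LINT s|lborel. indicator {0..T} s * (deriv \<phi> s * H s)) = - (LINT t|lborel. indicator {0..T} t * (w t * \<phi> t))"
      by (simp add: mult.assoc)
    have "(LINT t|lebesgue_on {0..T}. F t * deriv \<phi> t) = (LINT t|lebesgue_on {0..T}. F' t * deriv \<phi> t)"
      by (rule Bochner_Integration.integral_cong) (use FF' in auto)
    also have "\<dots> = (LINT t|lborel. indicator {0..T} t * (F' t * deriv \<phi> t))" by (rule lebesgue_on_integral_eq) measurable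
    also have "\<dots> = (LINT t|lborel. (- L) * (indicator {0..T} t * (deriv \<phi> t * H t)))"
      by (rule Bochner_Integration.integral_cong) (auto simp: F'_def)
    also have "\<dots> = - L * - (LINT t|lborel. indicator {0..T} t * (w t * \<phi> t))" unfolding main[symmetric] by simp
    also have "\<dots> = - (LINT t|lborel. (- L) * (indicator {0..T} t * (w t * \<phi> t)))" by simp
    also have "\<dots> = - (LINT t|lborel. indicator {0..T} t * ((- L * w t) * \<phi> t))" by (simp add: mult_ac)
    also have "\<dots> = - (LINT t|lebesgue_on {0..T}. (- L * w t) * \<phi> t)" by (subst lebesgue_on_integral_eq) auto
    finally show ?thesis .
  qed
  ultimately show ?thesis unfolding W1_inf_def by blast
qed

section \<open>Convergence\<close>

text \<open>The convergences below are uniform at every point, so null sets never enter. The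
  boundedness premise gives membership of each difference in the space, also for those k where it is
  not yet small.\<close>

lemma tendsto_LinfI:
  assumes m: "\<And>k. (\<lambda>x. F k x - f x) \<in> borel_measurable M"
    and b: "\<And>k. \<exists>B. \<forall>x\<in>space M. \<bar>F k x - f x\<bar> \<le> B"
    and c: "\<And>\<eta>. \<eta> > 0 \<Longrightarrow> \<forall>\<^sub>F k in sequentially. \<forall>x\<in>space M. \<bar>F k x - f x\<bar> \<le> \<eta>"
  shows "tendsto_Linf M F f"
  unfolding tendsto_Linf_def
proof
  show "\<forall>k. in_Linf M (\<lambda>x. F k x - f x)" using in_LinfI[OF m] b by blast
  show "(\<lambda>k. esssup M (\<lambda>x. ennreal \<bar>F k x - f x\<bar>)) \<longlonglongrightarrow> 0"
  proof (rule order_tendstoI)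
    fix a :: ennreal assume "0 < a"
    then obtain d where d: "0 < d" "d < a" using dense by blast
    then obtain \<eta> where \<eta>: "d = ennreal \<eta>" "0 \<le> \<eta>" by (cases d) auto
    then have "\<eta> > 0" using d by simp
    from c[OF this] show "\<forall>\<^sub>F k in sequentially. esssup M (\<lambda>x. ennreal \<bar>F k x - f x\<bar>) < a"
    proof eventually_elim
      case (elim k)
      have "esssup M (\<lambda>x. ennreal \<bar>F k x - f x\<bar>) \<le> d"
        unfolding \<eta>(1) by (rule esssup_I) (use m elim in \<open>auto intro!: AE_I2 ennreal_leI\<close>)
      then show ?case using d by simp
    qed
  qed simp
qed

lemma time_index:
  assumes e: "e > 0" and t: "t \<ge> 0"
  shows "real (nat \<lfloor>t / e\<^sup>2\<rfloor>) * e\<^sup>2 \<le> t" "t < real (nat \<lfloor>t / e\<^sup>2\<rfloor>) * e\<^sup>2 + e\<^sup>2"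
proof -
  have e2: "e\<^sup>2 > 0" using e by simp
  have q: "0 \<le> t / e\<^sup>2" using t e2 by simp
  have n: "real (nat \<lfloor>t / e\<^sup>2\<rfloor>) \<le> t / e\<^sup>2" "t / e\<^sup>2 < real (nat \<lfloor>t / e\<^sup>2\<rfloor>) + 1" using q by linarith+
  show "real (nat \<lfloor>t / e\<^sup>2\<rfloor>) * e\<^sup>2 \<le> t" using n(1) e2 by (simp add: pos_le_divide_eq)
  have "t < (real (nat \<lfloor>t / e\<^sup>2\<rfloor>) + 1) * e\<^sup>2" using n(2) e2 by (simp add: pos_divide_less_eq)
  then show "t < real (nat \<lfloor>t / e\<^sup>2\<rfloor>) * e\<^sup>2 + e\<^sup>2" by (simp add: algebra_simps)
qed

lemma interp_measurable:
  assumes "\<And>n. a n \<in> borel_measurable borel"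
  shows "(\<lambda>(t, x). interp e a t x :: real) \<in> borel_measurable (borel :: (real \<times> real) measure)"
proof -
  have [measurable]: "fst \<in> borel_measurable (borel :: (real \<times> real) measure)" "snd \<in> borel_measurable (borel :: (real \<times> real) measure)"
    by (intro borel_measurable_continuous_onI continuous_intros)+
  have "(\<lambda>z. a (nat \<lfloor>fst z / e\<^sup>2\<rfloor>) (snd z)) \<in> borel_measurable (borel :: (real \<times> real) measure)"
  proof (rule measurable_compose_countable[where f="\<lambda>i z. a i (snd z)"])
    show "(\<lambda>z. a i (snd z)) \<in> borel_measurable (borel :: (real \<times> real) measure)" for i
      by (rule measurable_compose[OF _ assms]) measurable
    show "(\<lambda>z. nat \<lfloor>fst z / e\<^sup>2\<rfloor>) \<in> measurable (borel :: (real \<times> real) measure) (count_space UNIV)" by measurable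
  qed
  then show ?thesis unfolding interp_def by (simp add: case_prod_beta')
qed

lemma lebesgue_on_measurable:
  "f \<in> borel_measurable borel \<Longrightarrow> f \<in> borel_measurable (lebesgue_on S)"
  by (intro measurable_restrict_space1 measurable_completion) simp

lemma q_seq_iterate: "q_seq e u \<xi> n = (conv (g_ker e) ^^ n) (p_of u \<xi>)"
  by (induction n) auto

text \<open>The extra e^2 is the rounding to the time grid: times closer than e^2 may still lie in
  different steps.\<close>

lemma xi_eps_dist:
  assumes e: "e > 0" and \<alpha>: "\<alpha> > 0" and u: "state_bounds \<alpha> u \<xi>" and st: "0 \<le> s" "s \<le> t"
  shows "xi_eps e u \<xi> t \<le> xi_eps e u \<xi> s" "xi_eps e u \<xi> s - xi_eps e u \<xi> t \<le> \<alpha> / 2 * (t - s + e\<^sup>2)"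
proof -
  define n where "n = nat \<lfloor>s / e\<^sup>2\<rfloor>"
  define n' where "n' = nat \<lfloor>t / e\<^sup>2\<rfloor>"
  have "s / e\<^sup>2 \<le> t / e\<^sup>2" using st by (intro divide_right_mono) auto
  then have nn: "n \<le> n'" unfolding n_def n'_def by (intro nat_mono floor_mono)
  then obtain m where m: "n' = n + m" using le_Suc_ex by blast
  have "real n' * e\<^sup>2 \<le> t" "s < real n * e\<^sup>2 + e\<^sup>2"
    unfolding n_def n'_def using time_index[OF e, of t] time_index[OF e, of s] st by auto
  then have "real m * e\<^sup>2 \<le> t - s + e\<^sup>2" unfolding m by (simp add: algebra_simps)
  then have "\<alpha> / 2 * (real m * e\<^sup>2) \<le> \<alpha> / 2 * (t - s + e\<^sup>2)" using \<alpha> by (intro mult_left_mono) auto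
  then show "xi_eps e u \<xi> t \<le> xi_eps e u \<xi> s" "xi_eps e u \<xi> s - xi_eps e u \<xi> t \<le> \<alpha> / 2 * (t - s + e\<^sup>2)"
    using xi_seq_dist[OF e \<alpha> u, of n m]
    unfolding xi_eps_def interp_def n_def[symmetric] n'_def[symmetric] m by auto
qed

text \<open>The conclusion is stated along every further subsequence r', because the subsequence for
  f is extracted afterwards.\<close>

lemma xi_eps_convergence:
  assumes \<epsilon>: "\<And>k. 0 < \<epsilon> k" "\<epsilon> \<longlonglongrightarrow> 0" and \<alpha>: "\<alpha> > 0" and u: "state_bounds \<alpha> u \<xi>" and T: "T > 0"
    and eT: "\<And>k. (\<epsilon> k)\<^sup>2 \<le> T"
  obtains r \<xi>0 where "strict_mono (r :: nat \<Rightarrow> nat)" "W1_inf 0 T \<xi>0"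
    "\<And>r'. strict_mono r' \<Longrightarrow> tendsto_Linf (lebesgue_on {0..T}) (\<lambda>k. xi_eps (\<epsilon> (r (r' k))) u \<xi>) \<xi>0"
proof -
  define L where "L = \<alpha> / 2"
  have L: "L > 0" unfolding L_def using \<alpha> by simp
  note xd = xi_eps_dist[OF \<epsilon>(1) \<alpha> u, folded L_def]
  have x0: "xi_eps (\<epsilon> k) u \<xi> 0 = \<xi>" for k unfolding xi_eps_def interp_def by (simp add: scheme_0)
  have \<epsilon>2: "(\<lambda>k. (\<epsilon> k)\<^sup>2) \<longlonglongrightarrow> 0" using tendsto_power[OF \<epsilon>(2), of 2] by simp
  have bd: "\<bar>xi_eps (\<epsilon> k) u \<xi> t\<bar> \<le> \<bar>\<xi>\<bar> + L * (2 * T)" if "t \<in> {0..T}" for k t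
  proof -
    have "L * (t - 0 + (\<epsilon> k)\<^sup>2) \<le> L * (2 * T)" using that eT[of k] L by (intro mult_left_mono) auto
    then show ?thesis using xd[of 0 t k] that x0[of k] by auto
  qed
  have eq: "\<exists>\<delta>>0. \<exists>k0. \<forall>k\<ge>k0. \<forall>z\<in>{0..T}. \<forall>z'\<in>{0..T}. dist z z' < \<delta> \<longrightarrow> \<bar>xi_eps (\<epsilon> k) u \<xi> z - xi_eps (\<epsilon> k) u \<xi> z'\<bar> \<le> \<eta>"
    if \<eta>: "\<eta> > 0" for \<eta>
  proof -
    define \<delta> where "\<delta> = \<eta> / (2 * L)"
    have \<delta>: "\<delta> > 0" "L * (2 * \<delta>) = \<eta>" unfolding \<delta>_def using \<eta> L by auto
    obtain k0 where k0: "\<And>k. k \<ge> k0 \<Longrightarrow> (\<epsilon> k)\<^sup>2 < \<delta>"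
      using order_tendstoD(2)[OF \<epsilon>2 \<delta>(1)] by (auto simp: eventually_sequentially)
    have "\<bar>xi_eps (\<epsilon> k) u \<xi> z - xi_eps (\<epsilon> k) u \<xi> z'\<bar> \<le> \<eta>"
      if k: "k \<ge> k0" and z: "0 \<le> z" "0 \<le> z'" "dist z z' < \<delta>" for k z z'
    proof -
      have "L * (\<bar>z - z'\<bar> + (\<epsilon> k)\<^sup>2) \<le> L * (2 * \<delta>)"
        using k0[OF k] z(3) L by (intro mult_left_mono) (auto simp: dist_real_def)
      then show ?thesis using xd[of z z' k] xd[of z' z k] z \<delta>(2) by (cases "z \<le> z'") (auto simp: abs_if split: if_splits)
    qed
    then show ?thesis using \<delta>(1) by (intro exI[of _ \<delta>] conjI exI[of _ k0]) auto
  qed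
  obtain r \<xi>0 where r: "strict_mono (r :: nat \<Rightarrow> nat)"
    and \<xi>M: "\<And>z. z \<in> {0..T} \<Longrightarrow> \<bar>\<xi>0 z\<bar> \<le> \<bar>\<xi>\<bar> + L * (2 * T)"
    and lim: "\<And>z. z \<in> {0..T} \<Longrightarrow> (\<lambda>k. xi_eps (\<epsilon> (r k)) u \<xi> z) \<longlonglongrightarrow> \<xi>0 z"
    and unif: "\<And>K. compact K \<Longrightarrow> K \<subseteq> {0..T} \<Longrightarrow> uniform_limit K (\<lambda>k. xi_eps (\<epsilon> (r k)) u \<xi>) \<xi>0 sequentially"
    using asymptotic_arzela_ascoli[of "{0..T}" "\<lambda>k. xi_eps (\<epsilon> k) u \<xi>", OF bd eq] by metis
  have \<epsilon>r: "(\<lambda>k. (\<epsilon> (r k))\<^sup>2) \<longlonglongrightarrow> 0" using LIMSEQ_subseq_LIMSEQ[OF \<epsilon>2 r] by (simp add: comp_def)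
  have \<xi>L: "\<xi>0 t \<le> \<xi>0 s \<and> \<xi>0 s - \<xi>0 t \<le> L * (t - s)" if st: "0 \<le> s" "s \<le> t" "t \<le> T" for s t
  proof
    have "s \<in> {0..T}" "t \<in> {0..T}" using st by auto
    note l = lim[OF this(1)] lim[OF this(2)]
    show "\<xi>0 t \<le> \<xi>0 s" by (rule LIMSEQ_le[OF l(2) l(1)]) (use xd(1) st in auto)
    \<comment> \<open>The rounding term disappears in the limit, and \<alpha>/2 becomes a true
      Lipschitz constant.\<close>
    have "(\<lambda>k. L * (t - s + (\<epsilon> (r k))\<^sup>2)) \<longlonglongrightarrow> L * (t - s + 0)" by (intro tendsto_intros \<epsilon>r)
    from LIMSEQ_le[OF tendsto_diff[OF l(1) l(2)] this] show "\<xi>0 s - \<xi>0 t \<le> L * (t - s)" using xd(2) st by auto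
  qed
  have W: "W1_inf 0 T \<xi>0" by (rule decreasing_lipschitz_W1_inf[OF T L]) (use \<xi>L in blast)
  then have \<xi>m: "\<xi>0 \<in> borel_measurable (lebesgue_on {0..T})" unfolding W1_inf_def in_Linf_def by blast
  have xm: "xi_eps e u \<xi> \<in> borel_measurable borel" for e
    unfolding xi_eps_def interp_def by (rule measurable_compose[of _ _ "count_space UNIV"]) measurable
  have "tendsto_Linf (lebesgue_on {0..T}) (\<lambda>k. xi_eps (\<epsilon> (r (r' k))) u \<xi>) \<xi>0" if r': "strict_mono r'" for r'
  proof (rule tendsto_LinfI)
    show "(\<lambda>t. xi_eps (\<epsilon> (r (r' k))) u \<xi> t - \<xi>0 t) \<in> borel_measurable (lebesgue_on {0..T})" for k
      by (intro borel_measurable_diff lebesgue_on_measurable xm \<xi>m)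
    have "\<bar>xi_eps (\<epsilon> (r (r' k))) u \<xi> t - \<xi>0 t\<bar> \<le> 2 * (\<bar>\<xi>\<bar> + L * (2 * T))" if "t \<in> {0..T}" for k t
      using abs_triangle_ineq4[of "xi_eps (\<epsilon> (r (r' k))) u \<xi> t" "\<xi>0 t"] bd[OF that, of "r (r' k)"] \<xi>M[OF that]
      unfolding mult_2 by linarith
    then show "\<exists>B. \<forall>x\<in>space (lebesgue_on {0..T}). \<bar>xi_eps (\<epsilon> (r (r' k))) u \<xi> x - \<xi>0 x\<bar> \<le> B" for k
      by (intro exI[of _ "2 * (\<bar>\<xi>\<bar> + L * (2 * T))"]) simp
    fix \<eta> :: real assume \<eta>: "\<eta> > 0"
    have "\<forall>\<^sub>F k in sequentially. \<forall>x\<in>{0..T}. dist (xi_eps (\<epsilon> (r k)) u \<xi> x) (\<xi>0 x) < \<eta>"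
      using uniform_limitD[OF unif[of "{0..T}"] \<eta>] by simp
    then have "\<forall>\<^sub>F k in sequentially. \<forall>x\<in>{0..T}. dist (xi_eps (\<epsilon> (r (r' k))) u \<xi> x) (\<xi>0 x) < \<eta>"
      by (rule eventually_subseq[OF r'])
    then show "\<forall>\<^sub>F k in sequentially. \<forall>x\<in>space (lebesgue_on {0..T}). \<bar>xi_eps (\<epsilon> (r (r' k))) u \<xi> x - \<xi>0 x\<bar> \<le> \<eta>"
      by eventually_elim (auto simp: dist_real_def intro: less_imp_le)
  qed
  then show ?thesis using that[OF r W] by blast
qed

lemma f_eps_modulus:
  assumes e: "e > 0" and \<alpha>: "\<alpha> > 0" and u: "state_bounds \<alpha> u \<xi>"
    and \<theta>: "e\<^sup>2 \<le> \<theta>" "\<theta> \<le> T" and t: "0 \<le> t" "t \<le> T" "0 \<le> t'" "t' \<le> T"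
  defines "C1 \<equiv> \<alpha> * exp (\<alpha> / 2 * sqrt T) * (1 + \<alpha> * sqrt T)"
  shows "\<bar>f_eps e u \<xi> t x - f_eps e u \<xi> t' y\<bar> \<le> 2 * (C1 * sqrt \<theta>)
    + (C1 + 8 * (C1 * sqrt T) / sqrt \<theta>) * sqrt (\<bar>t - t'\<bar> + e\<^sup>2) + 4 * (C1 * sqrt T) / sqrt \<theta> * \<bar>x - y\<bar>"
proof -
  define c where "c = C1 + 8 * (C1 * sqrt T) / sqrt \<theta>"
  have th: "\<theta> > 0" using \<theta> e by (smt (verit) zero_less_power)
  have T0: "T > 0" using th \<theta> by linarith
  have C0: "C1 \<ge> 0" unfolding C1_def using \<alpha> T0 by (intro mult_nonneg_nonneg add_nonneg_nonneg) auto
  have c0: "c \<ge> 0" unfolding c_def using C0 T0 th by (intro add_nonneg_nonneg divide_nonneg_nonneg mult_nonneg_nonneg) auto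
  define N where "N t = nat \<lfloor>t / e\<^sup>2\<rfloor>" for t
  have N: "real (N s) * e\<^sup>2 \<le> s" "s < real (N s) * e\<^sup>2 + e\<^sup>2" if "0 \<le> s" for s
    unfolding N_def using time_index[OF e that] by auto
  have f: "f_eps e u \<xi> s = f_seq e u \<xi> (N s)" for s unfolding f_eps_def interp_def N_def ..
  have time: "\<bar>f_seq e u \<xi> (N b) x - f_seq e u \<xi> (N a) x\<bar> \<le> C1 * sqrt \<theta> + c * sqrt (\<bar>t - t'\<bar> + e\<^sup>2)"
    if ab: "0 \<le> a" "a \<le> b" "b \<le> T" "b - a = \<bar>t - t'\<bar>" for a b x
  proof -
    have "a / e\<^sup>2 \<le> b / e\<^sup>2" using ab by (intro divide_right_mono) auto
    then have "N a \<le> N b" unfolding N_def by (intro nat_mono floor_mono)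
    then obtain m where m: "N b = N a + m" using le_Suc_ex by blast
    have NT: "real (N a + m) * e\<^sup>2 \<le> T" using N(1)[of b] ab unfolding m[symmetric] by linarith
    have "real m * e\<^sup>2 = real (N b) * e\<^sup>2 - real (N a) * e\<^sup>2" unfolding m by (simp add: algebra_simps)
    then have "real m * e\<^sup>2 \<le> \<bar>t - t'\<bar> + e\<^sup>2" using N(1)[of b] N(2)[of a] ab by linarith
    then have s: "c * sqrt (real m * e\<^sup>2) \<le> c * sqrt (\<bar>t - t'\<bar> + e\<^sup>2)" using c0 by (intro mult_left_mono) auto
    have "\<bar>f_seq e u \<xi> (N a + m) x - f_seq e u \<xi> (N a) x\<bar> \<le> C1 * sqrt (real m * e\<^sup>2) + C1 * sqrt \<theta> + 8 * (C1 * sqrt T) / sqrt \<theta> * sqrt (real m * e\<^sup>2)"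
      unfolding C1_def by (rule f_seq_time_modulus[OF e \<alpha> u \<theta> NT])
    also have "\<dots> = C1 * sqrt \<theta> + c * sqrt (real m * e\<^sup>2)" unfolding c_def by (simp add: algebra_simps)
    finally show ?thesis using s unfolding m by linarith
  qed
  have "\<bar>f_seq e u \<xi> (N t) x - f_seq e u \<xi> (N t') x\<bar> \<le> C1 * sqrt \<theta> + c * sqrt (\<bar>t - t'\<bar> + e\<^sup>2)"
  proof (cases "t' \<le> t")
    case True
    then show ?thesis using time[of t' t x] t by auto
  next
    case False
    then show ?thesis using time[of t t' x] t by (subst abs_minus_commute) auto
  qed
  moreover have "\<bar>f_seq e u \<xi> (N t') x - f_seq e u \<xi> (N t') y\<bar> \<le> C1 * sqrt \<theta> + 4 * (C1 * sqrt T) / sqrt \<theta> * \<bar>x - y\<bar>"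
    unfolding C1_def by (rule f_seq_space_modulus[OF e \<alpha> u \<theta>]) (use N(1)[OF t(3)] t in linarith)
  ultimately show ?thesis unfolding f c_def[symmetric] by linarith
qed

lemma f_eps_convergence:
  assumes \<epsilon>: "\<And>k. 0 < \<epsilon> k" "\<epsilon> \<longlonglongrightarrow> 0" and \<alpha>: "\<alpha> > 0" and u: "state_bounds \<alpha> u \<xi>" and T: "T > 0"
    and eT: "\<And>k. (\<epsilon> k)\<^sup>2 \<le> T"
  obtains r f0 S where "strict_mono (r :: nat \<Rightarrow> nat)" "continuous_on ({0..T} \<times> UNIV) (\<lambda>(t, x). f0 t x)"
    "\<And>k t x. t \<in> {0..T} \<Longrightarrow> \<bar>f_eps (\<epsilon> (r k)) u \<xi> t x - f0 t x\<bar> \<le> S"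
    "\<And>t x. t \<in> {0..T} \<Longrightarrow> (\<lambda>k. f_eps (\<epsilon> (r k)) u \<xi> t x) \<longlonglongrightarrow> f0 t x"
    "\<And>K \<eta>. compact K \<Longrightarrow> K \<subseteq> {0..T} \<times> UNIV \<Longrightarrow> \<eta> > 0 \<Longrightarrow>
      \<forall>\<^sub>F k in sequentially. \<forall>(t, x)\<in>K. \<bar>f_eps (\<epsilon> (r k)) u \<xi> t x - f0 t x\<bar> \<le> \<eta>"
proof -
  define C1 where "C1 = \<alpha> * exp (\<alpha> / 2 * sqrt T) * (1 + \<alpha> * sqrt T)"
  have C0: "C1 \<ge> 0" unfolding C1_def using \<alpha> T by (intro mult_nonneg_nonneg add_nonneg_nonneg) auto
  define D where "D = {0..T} \<times> (UNIV :: real set)"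
  define F where "F k z = (case z of (t, x) \<Rightarrow> f_eps (\<epsilon> k) u \<xi> t x)" for k z
  have \<epsilon>2: "(\<lambda>k. (\<epsilon> k)\<^sup>2) \<longlonglongrightarrow> 0" using tendsto_power[OF \<epsilon>(2), of 2] by simp
  have bd: "\<bar>F k z\<bar> \<le> C1 * sqrt T" if z: "z \<in> D" for k z
  proof -
    obtain t x where tx: "z = (t, x)" "0 \<le> t" "t \<le> T" using z unfolding D_def by auto
    have "real (nat \<lfloor>t / (\<epsilon> k)\<^sup>2\<rfloor>) * (\<epsilon> k)\<^sup>2 \<le> T" using time_index(1)[OF \<epsilon>(1) tx(2), of k] tx(3) by linarith
    from f_seq_bounded[OF \<epsilon>(1) \<alpha> u eT this order_refl, of x]
    show ?thesis unfolding F_def tx f_eps_def interp_def C1_def by simp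
  qed
  have eq: "\<exists>\<delta>>0. \<exists>k0. \<forall>k\<ge>k0. \<forall>z\<in>D. \<forall>z'\<in>D. dist z z' < \<delta> \<longrightarrow> \<bar>F k z - F k z'\<bar> \<le> \<eta>" if \<eta>: "\<eta> > 0" for \<eta>
  proof -
    \<comment> \<open>Order of choice: \<theta> = s^2 makes the first part of the modulus at most
      \<eta>/2 for all points; \<delta> follows, depending on \<theta>. The minimum with sqrt T
      ensures \<theta> \<le> T.\<close>
    define s where "s = min (sqrt T) (\<eta> / (4 * (C1 + 1)))"
    have s: "s > 0" "s \<le> sqrt T" unfolding s_def using T \<eta> C0 by auto
    define \<theta> where "\<theta> = s\<^sup>2"
    have \<theta>: "\<theta> > 0" "sqrt \<theta> = s" unfolding \<theta>_def using s by auto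
    have \<theta>T: "\<theta> \<le> T" using s \<theta>(2) real_sqrt_le_iff by metis
    have "C1 * s \<le> (C1 + 1) * (\<eta> / (4 * (C1 + 1)))" using C0 s unfolding s_def by (intro mult_mono) auto
    also have "\<dots> = \<eta> / 4"
    proof -
      have "a * (\<eta> / (4 * a)) = \<eta> / 4" if "a \<noteq> 0" for a using that by simp
      then show ?thesis using C0 by (metis add_nonneg_pos less_irrefl zero_less_one)
    qed
    finally have first: "2 * (C1 * sqrt \<theta>) \<le> \<eta> / 2" unfolding \<theta>(2) by simp
    define c where "c = C1 + 8 * (C1 * sqrt T) / sqrt \<theta> + 1"
    define b where "b = 4 * (C1 * sqrt T) / sqrt \<theta> + 1"
    have cb: "c > 0" "b > 0" unfolding c_def b_def using C0 T \<theta> by (auto intro!: add_nonneg_pos)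
    \<comment> \<open>The half in the first entry leaves room under the root for both \<bar>t -
      t'\<bar> and the rounding e^2.\<close>
    define \<delta> where "\<delta> = min ((\<eta> / (4 * c))\<^sup>2 / 2) (\<eta> / (4 * b))"
    have \<delta>: "\<delta> > 0" unfolding \<delta>_def using cb \<eta> by simp
    have "sqrt (2 * \<delta>) \<le> sqrt ((\<eta> / (4 * c))\<^sup>2)" unfolding \<delta>_def by (intro real_sqrt_le_mono) auto
    then have "c * sqrt (2 * \<delta>) \<le> c * (\<eta> / (4 * c))" using cb \<eta> by (intro mult_left_mono) auto
    then have second: "c * sqrt (2 * \<delta>) \<le> \<eta> / 4" using cb by simp
    have "b * \<delta> \<le> b * (\<eta> / (4 * b))" unfolding \<delta>_def using cb by (intro mult_left_mono) auto
    then have third: "b * \<delta> \<le> \<eta> / 4" using cb by simp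
    have "min \<delta> \<theta> > 0" using \<delta> \<theta> by simp
    then obtain k0 where k0: "\<And>k. k \<ge> k0 \<Longrightarrow> (\<epsilon> k)\<^sup>2 < min \<delta> \<theta>"
      using order_tendstoD(2)[OF \<epsilon>2] unfolding eventually_sequentially by blast
    have "\<bar>F k z - F k z'\<bar> \<le> \<eta>" if k: "k \<ge> k0" and z: "z \<in> D" "z' \<in> D" "dist z z' < \<delta>" for k z z'
    proof -
      obtain t x t' y where tx: "z = (t, x)" "z' = (t', y)" "0 \<le> t" "t \<le> T" "0 \<le> t'" "t' \<le> T" using z unfolding D_def by auto
      have dt: "\<bar>t - t'\<bar> < \<delta>" and dx: "\<bar>x - y\<bar> < \<delta>"
        using dist_fst_le[of z z'] dist_snd_le[of z z'] z(3) unfolding tx by (auto simp: dist_real_def)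
      have e: "(\<epsilon> k)\<^sup>2 \<le> \<theta>" "(\<epsilon> k)\<^sup>2 \<le> \<delta>" using k0[OF k] by auto
      have "\<bar>F k z - F k z'\<bar> \<le> 2 * (C1 * sqrt \<theta>)
        + (C1 + 8 * (C1 * sqrt T) / sqrt \<theta>) * sqrt (\<bar>t - t'\<bar> + (\<epsilon> k)\<^sup>2) + 4 * (C1 * sqrt T) / sqrt \<theta> * \<bar>x - y\<bar>"
        unfolding F_def tx prod.case C1_def by (rule f_eps_modulus[OF \<epsilon>(1) \<alpha> u e(1) \<theta>T tx(3-6)])
      also have "\<dots> \<le> 2 * (C1 * sqrt \<theta>) + c * sqrt (2 * \<delta>) + b * \<delta>"
      proof (intro add_mono mult_mono)
        show "sqrt (\<bar>t - t'\<bar> + (\<epsilon> k)\<^sup>2) \<le> sqrt (2 * \<delta>)" using dt e by simp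
      qed (use cb dx \<delta> c_def b_def C0 \<theta> in auto)
      finally show ?thesis using first second third by linarith
    qed
    then show ?thesis using \<delta> by (intro exI[of _ \<delta>] conjI exI[of _ k0]) auto
  qed
  obtain r f where r: "strict_mono (r :: nat \<Rightarrow> nat)"
    and fu: "\<And>\<eta>. \<eta> > 0 \<Longrightarrow> \<exists>\<delta>>0. \<forall>z\<in>D. \<forall>z'\<in>D. dist z z' < \<delta> \<longrightarrow> \<bar>f z - f z'\<bar> \<le> \<eta>"
    and fM: "\<And>z. z \<in> D \<Longrightarrow> \<bar>f z\<bar> \<le> C1 * sqrt T"
    and lim: "\<And>z. z \<in> D \<Longrightarrow> (\<lambda>k. F (r k) z) \<longlonglongrightarrow> f z"
    and unif: "\<And>K. compact K \<Longrightarrow> K \<subseteq> D \<Longrightarrow> uniform_limit K (\<lambda>k. F (r k)) f sequentially"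
    using asymptotic_arzela_ascoli[of D F, OF bd eq] by metis
  have fc: "continuous_on D f"
    unfolding continuous_on_iff
  proof (intro ballI allI impI)
    fix z and \<eta> :: real assume z: "z \<in> D" and "\<eta> > 0"
    then obtain \<delta> where "\<delta> > 0" "\<forall>z\<in>D. \<forall>z'\<in>D. dist z z' < \<delta> \<longrightarrow> \<bar>f z - f z'\<bar> \<le> \<eta> / 2" using fu[of "\<eta> / 2"] by auto
    then show "\<exists>d>0. \<forall>x'\<in>D. dist x' z < d \<longrightarrow> dist (f x') (f z) < \<eta>"
      using z \<open>\<eta> > 0\<close> by (intro exI[of _ \<delta>]) (force simp: dist_real_def)
  qed
  show ?thesis
  proof (rule that[of r "\<lambda>t x. f (t, x)" "2 * (C1 * sqrt T)"])
    show "strict_mono r" by (rule r)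
    show "continuous_on ({0..T} \<times> UNIV) (\<lambda>(t, x). f (t, x))" using fc unfolding D_def by simp
    show "\<bar>f_eps (\<epsilon> (r k)) u \<xi> t x - f (t, x)\<bar> \<le> 2 * (C1 * sqrt T)" if "t \<in> {0..T}" for k t x
      using bd[of "(t, x)" "r k"] fM[of "(t, x)"] that unfolding D_def F_def by simp
    show "(\<lambda>k. f_eps (\<epsilon> (r k)) u \<xi> t x) \<longlonglongrightarrow> f (t, x)" if "t \<in> {0..T}" for t x
      using lim[of "(t, x)"] that unfolding D_def F_def by simp
    fix K :: "(real \<times> real) set" and \<eta> :: real assume K: "compact K" "K \<subseteq> {0..T} \<times> UNIV" and \<eta>: "\<eta> > 0"
    from uniform_limitD[OF unif[OF K[folded D_def]] \<eta>]
    show "\<forall>\<^sub>F k in sequentially. \<forall>(t, x)\<in>K. \<bar>f_eps (\<epsilon> (r k)) u \<xi> t x - f (t, x)\<bar> \<le> \<eta>"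
      by eventually_elim (auto simp: F_def dist_real_def intro: less_imp_le)
  qed
qed

text \<open>The whole sequence converges, without extraction. The bound for fixed k is the Euler
  estimate with \<delta> = 1 and serves to place each difference in the space of essentially bounded
  functions.\<close>

lemma q_eps_convergence:
  fixes u \<xi> defines "p \<equiv> p_of u \<xi>"
  assumes \<epsilon>: "\<And>k. 0 < \<epsilon> k" "\<epsilon> \<longlonglongrightarrow> 0" and T: "T > 0"
    and M: "M \<ge> 0" and lip: "\<And>x y. \<bar>p x - p y\<bar> \<le> M * \<bar>x - y\<bar>"
  shows "\<exists>B. \<forall>t\<in>{0..T}. \<forall>x. \<bar>q_eps (\<epsilon> k) u \<xi> t x - heat_flow p t x\<bar> \<le> B"
    "\<eta> > 0 \<Longrightarrow> \<forall>\<^sub>F k in sequentially. \<forall>t\<in>{0..T}. \<forall>x. \<bar>q_eps (\<epsilon> k) u \<xi> t x - heat_flow p t x\<bar> \<le> \<eta>"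
proof -
  define N where "N k t = nat \<lfloor>t / (\<epsilon> k)\<^sup>2\<rfloor>" for k t
  have N: "real (N k t) * (\<epsilon> k)\<^sup>2 \<le> t" "\<bar>real (N k t) * (\<epsilon> k)\<^sup>2 - t\<bar> \<le> (\<epsilon> k)\<^sup>2" if "0 \<le> t" for k t
    unfolding N_def using time_index[OF \<epsilon>(1) that, of k] by auto
  have q: "q_eps (\<epsilon> k) u \<xi> t x = (conv (g_ker (\<epsilon> k)) ^^ N k t) p x" for k t x
    unfolding q_eps_def interp_def N_def q_seq_iterate p_def ..
  define c where "c = M * gauss_mass"
  have c0: "c \<ge> 0" unfolding c_def using M gauss_mass_nonneg by simp
  have hd: "\<bar>heat_flow p t x - heat_flow p s x\<bar> \<le> c * sqrt (2 * \<bar>t - s\<bar>)" if "s \<ge> 0" "t \<ge> 0" for s t x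
    using heat_flow_dist[OF lip M that, of x x] unfolding c_def by simp
  show "\<exists>B. \<forall>t\<in>{0..T}. \<forall>x. \<bar>q_eps (\<epsilon> k) u \<xi> t x - heat_flow p t x\<bar> \<le> B"
  proof -
    define w where "w = c * ((\<epsilon> k)\<^sup>2 * sqrt (2 * (T + 1)) / (2 * 1\<^sup>2) + sqrt (2 * (\<epsilon> k)\<^sup>2) / (2 * 1))"
    have w0: "w \<ge> 0" unfolding w_def using c0 T by (intro mult_nonneg_nonneg add_nonneg_nonneg) auto
    have "\<bar>q_eps (\<epsilon> k) u \<xi> t x - heat_flow p t x\<bar> \<le> c * sqrt (2 * 1) + T * w + c * sqrt (2 * ((\<epsilon> k)\<^sup>2 + 1))"
      if t: "t \<in> {0..T}" for t x
    proof -
      have NT: "real (N k t) * (\<epsilon> k)\<^sup>2 \<le> T" using N(1)[of t k] t by auto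
      have "\<bar>heat_flow p (real (N k t) * (\<epsilon> k)\<^sup>2 + 1) x - q_eps (\<epsilon> k) u \<xi> t x\<bar> \<le> c * sqrt (2 * 1) + real (N k t) * (\<epsilon> k)\<^sup>2 * w"
        unfolding q w_def c_def by (rule implicit_euler_error[OF lip M \<epsilon>(1) _ NT]) simp
      moreover have "real (N k t) * (\<epsilon> k)\<^sup>2 * w \<le> T * w" by (rule mult_right_mono[OF NT w0])
      moreover have "\<bar>heat_flow p (real (N k t) * (\<epsilon> k)\<^sup>2 + 1) x - heat_flow p t x\<bar> \<le> c * sqrt (2 * \<bar>real (N k t) * (\<epsilon> k)\<^sup>2 + 1 - t\<bar>)"
        by (rule hd) (use t in auto)
      moreover have "c * sqrt (2 * \<bar>real (N k t) * (\<epsilon> k)\<^sup>2 + 1 - t\<bar>) \<le> c * sqrt (2 * ((\<epsilon> k)\<^sup>2 + 1))"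
      proof (intro mult_left_mono c0 real_sqrt_le_mono)
        show "\<bar>real (N k t) * (\<epsilon> k)\<^sup>2 + 1 - t\<bar> \<le> (\<epsilon> k)\<^sup>2 + 1" using N(2)[of t k] t by auto
      qed simp
      ultimately show ?thesis by linarith
    qed
    then show ?thesis by blast
  qed
  assume \<eta>: "\<eta> > 0"
  then obtain e0 where e0: "e0 > 0" "\<And>e k x. 0 < e \<Longrightarrow> e < e0 \<Longrightarrow> real k * e\<^sup>2 \<le> T \<Longrightarrow>
      \<bar>(conv (g_ker e) ^^ k) p x - heat_flow p (real k * e\<^sup>2) x\<bar> \<le> \<eta> / 2"
    using heat_iteration_convergence[OF lip M T, of "\<eta> / 2"] by (metis half_gt_zero)
  have "(\<lambda>k. c * sqrt (2 * (\<epsilon> k)\<^sup>2)) \<longlonglongrightarrow> c * sqrt (2 * 0\<^sup>2)" by (intro tendsto_intros \<epsilon>(2))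
  then have "\<forall>\<^sub>F k in sequentially. c * sqrt (2 * (\<epsilon> k)\<^sup>2) < \<eta> / 2" using \<eta> by (intro order_tendstoD(2)) auto
  with order_tendstoD(2)[OF \<epsilon>(2) e0(1)]
  show "\<forall>\<^sub>F k in sequentially. \<forall>t\<in>{0..T}. \<forall>x. \<bar>q_eps (\<epsilon> k) u \<xi> t x - heat_flow p t x\<bar> \<le> \<eta>"
  proof eventually_elim
    case (elim k)
    show ?case
    proof (intro ballI allI)
      fix t x assume t: "t \<in> {0..T}"
      have NT: "real (N k t) * (\<epsilon> k)\<^sup>2 \<le> T" using N(1)[of t k] t by auto
      have "\<bar>q_eps (\<epsilon> k) u \<xi> t x - heat_flow p (real (N k t) * (\<epsilon> k)\<^sup>2) x\<bar> \<le> \<eta> / 2"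
        unfolding q by (rule e0(2)[OF \<epsilon>(1) elim(1) NT])
      moreover have "\<bar>heat_flow p (real (N k t) * (\<epsilon> k)\<^sup>2) x - heat_flow p t x\<bar> \<le> c * sqrt (2 * \<bar>real (N k t) * (\<epsilon> k)\<^sup>2 - t\<bar>)"
        by (rule hd) (use t in auto)
      moreover have "c * sqrt (2 * \<bar>real (N k t) * (\<epsilon> k)\<^sup>2 - t\<bar>) \<le> c * sqrt (2 * (\<epsilon> k)\<^sup>2)"
      proof (intro mult_left_mono c0 real_sqrt_le_mono)
        show "\<bar>real (N k t) * (\<epsilon> k)\<^sup>2 - t\<bar> \<le> (\<epsilon> k)\<^sup>2" using N(2)[of t k] t by auto
      qed simp
      ultimately show "\<bar>q_eps (\<epsilon> k) u \<xi> t x - heat_flow p t x\<bar> \<le> \<eta>" using elim(2) by linarith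
    qed
  qed
qed

text \<open>The null sequence \<epsilon> is arbitrary. Compactness is used for the interface and
  then for f, the second extraction refining the first; the regular part converges along any
  subsequence. The almost-everywhere statements are obtained at every point of D.\<close>

theorem corollary15:
  fixes T :: real and u_ini :: "real \<Rightarrow> real" and \<xi>_ini :: real and \<epsilon> :: "nat \<Rightarrow> real"
  defines "D \<equiv> {0..T} \<times> (UNIV :: real set)"
  assumes "T > 0"
    and "admissible_initial u_ini \<xi>_ini"
    and "\<And>k. 0 < \<epsilon> k \<and> (\<epsilon> k)\<^sup>2 \<le> T"
    and "\<epsilon> \<longlonglongrightarrow> 0"
  shows "\<exists>(r :: nat \<Rightarrow> nat) (\<xi>0 :: real \<Rightarrow> real) (q0 :: real \<Rightarrow> real \<Rightarrow> real) (f0 :: real \<Rightarrow> real \<Rightarrow> real).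
    strict_mono r \<and>
    W1_inf 0 T \<xi>0 \<and>
    tendsto_Linf (lebesgue_on {0..T}) (\<lambda>k. xi_eps (\<epsilon> (r k)) u_ini \<xi>_ini) \<xi>0 \<and>
    q0 = heat_flow (p_of u_ini \<xi>_ini) \<and>
    solves_heat_eq T (p_of u_ini \<xi>_ini) q0 \<and>
    continuous_on D (\<lambda>(t, x). q0 t x) \<and>
    tendsto_Linf (lebesgue_on D)
      (\<lambda>k (t, x). q_eps (\<epsilon> (r k)) u_ini \<xi>_ini t x) (\<lambda>(t, x). q0 t x) \<and>
    (AE (t, x) in lebesgue_on D. (\<lambda>k. q_eps (\<epsilon> (r k)) u_ini \<xi>_ini t x) \<longlonglongrightarrow> q0 t x) \<and>
    continuous_on D (\<lambda>(t, x). f0 t x) \<and>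
    (AE (t, x) in lebesgue_on D. (\<lambda>k. f_eps (\<epsilon> (r k)) u_ini \<xi>_ini t x) \<longlonglongrightarrow> f0 t x) \<and>
    (\<forall>K. compact K \<and> K \<subseteq> D \<longrightarrow>
      tendsto_Linf (lebesgue_on K)
        (\<lambda>k (t, x). f_eps (\<epsilon> (r k)) u_ini \<xi>_ini t x) (\<lambda>(t, x). f0 t x)) \<and>
    (\<forall>k. \<forall>t\<in>{0..T}. \<forall>x. p_eps (\<epsilon> (r k)) u_ini \<xi>_ini t x =
      q_eps (\<epsilon> (r k)) u_ini \<xi>_ini t x - f_eps (\<epsilon> (r k)) u_ini \<xi>_ini t x) \<and>
    (\<forall>K. compact K \<and> K \<subseteq> D \<longrightarrow>
      tendsto_Linf (lebesgue_on K)
        (\<lambda>k (t, x). p_eps (\<epsilon> (r k)) u_ini \<xi>_ini t x) (\<lambda>(t, x). q0 t x - f0 t x)) \<and>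
    (AE (t, x) in lebesgue_on D.
      (\<lambda>k. p_eps (\<epsilon> (r k)) u_ini \<xi>_ini t x) \<longlonglongrightarrow> q0 t x - f0 t x)"
proof -
  let ?u = u_ini and ?x = \<xi>_ini
  let ?p = "p_of u_ini \<xi>_ini"
  have T: "T > 0" and adm: "admissible_state ?u ?x" and sd: "second_derivative_finite_measure ?p"
    and \<epsilon>0: "\<And>k. 0 < \<epsilon> k" and eT: "\<And>k. (\<epsilon> k)\<^sup>2 \<le> T" and lim: "\<epsilon> \<longlonglongrightarrow> 0"
    using assms(2-5) unfolding admissible_initial_def by auto
  obtain \<alpha> where \<alpha>: "\<alpha> > 0" and u: "state_bounds \<alpha> ?u ?x" by (rule admissible_state_bounds[OF adm])
  obtain M where M: "M \<ge> 0" and lip: "\<And>x y. \<bar>?p x - ?p y\<bar> \<le> M * \<bar>x - y\<bar>"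
    using lipschitz_of_second_derivative[OF sd p_of_admissible(1)[OF adm] p_of_admissible(2)[OF adm]] by metis
  obtain r1 \<xi>0 where r1: "strict_mono (r1 :: nat \<Rightarrow> nat)" and W: "W1_inf 0 T \<xi>0"
    and xi: "\<And>r'. strict_mono r' \<Longrightarrow> tendsto_Linf (lebesgue_on {0..T}) (\<lambda>k. xi_eps (\<epsilon> (r1 (r' k))) ?u ?x) \<xi>0"
    by (rule xi_eps_convergence[OF \<epsilon>0 lim \<alpha> u T eT]) (rule that; assumption)
  have lim1: "(\<lambda>k. \<epsilon> (r1 k)) \<longlonglongrightarrow> 0" using LIMSEQ_subseq_LIMSEQ[OF lim r1] by (simp add: comp_def)
  obtain r2 f0 S where r2: "strict_mono (r2 :: nat \<Rightarrow> nat)" and f0: "continuous_on ({0..T} \<times> UNIV) (\<lambda>(t, x). f0 t x)"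
    and fS: "\<And>k t x. t \<in> {0..T} \<Longrightarrow> \<bar>f_eps (\<epsilon> (r1 (r2 k))) ?u ?x t x - f0 t x\<bar> \<le> S"
    and fl: "\<And>t x. t \<in> {0..T} \<Longrightarrow> (\<lambda>k. f_eps (\<epsilon> (r1 (r2 k))) ?u ?x t x) \<longlonglongrightarrow> f0 t x"
    and fK: "\<And>K \<eta>. compact K \<Longrightarrow> K \<subseteq> {0..T} \<times> UNIV \<Longrightarrow> \<eta> > 0 \<Longrightarrow>
      \<forall>\<^sub>F k in sequentially. \<forall>(t, x)\<in>K. \<bar>f_eps (\<epsilon> (r1 (r2 k))) ?u ?x t x - f0 t x\<bar> \<le> \<eta>"
    by (rule f_eps_convergence[OF \<epsilon>0 lim1 \<alpha> u T eT]) (rule that; assumption)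
  note f0 = f0[folded D_def] and fK = fK[folded D_def]
  define r where "r k = r1 (r2 k)" for k
  have r: "strict_mono r" unfolding r_def using strict_mono_o[OF r1 r2] by (simp add: comp_def)
  have limr: "(\<lambda>k. \<epsilon> (r k)) \<longlonglongrightarrow> 0" using LIMSEQ_subseq_LIMSEQ[OF lim r] by (simp add: comp_def)
  define q0 where "q0 = heat_flow ?p"
  have q0: "continuous_on D (\<lambda>(t, x). q0 t x)" unfolding D_def q0_def by (rule heat_flow_continuous[OF lip M])
  note qb = q_eps_convergence(1)[OF \<epsilon>0 limr T M lip, folded q0_def]
  note qc = q_eps_convergence(2)[OF \<epsilon>0 limr T M lip, folded q0_def]
  have p: "p_eps e ?u ?x t x = q_eps e ?u ?x t x - f_eps e ?u ?x t x" if "e > 0" for e t x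
    unfolding p_eps_def q_eps_def f_eps_def interp_def by (rule p_seq_eq[OF that \<alpha> u])
  have cl: "K \<in> sets lebesgue" if "closed K" for K :: "(real \<times> real) set"
    using sets_completionI_sets[of K lborel] borel_closed[OF that] by simp
  have Dl: "D \<in> sets lebesgue" unfolding D_def by (intro cl closed_Times) auto
  have Kl: "K \<in> sets lebesgue" if "compact K" for K :: "(real \<times> real) set" by (rule cl[OF compact_imp_closed[OF that]])
  have qm: "(\<lambda>(t, x). q_eps e ?u ?x t x) \<in> borel_measurable borel" if "e > 0" for e
    unfolding q_eps_def by (intro interp_measurable tame_measurable q_seq_tame that p_of_tame state_bounds_tame[OF u \<alpha>])
  have fm: "(\<lambda>(t, x). f_eps e ?u ?x t x) \<in> borel_measurable borel" if "e > 0" for e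
    unfolding f_eps_def by (intro interp_measurable tame_measurable f_seq_tame that)
  have cm: "(\<lambda>(t, x). h t x) \<in> borel_measurable (lebesgue_on K)"
    if "continuous_on D (\<lambda>(t, x). h t x)" "K \<subseteq> D" "K \<in> sets lebesgue" for h :: "real \<Rightarrow> real \<Rightarrow> real" and K
    by (rule continuous_imp_measurable_on_sets_lebesgue[OF continuous_on_subset[OF that(1,2)] that(3)])
  have qdm: "(\<lambda>z. (case z of (t, x) \<Rightarrow> q_eps (\<epsilon> (r k)) ?u ?x t x) - (case z of (t, x) \<Rightarrow> q0 t x)) \<in> borel_measurable (lebesgue_on K)"
    if "K \<subseteq> D" "K \<in> sets lebesgue" for k K
    by (intro borel_measurable_diff lebesgue_on_measurable qm \<epsilon>0 cm[OF q0 that])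
  have fdm: "(\<lambda>z. (case z of (t, x) \<Rightarrow> f_eps (\<epsilon> (r k)) ?u ?x t x) - (case z of (t, x) \<Rightarrow> f0 t x)) \<in> borel_measurable (lebesgue_on K)"
    if "K \<subseteq> D" "K \<in> sets lebesgue" for k K
    by (intro borel_measurable_diff lebesgue_on_measurable fm \<epsilon>0 cm[OF f0 that])
  have ql: "(\<lambda>k. q_eps (\<epsilon> (r k)) ?u ?x t x) \<longlonglongrightarrow> q0 t x" if "t \<in> {0..T}" for t x
  proof (rule LIMSEQ_I)
    fix \<eta> :: real assume "\<eta> > 0"
    then have "\<forall>\<^sub>F k in sequentially. \<forall>t\<in>{0..T}. \<forall>x. \<bar>q_eps (\<epsilon> (r k)) ?u ?x t x - q0 t x\<bar> \<le> \<eta> / 2" by (intro qc) simp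
    then obtain n0 where "\<forall>n\<ge>n0. \<forall>t\<in>{0..T}. \<forall>x. \<bar>q_eps (\<epsilon> (r n)) ?u ?x t x - q0 t x\<bar> \<le> \<eta> / 2"
      unfolding eventually_sequentially by blast
    then have "\<forall>n\<ge>n0. \<bar>q_eps (\<epsilon> (r n)) ?u ?x t x - q0 t x\<bar> \<le> \<eta> / 2" using that by blast
    then show "\<exists>n0. \<forall>n\<ge>n0. norm (q_eps (\<epsilon> (r n)) ?u ?x t x - q0 t x) < \<eta>"
      using \<open>\<eta> > 0\<close> by (intro exI[of _ n0]) force
  qed
  have sp: "space (lebesgue_on K) = K" for K :: "(real \<times> real) set" by simp
  have AE: "AE z in lebesgue_on D. case z of (t, x) \<Rightarrow> P t x" if "\<And>t x. t \<in> {0..T} \<Longrightarrow> P t x" for P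
    by (rule AE_I2) (use that in \<open>auto simp: D_def\<close>)
  have pK: "tendsto_Linf (lebesgue_on K) (\<lambda>k (t, x). p_eps (\<epsilon> (r k)) ?u ?x t x) (\<lambda>(t, x). q0 t x - f0 t x)"
    if K: "compact K" "K \<subseteq> D" for K
  proof (rule tendsto_LinfI)
    \<comment> \<open>The error of p is the difference of the errors of q and f, so measurability,
      boundedness and smallness are inherited from these.\<close>
    have eq: "(case z of (t, x) \<Rightarrow> p_eps (\<epsilon> (r k)) ?u ?x t x) - (case z of (t, x) \<Rightarrow> q0 t x - f0 t x)
      = ((case z of (t, x) \<Rightarrow> q_eps (\<epsilon> (r k)) ?u ?x t x) - (case z of (t, x) \<Rightarrow> q0 t x))
        - ((case z of (t, x) \<Rightarrow> f_eps (\<epsilon> (r k)) ?u ?x t x) - (case z of (t, x) \<Rightarrow> f0 t x))" for z k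
      by (simp add: p \<epsilon>0 split: prod.split)
    show "(\<lambda>z. (case z of (t, x) \<Rightarrow> p_eps (\<epsilon> (r k)) ?u ?x t x) - (case z of (t, x) \<Rightarrow> q0 t x - f0 t x)) \<in> borel_measurable (lebesgue_on K)" for k
      unfolding eq by (intro borel_measurable_diff qdm fdm K Kl)
    show "\<exists>B. \<forall>z\<in>space (lebesgue_on K). \<bar>(case z of (t, x) \<Rightarrow> p_eps (\<epsilon> (r k)) ?u ?x t x) - (case z of (t, x) \<Rightarrow> q0 t x - f0 t x)\<bar> \<le> B" for k
    proof -
      obtain B where B: "\<And>t x. t \<in> {0..T} \<Longrightarrow> \<bar>q_eps (\<epsilon> (r k)) ?u ?x t x - q0 t x\<bar> \<le> B" using qb by blast
      have "\<bar>p_eps (\<epsilon> (r k)) ?u ?x t x - (q0 t x - f0 t x)\<bar> \<le> B + S" if "t \<in> {0..T}" for t x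
        using B[OF that, of x] fS[OF that, of k x] unfolding p[OF \<epsilon>0] r_def[symmetric] by linarith
      then show ?thesis using K(2) unfolding sp D_def by (intro exI[of _ "B + S"]) auto
    qed
    fix \<eta> :: real assume \<eta>: "\<eta> > 0"
    then have "\<eta> / 2 > 0" by simp
    from qc[OF this] fK[OF K this]
    show "\<forall>\<^sub>F k in sequentially. \<forall>z\<in>space (lebesgue_on K). \<bar>(case z of (t, x) \<Rightarrow> p_eps (\<epsilon> (r k)) ?u ?x t x) - (case z of (t, x) \<Rightarrow> q0 t x - f0 t x)\<bar> \<le> \<eta>"
    proof eventually_elim
      case (elim k)
      show ?case unfolding sp
      proof (clarify)
        fix t x assume z: "(t, x) \<in> K"
        then have "t \<in> {0..T}" using K(2) unfolding D_def by auto
        then have "\<bar>q_eps (\<epsilon> (r k)) ?u ?x t x - q0 t x\<bar> \<le> \<eta> / 2" using elim(1) by blast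
        moreover have "\<bar>f_eps (\<epsilon> (r k)) ?u ?x t x - f0 t x\<bar> \<le> \<eta> / 2" using elim(2) z unfolding r_def by auto
        ultimately show "\<bar>p_eps (\<epsilon> (r k)) ?u ?x t x - (q0 t x - f0 t x)\<bar> \<le> \<eta>" unfolding p[OF \<epsilon>0] by linarith
      qed
    qed
  qed
  show ?thesis
  proof (rule exI[of _ r], rule exI[of _ \<xi>0], rule exI[of _ q0], rule exI[of _ f0], intro conjI allI ballI impI)
    show "strict_mono r" by (rule r)
    show "W1_inf 0 T \<xi>0" by (rule W)
    show "tendsto_Linf (lebesgue_on {0..T}) (\<lambda>k. xi_eps (\<epsilon> (r k)) ?u ?x) \<xi>0" unfolding r_def by (rule xi[OF r2])
    show "q0 = heat_flow ?p" by (rule q0_def)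
    show "solves_heat_eq T ?p q0" unfolding q0_def by (rule heat_flow_solves[OF lip M])
    show "continuous_on D (\<lambda>(t, x). q0 t x)" by (rule q0)
    show "tendsto_Linf (lebesgue_on D) (\<lambda>k (t, x). q_eps (\<epsilon> (r k)) ?u ?x t x) (\<lambda>(t, x). q0 t x)"
    proof (rule tendsto_LinfI[OF qdm[OF order_refl Dl]])
      show "\<exists>B. \<forall>z\<in>space (lebesgue_on D). \<bar>(case z of (t, x) \<Rightarrow> q_eps (\<epsilon> (r k)) ?u ?x t x) - (case z of (t, x) \<Rightarrow> q0 t x)\<bar> \<le> B" for k
        using qb[of k] unfolding sp D_def by auto
      fix \<eta> :: real assume "\<eta> > 0"
      from qc[OF this] show "\<forall>\<^sub>F k in sequentially. \<forall>z\<in>space (lebesgue_on D). \<bar>(case z of (t, x) \<Rightarrow> q_eps (\<epsilon> (r k)) ?u ?x t x) - (case z of (t, x) \<Rightarrow> q0 t x)\<bar> \<le> \<eta>"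
        by eventually_elim (auto simp: sp D_def)
    qed
    show "AE (t, x) in lebesgue_on D. (\<lambda>k. q_eps (\<epsilon> (r k)) ?u ?x t x) \<longlonglongrightarrow> q0 t x" by (rule AE[OF ql])
    show "continuous_on D (\<lambda>(t, x). f0 t x)" by (rule f0)
    show "AE (t, x) in lebesgue_on D. (\<lambda>k. f_eps (\<epsilon> (r k)) ?u ?x t x) \<longlonglongrightarrow> f0 t x"
      unfolding r_def by (rule AE[OF fl])
    show "tendsto_Linf (lebesgue_on K) (\<lambda>k (t, x). f_eps (\<epsilon> (r k)) ?u ?x t x) (\<lambda>(t, x). f0 t x)"
      if K: "compact K \<and> K \<subseteq> D" for K
    proof (rule tendsto_LinfI[OF fdm])
      show "\<exists>B. \<forall>z\<in>space (lebesgue_on K). \<bar>(case z of (t, x) \<Rightarrow> f_eps (\<epsilon> (r k)) ?u ?x t x) - (case z of (t, x) \<Rightarrow> f0 t x)\<bar> \<le> B" for k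
        using fS K unfolding sp D_def r_def by (intro exI[of _ S]) auto
      fix \<eta> :: real assume "\<eta> > 0"
      from fK[OF conjunct1[OF K] conjunct2[OF K] this]
      show "\<forall>\<^sub>F k in sequentially. \<forall>z\<in>space (lebesgue_on K). \<bar>(case z of (t, x) \<Rightarrow> f_eps (\<epsilon> (r k)) ?u ?x t x) - (case z of (t, x) \<Rightarrow> f0 t x)\<bar> \<le> \<eta>"
        unfolding sp r_def by eventually_elim auto
    qed (use K Kl in auto)
    show "p_eps (\<epsilon> (r k)) ?u ?x t x = q_eps (\<epsilon> (r k)) ?u ?x t x - f_eps (\<epsilon> (r k)) ?u ?x t x" for k t x
      by (rule p[OF \<epsilon>0])
    show "tendsto_Linf (lebesgue_on K) (\<lambda>k (t, x). p_eps (\<epsilon> (r k)) ?u ?x t x) (\<lambda>(t, x). q0 t x - f0 t x)"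
      if "compact K \<and> K \<subseteq> D" for K using pK that by blast
    have "(\<lambda>k. p_eps (\<epsilon> (r k)) ?u ?x t x) \<longlonglongrightarrow> q0 t x - f0 t x" if "t \<in> {0..T}" for t x
      unfolding p[OF \<epsilon>0] by (intro tendsto_diff ql[OF that] fl[OF that, folded r_def])
    then show "AE (t, x) in lebesgue_on D. (\<lambda>k. p_eps (\<epsilon> (r k)) ?u ?x t x) \<longlonglongrightarrow> q0 t x - f0 t x" by (rule AE)
  qed
qed

end
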